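(* Let $d\ge1$ and suppose that $A\in M_d(\mathbb Z)$ has $|\det A|=1$. If $\mu\in P(\mathbb T^d)$ satisfies $\sigma_A^*\mu=\mu$, then there is a $\sigma$-invariant trace $\psi_\mu$ on $C(\mathbb T^d)\rtimes_{\alpha_A}\mathbb Z$ such that, for all $m\in\mathbb Z^d$ and $k\in\mathbb Z$, $$\psi_\mu(\bar u_m\bar v^k)=\begin{cases}0&\text{unless $k=0$}\\ \int_{\mathbb T^d}z^m\,d\mu(z)&\text{if $k=0$,}\end{cases}$$ and every $\sigma$-invariant trace on $C(\mathbb T^d)\rtimes_{\alpha_A}\mathbb Z$ has this form.
   Context: $\mathbb T^d=\mathbb R^d/\mathbb Z^d$, with points written $e^{2\pi ix}=(e^{2\pi ix_1},\dots,e^{2\pi ix_d})$; $z^m=\prod_i z_i^{m_i}$ for $m\in\mathbb Z^d$. $\sigma_A:\mathbb T^d\to\mathbb T^d$, $\sigma_A(e^{2\pi ix})=e^{2\pi iAx}$, is a homeomorphism because $|\det A|=1$, and $\alpha_A(f)=f\circ\sigma_A$ is an automorphism of $C(\mathbb T^d)$. $P(\mathbb T^d)$ is the set of Borel probability measures on $\mathbb T^d$, and $\sigma_A^*\mu$ is the measure with $\int f\,d(\sigma_A^*\mu)=\int f\circ\sigma_A\,d\mu$ for $f\in C(\mathbb T^d)$. $C(\mathbb T^d)\rtimes_{\alpha_A}\mathbb Z$ is the usual crossed product; with $B=A^t$, it is generated by a unitary representation $\bar u$ of $\mathbb Z^d$ ($\bar u_m$ is the image of the function $z\mapsto z^m$)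 and a unitary $\bar v$ implementing $\alpha_A$, so that $\bar v\bar u_m\bar v^*=\bar u_{Bm}$, and it is the closed span of the elements $\bar u_m\bar v^k$, $m\in\mathbb Z^d$, $k\in\mathbb Z$. The action $\sigma$ of $\mathbb R$ on it is characterised by $\sigma_t(\bar u_m)=\bar u_m$ and $\sigma_t(\bar v)=e^{it}\bar v$. "Trace" means tracial state; it is $\sigma$-invariant if it is fixed by composition with every $\sigma_t$. *)

theory Defs
  imports "HOL-Probability.Probability" "HOL-Algebra.Module"
begin

section \<open>The torus\<close>

definition torus :: "(complex ^ 'd) set"
  where "torus = {z. \<forall>i. cmod (z $ i) = 1}"

definition torus_exp :: "real ^ 'd \<Rightarrow> complex ^ 'd"
  where "torus_exp x = (\<chi> i. exp (2 * complex_of_real pi * \<i> * complex_of_real (x $ i)))"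

definition torus_char :: "int ^ 'd \<Rightarrow> complex ^ 'd \<Rightarrow> complex"
  where "torus_char m z = (\<Prod>i\<in>UNIV. (z $ i) powi (m $ i))"

text \<open>The map \<open>\<sigma>\<^sub>A\<close> in coordinates; \<open>torus_map_exp\<close> below is the formula
  \<open>\<sigma>\<^sub>A(e\<^bsup>2\<pi>ix\<^esup>) = e\<^bsup>2\<pi>iAx\<^esup>\<close>, which determines it on the torus by \<open>range_torus_exp\<close>.\<close>

definition torus_map :: "int ^ 'd ^ 'd \<Rightarrow> complex ^ 'd \<Rightarrow> complex ^ 'd"
  where "torus_map A z = (\<chi> i. torus_char (A $ i) z)"

lemma range_torus_exp: "range (torus_exp :: real ^ 'd \<Rightarrow> complex ^ 'd) = torus"
proof (intro equalityI subsetI)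
  fix z :: "complex ^ 'd"
  assume "z \<in> range torus_exp"
  then show "z \<in> torus"
    by (auto simp: torus_exp_def torus_def norm_exp_eq_Re)
next
  fix z :: "complex ^ 'd"
  assume z: "z \<in> torus"
  have "torus_exp (\<chi> i. Arg (z $ i) / (2 * pi)) = z"
  proof (subst vec_eq_iff, rule allI)
    fix i
    have "cmod (z $ i) = 1"
      using z by (simp add: torus_def)
    then have "exp (\<i> * complex_of_real (Arg (z $ i))) = z $ i"
      using Arg_eq[of "z $ i"] by force
    then show "torus_exp (\<chi> i. Arg (z $ i) / (2 * pi)) $ i = z $ i"
      by (simp add: torus_exp_def)
  qed
  then show "z \<in> range torus_exp"
    by (metis rangeI)
qed

lemma torus_char_exp:
  "torus_char m (torus_exp x) =
     exp (2 * complex_of_real pi * \<i> * (\<Sum>i\<in>UNIV. of_int (m $ i) * complex_of_real (x $ i)))"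
proof -
  have "exp (2 * complex_of_real pi * \<i> * complex_of_real (x $ i)) powi (m $ i) =
      exp (2 * complex_of_real pi * \<i> * (of_int (m $ i) * complex_of_real (x $ i)))" for i
    by (simp add: exp_power_int mult_ac)
  then show ?thesis
    by (simp add: torus_char_def torus_exp_def sum_distrib_left exp_sum)
qed

lemma torus_map_exp:
  "torus_map A (torus_exp x) = torus_exp ((\<chi> i j. real_of_int (A $ i $ j)) *v x)"
  by (simp add: torus_map_def torus_char_exp matrix_vector_mult_def vec_eq_iff)
     (simp add: torus_exp_def)

definition torus_prob :: "(complex ^ 'd) measure \<Rightarrow> bool"
  where "torus_prob \<mu> \<longleftrightarrow> prob_space \<mu> \<and> sets \<mu> = sets (restrict_space borel torus)"

definition torus_pushforward ::
  "int ^ 'd ^ 'd \<Rightarrow> (complex ^ 'd) measure \<Rightarrow> (complex ^ 'd) measure"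
  where "torus_pushforward A \<mu> = distr \<mu> (restrict_space borel torus) (torus_map A)"

section \<open>*-algebras, C*-seminorms, completions and tracial states\<close>

record 'a star_algebra = "(complex, 'a) module" +
  star :: "'a \<Rightarrow> 'a"

definition cstar_seminorm :: "'a star_algebra \<Rightarrow> ('a \<Rightarrow> real) \<Rightarrow> bool"
  where "cstar_seminorm R p \<longleftrightarrow>
    (\<forall>x\<in>carrier R. 0 \<le> p x) \<and>
    (\<forall>x\<in>carrier R. \<forall>y\<in>carrier R. p (x \<oplus>\<^bsub>R\<^esub> y) \<le> p x + p y) \<and>
    (\<forall>c. \<forall>x\<in>carrier R. p (c \<odot>\<^bsub>R\<^esub> x) = cmod c * p x) \<and>
    (\<forall>x\<in>carrier R. \<forall>y\<in>carrier R. p (x \<otimes>\<^bsub>R\<^esub> y) \<le> p x * p y) \<and>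
    (\<forall>x\<in>carrier R. p (star R x \<otimes>\<^bsub>R\<^esub> x) = (p x)\<^sup>2)"

definition cauchy_seqs :: "'a star_algebra \<Rightarrow> ('a \<Rightarrow> real) \<Rightarrow> (nat \<Rightarrow> 'a) set"
  where "cauchy_seqs R p = {X. (\<forall>n. X n \<in> carrier R) \<and>
    (\<forall>e>0. \<exists>M. \<forall>m\<ge>M. \<forall>n\<ge>M. p (X m \<oplus>\<^bsub>R\<^esub> (- 1) \<odot>\<^bsub>R\<^esub> X n) < e)}"

definition null_rel :: "'a star_algebra \<Rightarrow> ('a \<Rightarrow> real) \<Rightarrow> ((nat \<Rightarrow> 'a) \<times> (nat \<Rightarrow> 'a)) set"
  where "null_rel R p = {(X, Y). X \<in> cauchy_seqs R p \<and> Y \<in> cauchy_seqs R p \<and>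
    (\<lambda>n. p (X n \<oplus>\<^bsub>R\<^esub> (- 1) \<odot>\<^bsub>R\<^esub> Y n)) \<longlonglongrightarrow> 0}"

text \<open>The Hausdorff completion: Cauchy sequences modulo null sequences, with the operations
  defined on representatives.\<close>

definition completion :: "'a star_algebra \<Rightarrow> ('a \<Rightarrow> real) \<Rightarrow> (nat \<Rightarrow> 'a) set star_algebra"
  where "completion R p = \<lparr>
    carrier = cauchy_seqs R p // null_rel R p,
    monoid.mult = (\<lambda>x y. \<Union>X\<in>x. \<Union>Y\<in>y. null_rel R p `` {\<lambda>n. X n \<otimes>\<^bsub>R\<^esub> Y n}),
    one = null_rel R p `` {\<lambda>n. \<one>\<^bsub>R\<^esub>},
    zero = null_rel R p `` {\<lambda>n. \<zero>\<^bsub>R\<^esub>},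
    add = (\<lambda>x y. \<Union>X\<in>x. \<Union>Y\<in>y. null_rel R p `` {\<lambda>n. X n \<oplus>\<^bsub>R\<^esub> Y n}),
    smult = (\<lambda>c x. \<Union>X\<in>x. null_rel R p `` {\<lambda>n. c \<odot>\<^bsub>R\<^esub> X n}),
    star = (\<lambda>x. \<Union>X\<in>x. null_rel R p `` {\<lambda>n. star R (X n)})\<rparr>"

definition tracial_state :: "'a star_algebra \<Rightarrow> ('a \<Rightarrow> complex) \<Rightarrow> bool"
  where "tracial_state M \<psi> \<longleftrightarrow>
    (\<forall>x\<in>carrier M. \<forall>y\<in>carrier M. \<psi> (x \<oplus>\<^bsub>M\<^esub> y) = \<psi> x + \<psi> y) \<and>
    (\<forall>c. \<forall>x\<in>carrier M. \<psi> (c \<odot>\<^bsub>M\<^esub> x) = c * \<psi> x) \<and>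
    (\<forall>x\<in>carrier M. \<psi> (star M x \<otimes>\<^bsub>M\<^esub> x) \<in> \<real>\<^sub>\<ge>\<^sub>0) \<and>
    \<psi> \<one>\<^bsub>M\<^esub> = 1 \<and>
    (\<forall>x\<in>carrier M. \<forall>y\<in>carrier M. \<psi> (x \<otimes>\<^bsub>M\<^esub> y) = \<psi> (y \<otimes>\<^bsub>M\<^esub> x))"

section \<open>The crossed product of the continuous functions on the torus by the integers\<close>

text \<open>Functions on the torus are represented by their extension by zero.\<close>

definition torus_extend :: "(complex ^ 'd \<Rightarrow> complex) \<Rightarrow> complex ^ 'd \<Rightarrow> complex"
  where "torus_extend f z = (if z \<in> torus then f z else 0)"

definition torus_cont :: "(complex ^ 'd \<Rightarrow> complex) set"
  where "torus_cont = {f. continuous_on torus f \<and> torus_extend f = f}"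

definition torus_iter :: "int ^ 'd ^ 'd \<Rightarrow> int \<Rightarrow> complex ^ 'd \<Rightarrow> complex ^ 'd"
  where "torus_iter A k =
    (if 0 \<le> k then torus_map A ^^ nat k else inv_into torus (torus_map A) ^^ nat (- k))"

text \<open>\<open>alpha A k\<close> is the power \<open>\<alpha>\<^sub>A\<^sup>k\<close>, for any integer \<open>k\<close>.\<close>

definition alpha ::
  "int ^ 'd ^ 'd \<Rightarrow> int \<Rightarrow> (complex ^ 'd \<Rightarrow> complex) \<Rightarrow> complex ^ 'd \<Rightarrow> complex"
  where "alpha A k f = torus_extend (f \<circ> torus_iter A k)"

text \<open>The convolution *-algebra of finitely supported functions from the integers to the
  continuous functions on the torus; \<open>a\<close> stands for the formal sum of the \<open>a k v\<^sup>k\<close>, and the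
  operations are those forced by \<open>v f v\<^sup>* = \<alpha>\<^sub>A f\<close>.\<close>

definition conv_algebra :: "int ^ 'd ^ 'd \<Rightarrow> (int \<Rightarrow> complex ^ 'd \<Rightarrow> complex) star_algebra"
  where "conv_algebra A = \<lparr>
    carrier = {a. (\<forall>k. a k \<in> torus_cont) \<and> finite {k. a k \<noteq> (\<lambda>z. 0)}},
    monoid.mult = (\<lambda>a b k z. \<Sum>j | a j \<noteq> (\<lambda>z. 0). a j z * alpha A j (b (k - j)) z),
    one = (\<lambda>k. if k = 0 then torus_extend (\<lambda>z. 1) else (\<lambda>z. 0)),
    zero = (\<lambda>k z. 0),
    add = (\<lambda>a b k z. a k z + b k z),
    smult = (\<lambda>c a k z. c * a k z),
    star = (\<lambda>a k. alpha A k (\<lambda>z. cnj (a (- k) z)))\<rparr>"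

definition l1_norm :: "(int \<Rightarrow> complex ^ 'd \<Rightarrow> complex) \<Rightarrow> real"
  where "l1_norm a = (\<Sum>k | a k \<noteq> (\<lambda>z. 0). SUP z\<in>torus. cmod (a k z))"

text \<open>The universal norm, which defines the full crossed product (for the amenable group of
  integers it is also the reduced one). The C*-seminorms on a *-algebra are exactly the
  functions \<open>a \<mapsto> \<parallel>\<pi> a\<parallel>\<close> for *-homomorphisms \<open>\<pi>\<close> into C*-algebras, hence for *-representations
  on Hilbert spaces, and for the convolution algebra these are the integrated forms of covariant
  representations. All of them are dominated by the 1-norm; that condition is included only to
  make it evident that the supremum is finite.\<close>

definition universal_norm :: "int ^ 'd ^ 'd \<Rightarrow> (int \<Rightarrow> complex ^ 'd \<Rightarrow> complex) \<Rightarrow> real"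
  where "universal_norm A a =
    (SUP p \<in> {p. cstar_seminorm (conv_algebra A) p \<and>
                 (\<forall>b\<in>carrier (conv_algebra A). p b \<le> l1_norm b)}. p a)"

definition crossed_product ::
  "int ^ 'd ^ 'd \<Rightarrow> (nat \<Rightarrow> int \<Rightarrow> complex ^ 'd \<Rightarrow> complex) set star_algebra"
  where "crossed_product A = completion (conv_algebra A) (universal_norm A)"

definition cp_embed :: "int ^ 'd ^ 'd \<Rightarrow> (int \<Rightarrow> complex ^ 'd \<Rightarrow> complex)
    \<Rightarrow> (nat \<Rightarrow> int \<Rightarrow> complex ^ 'd \<Rightarrow> complex) set"
  where "cp_embed A a = null_rel (conv_algebra A) (universal_norm A) `` {\<lambda>n. a}"

definition single :: "(complex ^ 'd \<Rightarrow> complex) \<Rightarrow> int \<Rightarrow> int \<Rightarrow> complex ^ 'd \<Rightarrow> complex"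
  where "single f k = (\<lambda>j. if j = k then torus_extend f else (\<lambda>z. 0))"

definition u_bar :: "int ^ 'd ^ 'd \<Rightarrow> int ^ 'd \<Rightarrow> (nat \<Rightarrow> int \<Rightarrow> complex ^ 'd \<Rightarrow> complex) set"
  where "u_bar A m = cp_embed A (single (torus_char m) 0)"

definition v_bar :: "int ^ 'd ^ 'd \<Rightarrow> (nat \<Rightarrow> int \<Rightarrow> complex ^ 'd \<Rightarrow> complex) set"
  where "v_bar A = cp_embed A (single (\<lambda>z. 1) 1)"

text \<open>The action of \<open>t\<close> multiplies the coefficient of \<open>v\<^sup>k\<close> by \<open>e\<^bsup>ikt\<^esup>\<close>; this preserves the
  universal norm and so passes to the completion.\<close>

definition dual_action :: "int ^ 'd ^ 'd \<Rightarrow> real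
    \<Rightarrow> (nat \<Rightarrow> int \<Rightarrow> complex ^ 'd \<Rightarrow> complex) set
    \<Rightarrow> (nat \<Rightarrow> int \<Rightarrow> complex ^ 'd \<Rightarrow> complex) set"
  where "dual_action A t x = (\<Union>X\<in>x. null_rel (conv_algebra A) (universal_norm A) ``
    {\<lambda>n k z. exp (\<i> * of_int k * complex_of_real t) * X n k z})"

definition invariant_trace :: "int ^ 'd ^ 'd
    \<Rightarrow> ((nat \<Rightarrow> int \<Rightarrow> complex ^ 'd \<Rightarrow> complex) set \<Rightarrow> complex) \<Rightarrow> bool"
  where "invariant_trace A \<psi> \<longleftrightarrow> tracial_state (crossed_product A) \<psi> \<and>
    (\<forall>t. \<forall>x\<in>carrier (crossed_product A). \<psi> (dual_action A t x) = \<psi> x)"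

section \<open>Covariance relation and characterisation of the action\<close>

lemma torus_map_in: "z \<in> torus \<Longrightarrow> torus_map A z \<in> torus"
  unfolding range_torus_exp[symmetric] by (auto simp: torus_map_exp)

lemma torus_char_map: 
  assumes "z \<in> torus"
  shows "torus_char m (torus_map A z) = torus_char (transpose A *v m) z"
proof -
  obtain x where z: "z = torus_exp x"
    using assms by (metis imageE range_torus_exp)
  have "(\<Sum>i\<in>UNIV. of_int (m $ i) * complex_of_real (\<Sum>j\<in>UNIV. of_int (A $ i $ j) * x $ j)) =
      (\<Sum>j\<in>UNIV. (\<Sum>i\<in>UNIV. of_int (A $ i $ j) * of_int (m $ i)) * complex_of_real (x $ j))"
    by (simp add: sum_distrib_left sum_distrib_right mult_ac) (rule sum.swap)
  then show ?thesis
    by (simp add: z torus_map_exp torus_char_exp matrix_vector_mult_def transpose_def)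
qed

lemma single_mult:
  "single f j \<otimes>\<^bsub>conv_algebra A\<^esub> single g k = single (\<lambda>z. f z * alpha A j (torus_extend g) z) (j + k)"
proof (intro ext)
  fix l z
  let ?S = "{i. single f j i \<noteq> (\<lambda>z. 0)}"
  have sub: "?S \<subseteq> {j}" by (auto simp: single_def)
  have "(single f j \<otimes>\<^bsub>conv_algebra A\<^esub> single g k) l z =
     (\<Sum>i\<in>?S. single f j i z * alpha A i (single g k (l - i)) z)"
    by (simp add: conv_algebra_def)
  also have "\<dots> = (\<Sum>i\<in>{j}. single f j i z * alpha A i (single g k (l - i)) z)"
    by (rule sum.mono_neutral_left) (use sub in auto)
  also have "\<dots> = single (\<lambda>z. f z * alpha A j (torus_extend g) z) (j + k) l z"
    by (auto simp: single_def alpha_def torus_extend_def)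
  finally show "(single f j \<otimes>\<^bsub>conv_algebra A\<^esub> single g k) l z = \<dots>" .
qed

text \<open>The covariance relation \<open>v u\<^sub>m = u\<^bsub>Bm\<^esub> v\<close> with \<open>B = A\<^sup>t\<close>.\<close>

lemma covariance:
  "single (\<lambda>z. 1) 1 \<otimes>\<^bsub>conv_algebra A\<^esub> single (torus_char m) 0 =
   single (torus_char (transpose A *v m)) 0 \<otimes>\<^bsub>conv_algebra A\<^esub> single (\<lambda>z. 1) 1"
  unfolding single_mult
  by (auto simp: single_def fun_eq_iff alpha_def torus_extend_def
      torus_iter_def torus_char_map torus_map_in simp del: transpose_matrix_vector)

definition gauge_conv :: "real \<Rightarrow> (int \<Rightarrow> complex ^ 'd \<Rightarrow> complex) \<Rightarrow> int \<Rightarrow> complex ^ 'd \<Rightarrow> complex"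
  where "gauge_conv t a = (\<lambda>k z. exp (\<i> * of_int k * complex_of_real t) * a k z)"

lemma conv_simps:
  "carrier (conv_algebra A) = {a. (\<forall>k. a k \<in> torus_cont) \<and> finite {k. a k \<noteq> (\<lambda>z. 0)}}"
  "a \<oplus>\<^bsub>conv_algebra A\<^esub> b = (\<lambda>k z. a k z + b k z)"
  "c \<odot>\<^bsub>conv_algebra A\<^esub> a = (\<lambda>k z. c * a k z)"
  "a \<otimes>\<^bsub>conv_algebra A\<^esub> b = (\<lambda>k z. \<Sum>j | a j \<noteq> (\<lambda>z. 0). a j z * alpha A j (b (k - j)) z)"
  "star (conv_algebra A) a = (\<lambda>k. alpha A k (\<lambda>z. cnj (a (- k) z)))"
  by (simp_all add: conv_algebra_def)

lemma conv_add_closed: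
  assumes "a \<in> carrier (conv_algebra A)" "b \<in> carrier (conv_algebra A)"
  shows "a \<oplus>\<^bsub>conv_algebra A\<^esub> b \<in> carrier (conv_algebra A)"
proof -
  have "{k. (\<lambda>z. a k z + b k z) \<noteq> (\<lambda>z. 0)} \<subseteq> {k. a k \<noteq> (\<lambda>z. 0)} \<union> {k. b k \<noteq> (\<lambda>z. 0)}"
    by auto
  then have "finite {k. (\<lambda>z. a k z + b k z) \<noteq> (\<lambda>z. 0)}"
    by (rule finite_subset) (use assms in \<open>simp add: conv_simps\<close>)
  moreover have "(\<lambda>z. a k z + b k z) \<in> torus_cont" for k
    using assms by (auto simp: conv_simps torus_cont_def torus_extend_def fun_eq_iff
        intro!: continuous_on_add) (metis add_cancel_right_right)+
  ultimately show ?thesis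
    by (simp add: conv_simps)
qed

lemma conv_scale_closed:
  assumes "a \<in> carrier (conv_algebra A)"
  shows "(\<lambda>k z. c k * a k z) \<in> carrier (conv_algebra A)"
proof -
  have "{k. (\<lambda>z. c k * a k z) \<noteq> (\<lambda>z. 0)} \<subseteq> {k. a k \<noteq> (\<lambda>z. 0)}"
    by auto
  then have "finite {k. (\<lambda>z. c k * a k z) \<noteq> (\<lambda>z. 0)}"
    by (rule finite_subset) (use assms in \<open>simp add: conv_simps\<close>)
  moreover have "(\<lambda>z. c k * a k z) \<in> torus_cont" for k
    using assms by (auto simp: conv_simps torus_cont_def torus_extend_def fun_eq_iff
        intro!: continuous_intros) metis
  ultimately show ?thesis
    by (simp add: conv_simps)
qed

lemma single_closed:
  assumes "continuous_on torus f"
  shows "single f k \<in> carrier (conv_algebra A)"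
proof -
  have "finite {j. single f k j \<noteq> (\<lambda>z. 0)}"
    by (rule finite_subset[of _ "{k}"]) (auto simp: single_def)
  moreover have "continuous_on torus (torus_extend f)"
    using assms by (rule continuous_on_eq) (simp add: torus_extend_def)
  ultimately show ?thesis
    by (auto simp: conv_simps torus_cont_def single_def torus_extend_def fun_eq_iff)
qed

lemma continuous_torus_char: "continuous_on torus (torus_char m)"
  unfolding torus_char_def
  by (intro continuous_intros) (metis (mono_tags, lifting) mem_Collect_eq norm_zero torus_def zero_neq_one)

lemma gauge_closed:
  "a \<in> carrier (conv_algebra A) \<Longrightarrow> gauge_conv t a \<in> carrier (conv_algebra A)"
  unfolding gauge_conv_def by (rule conv_scale_closed)

lemma gauge_supp: "gauge_conv t a k = (\<lambda>z. 0) \<longleftrightarrow> a k = (\<lambda>z. 0)"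
  by (auto simp: gauge_conv_def fun_eq_iff)

lemma gauge_mult:
  "gauge_conv t (a \<otimes>\<^bsub>conv_algebra A\<^esub> b) = gauge_conv t a \<otimes>\<^bsub>conv_algebra A\<^esub> gauge_conv t b"
proof (intro ext)
  fix k z
  have e: "exp (\<i> * of_int k * complex_of_real t) =
      exp (\<i> * of_int j * complex_of_real t) * exp (\<i> * of_int (k - j) * complex_of_real t)" for j
    by (simp add: algebra_simps flip: exp_add)
  have al: "alpha A j (gauge_conv t b l) z = exp (\<i> * of_int l * complex_of_real t) * alpha A j (b l) z"
    for j l by (simp add: alpha_def torus_extend_def gauge_conv_def)
  show "gauge_conv t (a \<otimes>\<^bsub>conv_algebra A\<^esub> b) k z =
      (gauge_conv t a \<otimes>\<^bsub>conv_algebra A\<^esub> gauge_conv t b) k z"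
    unfolding conv_simps gauge_supp al
    unfolding gauge_conv_def sum_distrib_left
  proof (rule sum.cong[OF refl])
    fix j
    show "exp (\<i> * of_int k * complex_of_real t) * (a j z * alpha A j (b (k - j)) z) =
      exp (\<i> * of_int j * complex_of_real t) * a j z *
      (exp (\<i> * of_int (k - j) * complex_of_real t) * alpha A j (b (k - j)) z)"
      unfolding e[of j] by (simp only: mult.assoc mult.left_commute)
  qed
qed

lemma gauge_star: "gauge_conv t (star (conv_algebra A) a) = star (conv_algebra A) (gauge_conv t a)"
  by (auto simp: conv_simps gauge_conv_def alpha_def torus_extend_def fun_eq_iff exp_cnj)

lemma gauge_l1: "l1_norm (gauge_conv t a) = l1_norm a"
  unfolding l1_norm_def gauge_supp
  by (simp add: gauge_conv_def norm_mult norm_exp_eq_Re)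

lemma gauge_seminorm:
  assumes p: "cstar_seminorm (conv_algebra A) p"
  shows "cstar_seminorm (conv_algebra A) (p \<circ> gauge_conv t)"
proof -
  have add: "gauge_conv t (a \<oplus>\<^bsub>conv_algebra A\<^esub> b) =
      gauge_conv t a \<oplus>\<^bsub>conv_algebra A\<^esub> gauge_conv t b" for a b
    by (simp add: conv_simps gauge_conv_def algebra_simps)
  have sc: "gauge_conv t (c \<odot>\<^bsub>conv_algebra A\<^esub> a) = c \<odot>\<^bsub>conv_algebra A\<^esub> gauge_conv t a" for c a
    by (simp add: conv_simps gauge_conv_def algebra_simps)
  show ?thesis
    using p unfolding cstar_seminorm_def
    by (simp add: add sc gauge_mult gauge_star gauge_closed)
qed

abbreviation "l1_seminorms A \<equiv> {p. cstar_seminorm (conv_algebra A) p \<and>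
                 (\<forall>b\<in>carrier (conv_algebra A). p b \<le> l1_norm b)}"

lemma zero_l1_seminorm: "(\<lambda>a. 0) \<in> l1_seminorms (A :: int ^ 'd ^ 'd)"
proof -
  have "0 \<le> l1_norm b" if "b \<in> carrier (conv_algebra A)" for b
    unfolding l1_norm_def
  proof (rule sum_nonneg)
    fix k
    have c: "compact (torus :: (complex ^ 'd) set)"
    proof -
      have "closed (torus :: (complex ^ 'd) set)"
        unfolding torus_def by (intro closed_Collect_all closed_Collect_eq continuous_intros)
      moreover have "norm z \<le> real CARD('d)" if "z \<in> torus" for z :: "complex ^ 'd"
        using that L2_set_le_sum[of UNIV "\<lambda>i. norm (z $ i)"] by (simp add: torus_def norm_vec_def)
      ultimately show ?thesis
        by (metis boundedI compact_eq_bounded_closed)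
    qed
    have "continuous_on torus (\<lambda>z. cmod (b k z))"
      using that by (auto simp: conv_simps torus_cont_def intro: continuous_on_norm)
    then have "bdd_above ((\<lambda>z. cmod (b k z)) ` torus)"
      by (intro bounded_imp_bdd_above compact_imp_bounded compact_continuous_image c)
    moreover have "torus_exp 0 \<in> (torus :: (complex ^ 'd) set)"
      by (metis rangeI range_torus_exp)
    ultimately show "0 \<le> (SUP z\<in>torus. cmod (b k z))"
      by (meson cSUP_upper norm_ge_zero order_trans)
  qed
  then show ?thesis
    by (simp add: cstar_seminorm_def)
qed

lemma universal_norm_upper:
  assumes "p \<in> l1_seminorms A" "a \<in> carrier (conv_algebra A)"
  shows "p a \<le> universal_norm A a"
  unfolding universal_norm_def
  by (rule cSUP_upper) (use assms in \<open>auto intro!: bdd_aboveI2\<close>)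

lemma universal_norm_least:
  assumes "\<And>p. p \<in> l1_seminorms A \<Longrightarrow> p a \<le> c"
  shows "universal_norm A a \<le> c"
  unfolding universal_norm_def
  by (rule cSUP_least) (use assms zero_l1_seminorm in auto)

lemma universal_norm_nonneg:
  "a \<in> carrier (conv_algebra A) \<Longrightarrow> 0 \<le> universal_norm A a"
  using universal_norm_upper[OF zero_l1_seminorm] by fastforce

lemma universal_norm_add:
  assumes "a \<in> carrier (conv_algebra A)" "b \<in> carrier (conv_algebra A)"
  shows "universal_norm A (a \<oplus>\<^bsub>conv_algebra A\<^esub> b) \<le> universal_norm A a + universal_norm A b"
proof (rule universal_norm_least)
  fix p assume p: "p \<in> l1_seminorms A"
  then have "p (a \<oplus>\<^bsub>conv_algebra A\<^esub> b) \<le> p a + p b"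
    using assms by (simp add: cstar_seminorm_def)
  also have "\<dots> \<le> universal_norm A a + universal_norm A b"
    by (intro add_mono universal_norm_upper p assms)
  finally show "p (a \<oplus>\<^bsub>conv_algebra A\<^esub> b) \<le> \<dots>" .
qed

lemma universal_norm_scale_le:
  assumes "a \<in> carrier (conv_algebra A)"
  shows "universal_norm A (c \<odot>\<^bsub>conv_algebra A\<^esub> a) \<le> cmod c * universal_norm A a"
proof (rule universal_norm_least)
  fix p assume p: "p \<in> l1_seminorms A"
  then have "p (c \<odot>\<^bsub>conv_algebra A\<^esub> a) = cmod c * p a"
    using assms by (simp add: cstar_seminorm_def)
  also have "\<dots> \<le> cmod c * universal_norm A a"
    by (intro mult_left_mono universal_norm_upper p assms) simp
  finally show "p (c \<odot>\<^bsub>conv_algebra A\<^esub> a) \<le> \<dots>" .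
qed

lemma universal_norm_gauge_le:
  assumes "a \<in> carrier (conv_algebra A)"
  shows "universal_norm A (gauge_conv t a) \<le> universal_norm A a"
proof (rule universal_norm_least)
  fix p assume p: "p \<in> l1_seminorms A"
  have "p (gauge_conv t b) \<le> l1_norm b" if "b \<in> carrier (conv_algebra A)" for b
  proof -
    have "p (gauge_conv t b) \<le> l1_norm (gauge_conv t b)"
      using p gauge_closed[OF that, of t] by blast
    then show ?thesis
      by (simp only: gauge_l1)
  qed
  with p have "p \<circ> gauge_conv t \<in> l1_seminorms A"
    by (simp add: gauge_seminorm)
  from universal_norm_upper[OF this assms]
  show "p (gauge_conv t a) \<le> universal_norm A a" by simp
qed

lemma lift_const:
  fixes A :: "int ^ 'd ^ 'd"
  assumes a: "a \<in> carrier (conv_algebra A)"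
    and F: "\<And>x. x \<in> carrier (conv_algebra A) \<Longrightarrow> F x \<in> carrier (conv_algebra A)"
    and diff: "\<And>x y. F (\<lambda>k z. x k z - y k z) = (\<lambda>k z. F x k z - F y k z)"
    and bd: "\<And>x. x \<in> carrier (conv_algebra A) \<Longrightarrow> universal_norm A (F x) \<le> C * universal_norm A x"
    and C: "C > 0"
  shows "(\<Union>X\<in>cp_embed A a. null_rel (conv_algebra A) (universal_norm A) `` {\<lambda>n. F (X n)}) =
    cp_embed A (F a)"
proof -
  let ?N = "universal_norm A" and ?R = "conv_algebra A"
  have m: "x \<oplus>\<^bsub>?R\<^esub> (- 1) \<odot>\<^bsub>?R\<^esub> y = (\<lambda>k z. x k z - y k z)" for x y
    by (simp add: conv_simps)
  have mc: "(\<lambda>k z. x k z - y k z) \<in> carrier ?R" if "x \<in> carrier ?R" "y \<in> carrier ?R" for x y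
    using conv_add_closed[OF that(1) conv_scale_closed[OF that(2), of "\<lambda>k. - 1"]]
    by (simp add: conv_simps)
  have sym: "?N (\<lambda>k z. x k z - y k z) \<le> ?N (\<lambda>k z. y k z - x k z)"
    if "x \<in> carrier ?R" "y \<in> carrier ?R" for x y
    using universal_norm_scale_le[OF mc[OF that(2,1)], of "- 1"] by (simp add: conv_simps)
  have tri: "?N (\<lambda>k z. x k z - y k z) \<le> ?N (\<lambda>k z. x k z - w k z) + ?N (\<lambda>k z. w k z - y k z)"
    if "x \<in> carrier ?R" "y \<in> carrier ?R" "w \<in> carrier ?R" for x y w
    using universal_norm_add[OF mc[OF that(1,3)] mc[OF that(3,2)]] by (simp add: conv_simps)
  have z: "?N (\<lambda>k z. x k z - x k z) = 0" if "x \<in> carrier ?R" for x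
    using universal_norm_scale_le[OF that, of 0] universal_norm_nonneg[OF mc[OF that that]]
    by (simp add: conv_simps)
  have const: "(\<lambda>n. b) \<in> cauchy_seqs ?R ?N" if "b \<in> carrier ?R" for b
    using that z[OF that] by (simp add: cauchy_seqs_def m)
  have "null_rel ?R ?N `` {\<lambda>n. F (X n)} = cp_embed A (F a)" if X: "X \<in> cp_embed A a" for X
  proof -
    have Xc: "X n \<in> carrier ?R" for n
      using X by (auto simp: cp_embed_def null_rel_def cauchy_seqs_def)
    have X0: "(\<lambda>n. ?N (\<lambda>k z. a k z - X n k z)) \<longlonglongrightarrow> 0"
      using X by (auto simp: cp_embed_def null_rel_def m)
    have Fb: "?N (\<lambda>k z. F x k z - F y k z) \<le> C * ?N (\<lambda>k z. x k z - y k z)"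
      if "x \<in> carrier ?R" "y \<in> carrier ?R" for x y
      using bd[OF mc[OF that]] by (simp add: diff)
    have FX: "(\<lambda>n. F (X n)) \<in> cauchy_seqs ?R ?N"
      unfolding cauchy_seqs_def m
    proof (intro CollectI conjI allI impI)
      fix e :: real assume "e > 0"
      then have "e / C > 0" using C by simp
      moreover have "X \<in> cauchy_seqs ?R ?N"
        using X by (auto simp: cp_embed_def null_rel_def)
      ultimately obtain M where M: "\<forall>m\<ge>M. \<forall>n\<ge>M. ?N (\<lambda>k z. X m k z - X n k z) < e / C"
        unfolding cauchy_seqs_def m by blast
      then show "\<exists>M. \<forall>m\<ge>M. \<forall>n\<ge>M. ?N (\<lambda>k z. F (X m) k z - F (X n) k z) < e"
      proof (intro exI allI impI)
        fix i j assume "M \<le> i" "M \<le> j"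
        then have "C * ?N (\<lambda>k z. X i k z - X j k z) < e"
          using M C by (simp add: pos_less_divide_eq mult.commute)
        with Fb[OF Xc Xc, of i j] show "?N (\<lambda>k z. F (X i) k z - F (X j) k z) < e"
          by linarith
      qed
    qed (use Xc F in auto)
    have FX0: "(\<lambda>n. ?N (\<lambda>k z. F a k z - F (X n) k z)) \<longlonglongrightarrow> 0"
    proof (rule Lim_null_comparison[OF always_eventually])
      show "\<forall>n. norm (?N (\<lambda>k z. F a k z - F (X n) k z)) \<le> C * ?N (\<lambda>k z. a k z - X n k z)"
      proof
        fix n
        show "norm (?N (\<lambda>k z. F a k z - F (X n) k z)) \<le> C * ?N (\<lambda>k z. a k z - X n k z)"
          using Fb[OF a Xc, of n] universal_norm_nonneg[OF mc[OF F[OF a] F[OF Xc]], of n] by simp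
      qed
      show "(\<lambda>n. C * ?N (\<lambda>k z. a k z - X n k z)) \<longlonglongrightarrow> 0"
        using tendsto_mult_right_zero[OF X0] by simp
    qed
    have "(\<lambda>n. ?N (\<lambda>k z. F (X n) k z - Y n k z)) \<longlonglongrightarrow> 0 \<longleftrightarrow>
          (\<lambda>n. ?N (\<lambda>k z. F a k z - Y n k z)) \<longlonglongrightarrow> 0"
      if Y: "\<And>n. Y n \<in> carrier ?R" for Y
    proof
      assume H: "(\<lambda>n. ?N (\<lambda>k z. F (X n) k z - Y n k z)) \<longlonglongrightarrow> 0"
      show "(\<lambda>n. ?N (\<lambda>k z. F a k z - Y n k z)) \<longlonglongrightarrow> 0"
      proof (rule Lim_null_comparison[OF always_eventually])
        show "\<forall>n. norm (?N (\<lambda>k z. F a k z - Y n k z)) \<le>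
          ?N (\<lambda>k z. F a k z - F (X n) k z) + ?N (\<lambda>k z. F (X n) k z - Y n k z)"
        proof
          fix n
          show "norm (?N (\<lambda>k z. F a k z - Y n k z)) \<le>
            ?N (\<lambda>k z. F a k z - F (X n) k z) + ?N (\<lambda>k z. F (X n) k z - Y n k z)"
            using tri[OF F[OF a] Y F[OF Xc], of n n] universal_norm_nonneg[OF mc[OF F[OF a] Y], of n]
            by simp
        qed
      qed (use tendsto_add[OF FX0 H] in simp)
    next
      assume H: "(\<lambda>n. ?N (\<lambda>k z. F a k z - Y n k z)) \<longlonglongrightarrow> 0"
      show "(\<lambda>n. ?N (\<lambda>k z. F (X n) k z - Y n k z)) \<longlonglongrightarrow> 0"
      proof (rule Lim_null_comparison[OF always_eventually])
        show "\<forall>n. norm (?N (\<lambda>k z. F (X n) k z - Y n k z)) \<le>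
          ?N (\<lambda>k z. F a k z - F (X n) k z) + ?N (\<lambda>k z. F a k z - Y n k z)"
        proof
          fix n
          show "norm (?N (\<lambda>k z. F (X n) k z - Y n k z)) \<le>
            ?N (\<lambda>k z. F a k z - F (X n) k z) + ?N (\<lambda>k z. F a k z - Y n k z)"
            using tri[OF F[OF Xc] Y F[OF a], of n n] sym[OF F[OF Xc] F[OF a], of n]
              universal_norm_nonneg[OF mc[OF F[OF Xc] Y], of n n] by simp
        qed
      qed (use tendsto_add[OF FX0 H] in simp)
    qed
    then show ?thesis
      using FX const[OF F[OF a]]
      by (auto simp: cp_embed_def null_rel_def m cauchy_seqs_def)
  qed
  moreover have "(\<lambda>n. a) \<in> cp_embed A a"
    using const[OF a] z[OF a] by (simp add: cp_embed_def null_rel_def m)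
  ultimately show ?thesis
    by blast
qed

lemma dual_action_embed:
  assumes "a \<in> carrier (conv_algebra A)"
  shows "dual_action A t (cp_embed A a) = cp_embed A (gauge_conv t a)"
  unfolding dual_action_def gauge_conv_def[symmetric]
  by (rule lift_const[where C = 1])
     (use assms in \<open>auto simp: gauge_closed universal_norm_gauge_le\<close>,
       simp add: gauge_conv_def algebra_simps)

lemma smult_embed:
  assumes "a \<in> carrier (conv_algebra A)"
  shows "c \<odot>\<^bsub>crossed_product A\<^esub> cp_embed A a = cp_embed A (\<lambda>k z. c * a k z)"
proof -
  have "c \<odot>\<^bsub>crossed_product A\<^esub> cp_embed A a = (\<Union>X\<in>cp_embed A a.
      null_rel (conv_algebra A) (universal_norm A) `` {\<lambda>n k z. c * X n k z})"
    by (simp add: crossed_product_def completion_def conv_simps)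
  also have "\<dots> = cp_embed A (\<lambda>k z. c * a k z)"
  proof (rule lift_const[where C = "cmod c + 1" and F = "\<lambda>x k z. c * x k z"])
    show "universal_norm A (\<lambda>k z. c * x k z) \<le> (cmod c + 1) * universal_norm A x"
      if "x \<in> carrier (conv_algebra A)" for x
      using universal_norm_scale_le[OF that, of c] universal_norm_nonneg[OF that]
      by (simp add: conv_simps algebra_simps)
    show "0 < cmod c + 1"
      by (simp add: add_nonneg_pos)
  qed (simp_all add: assms conv_scale_closed algebra_simps del: conv_simps)
  finally show ?thesis .
qed

text \<open>The two identities that characterise the action of the reals.\<close>

lemma dual_action_u: "dual_action A t (u_bar A m) = u_bar A m"
  unfolding u_bar_def dual_action_embed[OF single_closed[OF continuous_torus_char]]
  by (rule arg_cong[of _ _ "cp_embed A"]) (auto simp: gauge_conv_def single_def)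

lemma dual_action_v: "dual_action A t (v_bar A) = exp (\<i> * t) \<odot>\<^bsub>crossed_product A\<^esub> v_bar A"
  unfolding v_bar_def dual_action_embed[OF single_closed[OF continuous_on_const]]
    smult_embed[OF single_closed[OF continuous_on_const]]
  by (rule arg_cong[of _ _ "cp_embed A"]) (auto simp: gauge_conv_def single_def fun_eq_iff)

end

theory Submission
  imports Defs
begin

text \<open>Write an element of the convolution algebra as a finite sum of terms \<open>a\<^sub>k v\<^sup>k\<close> with
  continuous coefficients. The correspondence between invariant measures and invariant traces is
  \<open>a \<mapsto> \<integral>a\<^sub>0 d\<mu>\<close>.

  From a measure to a trace. Substituting powers of \<open>\<sigma>\<^sub>A\<close> under the integral shows that the
  functional \<open>a \<mapsto> \<integral>a\<^sub>0 d\<mu>\<close> is tracial (\<open>conv_trace_commute\<close>) and that its value at \<open>a\<^sup>* a\<close> is the sum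
  of the \<open>\<integral>|a\<^sub>k|\<^sup>2 d\<mu>\<close> (\<open>conv_trace_star_mult\<close>), so it is positive. It extends to the crossed product
  once it is bounded by the universal norm. For this, the operator norm of left multiplication in
  the GNS representation of the functional is a C*-seminorm (\<open>cstar_seminorm_gns_op_norm\<close>), it
  dominates the functional by the Cauchy-Schwarz inequality, and it lies below the 1-norm, hence
  below the universal norm (\<open>conv_trace_le_universal_norm\<close>). The functional reads only the coefficient
  of \<open>v\<^sup>0\<close>, which the action of the reals fixes.

  From a trace to a measure. A trace restricts to a positive functional on the continuous
  functions, which a measure represents (\<open>riesz_representation\<close>). Since \<open>f \<circ> \<sigma>\<^sub>A = v f v\<^sup>*\<close>, traciality
  gives \<open>f\<close> and \<open>f \<circ> \<sigma>\<^sub>A\<close> the same integral, and a finite measure is determined by its integrals of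
  continuous functions (\<open>measure_eqI_continuous\<close>), so the measure is invariant. The action multiplies
  \<open>f v\<^sup>k\<close> by \<open>e\<^bsup>ikt\<^esup>\<close>; for \<open>k \<noteq> 0\<close> this forces an invariant trace to vanish there
  (\<open>trace_single_off_diagonal\<close>).

  The hypothesis on the determinant makes \<open>\<sigma>\<^sub>A\<close> bijective (\<open>bij_betw_torus_map\<close>), so that its negative
  powers, and with them the convolution product and involution, behave as they should.\<close>

section \<open>The Riesz representation theorem on compact metric spaces\<close>

lemma sets_restrict_borel_closed:
  assumes K: "closed K"
  shows "sets (restrict_space borel K) = sigma_sets K {F. closed F \<and> F \<subseteq> K}"
proof -
  have "sets (restrict_space borel K) = (\<inter>) K ` sigma_sets UNIV (Collect closed)"
    by (simp add: sets_restrict_space borel_eq_closed)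
  also have "\<dots> = sigma_sets K ((\<inter>) K ` Collect closed)"
    using sigma_sets_Int[of K UNIV "Collect closed"] K
    by (simp add: borel_eq_closed flip: sets_measure_of)
  also have "(\<inter>) K ` Collect closed = {F. closed F \<and> F \<subseteq> K}"
    using K by (auto intro!: image_eqI)
  finally show ?thesis .
qed

text \<open>Functions live on the whole type. Monotonicity with respect to the order on \<open>K\<close> expresses
  positivity and also that \<open>L f\<close> depends only on the restriction of \<open>f\<close> to \<open>K\<close>.\<close>

locale positive_functional =
  fixes K :: "'a::metric_space set" and L :: "('a \<Rightarrow> real) \<Rightarrow> real"
  assumes compact: "compact K"
    and add: "continuous_on K f \<Longrightarrow> continuous_on K g \<Longrightarrow> L (\<lambda>x. f x + g x) = L f + L g"
    and scale: "continuous_on K f \<Longrightarrow> L (\<lambda>x. c * f x) = c * L f"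
    and mono: "continuous_on K f \<Longrightarrow> continuous_on K g \<Longrightarrow> (\<And>x. x \<in> K \<Longrightarrow> f x \<le> g x) \<Longrightarrow> L f \<le> L g"
begin

definition covers :: "('a \<Rightarrow> ennreal) \<Rightarrow> (nat \<Rightarrow> 'a \<Rightarrow> real) set"
  where "covers g = {F. (\<forall>n. continuous_on K (F n)) \<and> (\<forall>n. \<forall>x\<in>K. 0 \<le> F n x) \<and>
    (\<forall>x\<in>K. g x \<le> (\<Sum>n. ennreal (F n x)))}"

text \<open>The Daniell upper integral attached to \<open>L\<close>. It serves functions and, through indicators, sets
  at once, which is what makes the comparison of \<open>L\<close> with the integral short.\<close>

definition upper :: "('a \<Rightarrow> ennreal) \<Rightarrow> ennreal"
  where "upper g = (INF F\<in>covers g. \<Sum>n. ennreal (L (F n)))"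

lemma L_zero: "L (\<lambda>x. 0) = 0"
  using scale[of "\<lambda>x. 0" 0] by simp

lemma L_nonneg: "continuous_on K f \<Longrightarrow> (\<And>x. x \<in> K \<Longrightarrow> 0 \<le> f x) \<Longrightarrow> 0 \<le> L f"
  using mono[of "\<lambda>x. 0" f] by (simp add: L_zero)

lemma L_sum:
  assumes "finite I" "\<And>i. i \<in> I \<Longrightarrow> continuous_on K (f i)"
  shows "L (\<lambda>x. \<Sum>i\<in>I. f i x) = (\<Sum>i\<in>I. L (f i))"
  using assms by (induction I rule: finite_induct) (auto simp: L_zero add continuous_on_sum)

lemma coversD:
  assumes "F \<in> covers g"
  shows "continuous_on K (F n)" "x \<in> K \<Longrightarrow> 0 \<le> F n x" "x \<in> K \<Longrightarrow> g x \<le> (\<Sum>n. ennreal (F n x))"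
    "0 \<le> L (F n)"
  using assms by (auto simp: covers_def intro: L_nonneg)

lemma upper_le: "F \<in> covers g \<Longrightarrow> upper g \<le> (\<Sum>n. ennreal (L (F n)))"
  unfolding upper_def by (rule INF_lower)

lemma upper_mono: "(\<And>x. x \<in> K \<Longrightarrow> g x \<le> h x) \<Longrightarrow> upper g \<le> upper h"
  unfolding upper_def by (rule INF_superset_mono) (use order_trans in \<open>unfold covers_def, blast\<close>, simp)

text \<open>Covers of the \<open>g i\<close> that are optimal up to \<open>e / 2\<^sup>i\<^sup>+\<^sup>1\<close> merge, along a pairing of the
  natural numbers, into one cover of the sum.\<close>

lemma upper_suminf: "upper (\<lambda>x. \<Sum>i. g i x) \<le> (\<Sum>i. upper (g i))"
proof (rule ennreal_le_epsilon)
  fix e :: real assume "0 < e" "(\<Sum>i. upper (g i)) < top_class.top"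
  then have *: "upper (g i) < upper (g i) + e * (1/2) ^ Suc i" for i
    by (auto simp add: less_top dest!: ennreal_suminf_lessD)
  have "\<exists>F\<in>covers (g i). (\<Sum>n. ennreal (L (F n))) < upper (g i) + e * (1/2) ^ Suc i" for i
    using *[of i] unfolding upper_def[of "g i"] INF_less_iff .
  then obtain F where F: "F i \<in> covers (g i)"
    "(\<Sum>n. ennreal (L (F i n))) < upper (g i) + e * (1/2) ^ Suc i" for i
    by metis
  define G where "G = (\<lambda>k. case prod_decode k of (i, n) \<Rightarrow> F i n)"
  have "(\<Sum>k. ennreal (G k x)) = (\<Sum>i. \<Sum>n. ennreal (F i n x))" for x
    unfolding G_def using suminf_ennreal_2dimen[of _ "\<lambda>(i, n). ennreal (F i n x)"]
    by (simp add: split_beta)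
  then have "G \<in> covers (\<lambda>x. \<Sum>i. g i x)"
    unfolding covers_def using coversD[OF F(1)]
    by (auto simp: G_def split_beta intro!: suminf_le)
  then have "upper (\<lambda>x. \<Sum>i. g i x) \<le> (\<Sum>k. ennreal (L (G k)))"
    by (rule upper_le)
  also have "\<dots> = (\<Sum>i. \<Sum>n. ennreal (L (F i n)))"
    unfolding G_def using suminf_ennreal_2dimen[of _ "\<lambda>(i, n). ennreal (L (F i n))"]
    by (simp add: split_beta)
  also have "\<dots> \<le> (\<Sum>i. upper (g i) + e * (1/2) ^ Suc i)"
    using F(2) by (intro suminf_le less_imp_le) auto
  also have "... = (\<Sum>i. upper (g i)) + (\<Sum>i. ennreal e * ennreal ((1/2) ^ Suc i))"
    using \<open>0 < e\<close> by (subst suminf_add[symmetric])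
                     (auto simp del: ennreal_suminf_cmult simp add: ennreal_mult[symmetric])
  also have "\<dots> = (\<Sum>i. upper (g i)) + e"
    unfolding ennreal_suminf_cmult
    by (subst suminf_ennreal_eq[OF zero_le_power power_half_series]) auto
  finally show "upper (\<lambda>x. \<Sum>i. g i x) \<le> (\<Sum>i. upper (g i)) + e" .
qed

text \<open>The argument of Dini's theorem: by compactness finitely many terms of a cover of \<open>f\<close> already
  exceed \<open>f - e\<close> everywhere, so monotonicity of \<open>L\<close> upgrades to countable subadditivity.\<close>

lemma upper_continuous:
  assumes f: "continuous_on K f" "\<And>x. x \<in> K \<Longrightarrow> 0 \<le> f x"
  shows "upper (\<lambda>x. ennreal (f x)) = ennreal (L f)"
proof (rule antisym)
  let ?F = "\<lambda>n::nat. if n = 0 then f else (\<lambda>x. 0)"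
  have s: "(\<Sum>n. ennreal (?F n x)) = ennreal (f x)" for x
    by (subst suminf_finite[of "{0}"]) auto
  have "?F \<in> covers (\<lambda>x. ennreal (f x))"
    using f by (auto simp: covers_def s)
  then have "upper (\<lambda>x. ennreal (f x)) \<le> (\<Sum>n. ennreal (L (?F n)))"
    by (rule upper_le)
  also have "\<dots> = ennreal (L f)"
    by (subst suminf_finite[of "{0}"]) (auto simp: L_zero)
  finally show "upper (\<lambda>x. ennreal (f x)) \<le> ennreal (L f)" .
next
  show "ennreal (L f) \<le> upper (\<lambda>x. ennreal (f x))"
    unfolding upper_def
  proof (rule INF_greatest)
    fix F assume F: "F \<in> covers (\<lambda>x. ennreal (f x))"
    have *: "L f \<le> (\<Sum>n<N. L (F n)) + e * L (\<lambda>x. 1)"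
      if N: "\<And>x. x \<in> K \<Longrightarrow> f x < (\<Sum>n<N. F n x) + e" for N e
    proof -
      have "L f \<le> L (\<lambda>x. (\<Sum>n<N. F n x) + e * 1)"
        using N coversD(1)[OF F] f
        by (intro mono continuous_intros) (auto simp: less_imp_le)
      also have "\<dots> = (\<Sum>n<N. L (F n)) + e * L (\<lambda>x. 1)"
        using coversD(1)[OF F] scale[of "\<lambda>x. 1" e]
          by (subst add) (auto intro!: continuous_intros simp: L_sum)
      finally show ?thesis .
    qed
    have ex: "\<exists>N. \<forall>x\<in>K. f x < (\<Sum>n<N. F n x) + e" if e: "0 < e" for e
    proof -
      have "\<exists>T. open T \<and> T \<inter> K = {x\<in>K. f x < (\<Sum>n<N. F n x) + e}" for N
      proof -
        have "continuous_on K (\<lambda>x. f x - (\<Sum>n<N. F n x))"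
          using coversD(1)[OF F] f by (intro continuous_intros) auto
        then obtain T where "open T" "T \<inter> K = (\<lambda>x. f x - (\<Sum>n<N. F n x)) -` {..<e} \<inter> K"
          unfolding continuous_on_open_invariant by (meson open_lessThan)
        then show ?thesis by (intro exI[of _ T]) auto
      qed
      then obtain T where T: "\<And>N. open (T N)"
        "\<And>N. T N \<inter> K = {x\<in>K. f x < (\<Sum>n<N. F n x) + e}"
        by metis
      have "\<exists>N. x \<in> T N" if x: "x \<in> K" for x
      proof -
        have "ennreal (f x) < (\<Sum>n. ennreal (F n x)) + e"
        proof (cases "(\<Sum>n. ennreal (F n x)) = top_class.top")
          case False
          then show ?thesis
            using coversD(3)[OF F x] e
            by (metis ennreal_add_left_cancel_less add.right_neutral ennreal_less_zero_iff
                order_le_less_trans infinity_ennreal_def)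
        qed auto
        also have "\<dots> = (SUP N. (\<Sum>n<N. ennreal (F n x)) + e)"
          unfolding suminf_eq_SUP by (simp add: ennreal_SUP_add_left)
        finally obtain N where "ennreal (f x) < (\<Sum>n<N. ennreal (F n x)) + e"
          unfolding less_SUP_iff by auto
        also have "\<dots> = ennreal ((\<Sum>n<N. F n x) + e)"
          using coversD(2)[OF F x] e by (simp add: sum_nonneg)
        finally have "f x < (\<Sum>n<N. F n x) + e"
          using f(2)[OF x] by (simp add: ennreal_less_iff)
        then show ?thesis using T(2)[of N] x by auto
      qed
      then have "K \<subseteq> (\<Union>N. T N)" by auto
      then obtain S where S: "finite S" "K \<subseteq> (\<Union>N\<in>S. T N)"
        by (rule compactE_image[OF compact T(1)])
      have "f x < (\<Sum>n<Max (insert 0 S). F n x) + e" if x: "x \<in> K" for x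
      proof -
        obtain N where N: "N \<in> S" "x \<in> T N" using S x by auto
        then have "f x < (\<Sum>n<N. F n x) + e" using T(2)[of N] x by auto
        also have "(\<Sum>n<N. F n x) \<le> (\<Sum>n<Max (insert 0 S). F n x)"
          using coversD(2)[OF F x] N S(1) by (intro sum_mono2) (auto simp: less_le_trans)
        finally show ?thesis by simp
      qed
      then show ?thesis by blast
    qed
    have L1: "0 \<le> L (\<lambda>x. 1)" by (auto intro: L_nonneg)
    show "ennreal (L f) \<le> (\<Sum>n. ennreal (L (F n)))"
    proof (rule ennreal_le_epsilon)
      fix e :: real assume e: "0 < e"
      let ?d = "e / (L (\<lambda>x. 1) + 1)"
      have d: "0 < ?d" using e L1 by auto
      obtain N where N: "\<forall>x\<in>K. f x < (\<Sum>n<N. F n x) + ?d" using ex[OF d] by blast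
      have "L f \<le> (\<Sum>n<N. L (F n)) + ?d * L (\<lambda>x. 1)" using * N by blast
      also have "?d * L (\<lambda>x. 1) \<le> e" using e L1 by (simp add: field_simps)
      finally have "ennreal (L f) \<le> ennreal ((\<Sum>n<N. L (F n)) + e)" by (simp add: ennreal_leI)
      also have "\<dots> = (\<Sum>n<N. ennreal (L (F n))) + ennreal e"
        using coversD(4)[OF F] e by (simp add: sum_nonneg)
      also have "(\<Sum>n<N. ennreal (L (F n))) \<le> (\<Sum>n. ennreal (L (F n)))"
        by (intro sum_le_suminf) auto
      finally show "ennreal (L f) \<le> (\<Sum>n. ennreal (L (F n))) + ennreal e" by simp
    qed
  qed
qed

lemma upper_zero: "upper (\<lambda>x. 0) = 0"
  using upper_continuous[of "\<lambda>x. 0"] by (simp add: L_zero)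

lemma upper_sum:
  fixes n :: nat
  shows "upper (\<lambda>x. \<Sum>i<n. g i x) \<le> (\<Sum>i<n. upper (g i))"
proof -
  have "upper (\<lambda>x. \<Sum>i. if i < n then g i x else 0) \<le> (\<Sum>i. upper (\<lambda>x. if i < n then g i x else 0))"
    by (rule upper_suminf)
  moreover have "(\<Sum>i. if i < n then g i x else 0) = (\<Sum>i<n. g i x)" for x
    by (subst suminf_finite[of "{..<n}"]) auto
  moreover have "(\<Sum>i. upper (\<lambda>x. if i < n then g i x else 0)) = (\<Sum>i<n. upper (g i))"
    by (subst suminf_finite[of "{..<n}"]) (auto simp: upper_zero)
  ultimately show ?thesis by simp
qed

text \<open>Superadditivity along a continuous partition of unity, the counterpart of \<open>upper_suminf\<close>: a
  cover of \<open>g\<close>, multiplied by \<open>u i\<close>, covers the piece \<open>g * u i\<close>, and the costs add up.\<close>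

lemma upper_partition:
  fixes u :: "'i \<Rightarrow> 'a \<Rightarrow> real"
  assumes I: "finite I" and u: "\<And>i. i \<in> I \<Longrightarrow> continuous_on K (u i)"
    "\<And>i x. i \<in> I \<Longrightarrow> x \<in> K \<Longrightarrow> 0 \<le> u i x" "\<And>x. x \<in> K \<Longrightarrow> (\<Sum>i\<in>I. u i x) \<le> 1"
  shows "(\<Sum>i\<in>I. upper (\<lambda>x. g x * ennreal (u i x))) \<le> upper g"
  unfolding upper_def[of g]
proof (rule INF_greatest)
  fix F assume F: "F \<in> covers g"
  have "(\<lambda>n x. F n x * u i x) \<in> covers (\<lambda>x. g x * ennreal (u i x))" if i: "i \<in> I" for i
    unfolding covers_def using coversD[OF F] u i
    by (auto intro!: continuous_intros mult_right_mono simp: ennreal_mult ennreal_suminf_multc)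
  then have "(\<Sum>i\<in>I. upper (\<lambda>x. g x * ennreal (u i x))) \<le>
      (\<Sum>i\<in>I. \<Sum>n. ennreal (L (\<lambda>x. F n x * u i x)))"
    by (intro sum_mono upper_le)
  also have "\<dots> = (\<Sum>n. \<Sum>i\<in>I. ennreal (L (\<lambda>x. F n x * u i x)))"
    by (subst suminf_sum) auto
  also have "\<dots> \<le> (\<Sum>n. ennreal (L (F n)))"
  proof (rule suminf_le)
    fix n
    have "(\<Sum>i\<in>I. ennreal (L (\<lambda>x. F n x * u i x))) = ennreal (\<Sum>i\<in>I. L (\<lambda>x. F n x * u i x))"
      using coversD[OF F] u by (subst sum_ennreal) (auto intro!: L_nonneg continuous_intros)
    also have "(\<Sum>i\<in>I. L (\<lambda>x. F n x * u i x)) = L (\<lambda>x. \<Sum>i\<in>I. F n x * u i x)"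
      using coversD[OF F] u I by (subst L_sum) (auto intro!: continuous_intros)
    also have "\<dots> \<le> L (F n)"
      using coversD[OF F] u by (intro mono)
        (auto intro!: continuous_intros mult_left_le simp flip: sum_distrib_left)
    finally show "(\<Sum>i\<in>I. ennreal (L (\<lambda>x. F n x * u i x))) \<le> ennreal (L (F n))"
      by (simp add: ennreal_leI)
  qed auto
  finally show "(\<Sum>i\<in>I. upper (\<lambda>x. g x * ennreal (u i x))) \<le> (\<Sum>n. ennreal (L (F n)))" .
qed

definition outer :: "'a set \<Rightarrow> ennreal"
  where "outer E = upper (indicator E)"

lemma outer_measure_space_outer: "outer_measure_space (Pow K) outer"
proof -
  have "outer (\<Union> (range E)) \<le> (\<Sum>i. outer (E i))" for E :: "nat \<Rightarrow> 'a set"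
  proof -
    have "outer (\<Union> (range E)) \<le> upper (\<lambda>x. \<Sum>i. indicator (E i) x)"
      unfolding outer_def
    proof (rule upper_mono)
      fix x
      show "indicator (\<Union> (range E)) x \<le> (\<Sum>i. indicator (E i) x :: ennreal)"
      proof (cases "x \<in> \<Union> (range E)")
        case True
        then obtain i where "x \<in> E i" by auto
        then have "indicator (\<Union> (range E)) x = (indicator (E i) x :: ennreal)"
          by (auto simp: indicator_def)
        also have "\<dots> = (\<Sum>j\<in>{i}. indicator (E j) x)" by simp
        also have "\<dots> \<le> (\<Sum>i. indicator (E i) x)" by (intro sum_le_suminf) auto
        finally show ?thesis .
      qed auto
    qed
    also have "\<dots> \<le> (\<Sum>i. outer (E i))"
      unfolding outer_def by (rule upper_suminf)
    finally show ?thesis .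
  qed
  moreover have "outer {} = 0"
    using upper_zero by (simp add: outer_def indicator_def[abs_def])
  ultimately show ?thesis
    unfolding outer_measure_space_def positive_def increasing_def countably_subadditive_def
    by (auto simp: outer_def intro!: upper_mono split: split_indicator)
qed

text \<open>Continuous cut-offs \<open>h n\<close> decrease from \<open>1\<close> to the indicator of \<open>F\<close>, so \<open>h n\<close> and the
  increments \<open>h k - h (k + 1)\<close> with \<open>k < n\<close> form a partition of unity. By \<open>upper_partition\<close> the
  pieces that they cut out of \<open>E\<close> cost at most \<open>outer E\<close>; the first dominates \<open>E \<inter> F\<close>, and by
  \<open>upper_suminf\<close> the increments, taken over all \<open>k\<close>, dominate \<open>E - F\<close>.\<close>

lemma closed_in_lambda_system:
  assumes F: "closed F" "F \<subseteq> K"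
  shows "F \<in> lambda_system K (Pow K) outer"
proof (cases "F = {}")
  case True
  then show ?thesis
    using algebra.lambda_system_empty[OF algebra_Pow] outer_measure_space_outer
    by (auto simp: outer_measure_space_def)
next
  case ne: False
  define h where "h = (\<lambda>(n::nat) x. max 0 (1 - real n * infdist x F))"
  have hc: "continuous_on K (h n)" for n
    unfolding h_def by (intro continuous_intros)
  have h0: "h 0 x = 1" and hF: "x \<in> F \<Longrightarrow> h n x = 1" and hpos: "0 \<le> h n x" for n x
    by (auto simp: h_def)
  have hdec: "h (Suc n) x \<le> h n x" for n x
    unfolding h_def using infdist_nonneg[of x F]
    by (intro max.mono diff_left_mono mult_right_mono) auto
  have h_zero: "\<exists>n. h n x = 0" if "x \<notin> F" for x
  proof -
    have "0 < infdist x F"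
      using infdist_pos_not_in_closed[OF F(1) ne that] .
    then obtain n where "1 < real n * infdist x F"
      using reals_Archimedean3 by blast
    then show ?thesis by (intro exI[of _ n]) (auto simp: h_def)
  qed
  have tele: "(\<Sum>k<n. h k x - h (Suc k) x) = 1 - h n x" for n x
    using sum_lessThan_telescope'[of "\<lambda>k. h k x" n] by (simp add: h0)
  have le: "outer (E \<inter> F) + outer (E - F) \<le> outer E" if "E \<subseteq> K" for E
  proof -
    define w where "w = (\<lambda>k. upper (\<lambda>x. indicator E x * ennreal (h k x - h (Suc k) x)))"
    have "outer (E - F) \<le> upper (\<lambda>x. \<Sum>k. indicator E x * ennreal (h k x - h (Suc k) x))"
      unfolding outer_def
    proof (rule upper_mono)
      fix x
      show "indicator (E - F) x \<le> (\<Sum>k. indicator E x * ennreal (h k x - h (Suc k) x))"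
      proof (cases "x \<in> E - F")
        case True
        then obtain n where n: "h n x = 0" using h_zero by auto
        have "(\<Sum>k<n. ennreal (h k x - h (Suc k) x)) = 1"
          by (subst sum_ennreal) (auto simp: tele n hdec)
        moreover have "(\<Sum>k<n. ennreal (h k x - h (Suc k) x)) \<le> (\<Sum>k. ennreal (h k x - h (Suc k) x))"
          by (intro sum_le_suminf) auto
        ultimately show ?thesis using True by auto
      qed auto
    qed
    also have "\<dots> \<le> (\<Sum>k. w k)"
      unfolding w_def by (rule upper_suminf)
    finally have "outer (E \<inter> F) + outer (E - F) \<le> outer (E \<inter> F) + (\<Sum>k. w k)"
      by (rule add_left_mono)
    also have "\<dots> = (\<Sum>k. w k) + outer (E \<inter> F)" by (rule add.commute)
    also have "\<dots> \<le> outer E"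
    proof (rule ennreal_suminf_bound_add)
      fix n
      let ?u = "\<lambda>i x. if i < n then h i x - h (Suc i) x else h n x"
      have "(\<Sum>k<n. w k) + outer (E \<inter> F) \<le>
          (\<Sum>k<n. w k) + upper (\<lambda>x. indicator E x * ennreal (h n x))"
        unfolding outer_def
        by (intro add_left_mono upper_mono) (auto simp: hF split: split_indicator)
      also have "\<dots> = (\<Sum>i<Suc n. upper (\<lambda>x. indicator E x * ennreal (?u i x)))"
        by (simp add: w_def)
      also have "\<dots> \<le> upper (indicator E)"
      proof (rule upper_partition)
        show "continuous_on K (?u i)" for i
          using hc by (cases "i < n") (auto intro!: continuous_intros)
      qed (auto simp: hdec hpos tele)
      finally show "(\<Sum>k<n. w k) + outer (E \<inter> F) \<le> outer E" by (simp add: outer_def)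
    qed
    finally show ?thesis .
  qed
  have ge: "outer E \<le> outer (E \<inter> F) + outer (E - F)" for E
  proof -
    have "outer E \<le> upper (\<lambda>x. \<Sum>i<Suc (Suc 0). if i = 0 then indicator (E \<inter> F) x else indicator (E - F) x)"
      unfolding outer_def by (intro upper_mono) (auto split: split_indicator)
    also have "\<dots> \<le> (\<Sum>i<Suc (Suc 0). upper (\<lambda>x. if i = 0 then indicator (E \<inter> F) x else indicator (E - F) x))"
      by (rule upper_sum)
    finally show ?thesis by (simp add: outer_def)
  qed
  show ?thesis
    unfolding algebra.lambda_system_eq[OF algebra_Pow]
    using F(2) le ge by (auto intro: antisym)
qed

lemma ex_outer_measure:
  "\<exists>M. sets M = sets (restrict_space borel K) \<and> (\<forall>E\<in>sets M. emeasure M E = outer E)"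
proof (intro exI conjI ballI)
  let ?B = "sets (restrict_space borel K)"
  let ?M = "measure_of K ?B outer"
  have K: "space (restrict_space borel K) = K"
    using compact by (simp add: space_restrict_space)
  then have sa: "sigma_algebra K ?B"
    using sets.sigma_algebra_axioms[of "restrict_space borel K"] by simp
  have ms: "measure_space K (lambda_system K (Pow K) outer) outer"
    by (rule sigma_algebra.caratheodory_lemma[OF sigma_algebra_Pow outer_measure_space_outer])
  have "?B \<subseteq> lambda_system K (Pow K) outer"
    unfolding sets_restrict_borel_closed[OF compact_imp_closed[OF compact]]
    using ms closed_in_lambda_system
    by (intro sigma_algebra.sigma_sets_subset) (auto simp: measure_space_def)
  then have "measure_space K ?B outer"
    by (rule measure_down[OF ms sa])
  then have m: "positive ?B outer" "countably_additive ?B outer"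
    by (auto simp: measure_space_def)
  show s: "sets ?M = ?B"
    by (rule sigma_algebra.sets_measure_of_eq[OF sa])
  show "emeasure ?M E = outer E" if "E \<in> sets ?M" for E
    using that unfolding s by (rule emeasure_measure_of_sigma[OF sa m])
qed

text \<open>Counting the integers below a nonnegative \<open>g\<close> gives a step function between \<open>g\<close> and \<open>g + 1\<close>.
  Hence \<open>L g \<le> \<integral>g + L 1\<close>; replacing \<open>g\<close> by \<open>n * g\<close> makes the error negligible, so
  \<open>L g \<le> \<integral>g\<close>. Since equality holds for constants, applying this to \<open>B + f\<close> and to \<open>B - f\<close>
  gives equality for all \<open>f\<close>.\<close>

theorem riesz_representation:
  obtains M where "sets M = sets (restrict_space borel K)" "finite_measure M"
    "\<And>f. continuous_on K f \<Longrightarrow> integrable M f \<and> (\<integral>x. f x \<partial>M) = L f"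
proof -
  obtain M where M: "sets M = sets (restrict_space borel K)"
    "\<And>E. E \<in> sets M \<Longrightarrow> emeasure M E = outer E"
    using ex_outer_measure by metis
  have sp: "space M = K"
    using sets_eq_imp_space_eq[OF M(1)] by (simp add: space_restrict_space)
  have K: "emeasure M K = ennreal (L (\<lambda>x. 1))"
  proof -
    have "emeasure M K = upper (indicator K)"
      using M(2)[of K] sets.top[of M] sp by (simp add: outer_def)
    also have "\<dots> = upper (\<lambda>x. ennreal 1)"
      by (intro antisym upper_mono) auto
    also have "\<dots> = ennreal (L (\<lambda>x. 1))"
      by (rule upper_continuous) auto
    finally show ?thesis .
  qed
  interpret finite_measure M
    by (rule finite_measureI) (simp add: sp K)
  have L1: "0 \<le> L (\<lambda>x. 1)" by (auto intro: L_nonneg)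
  have mK: "measure M (space M) = L (\<lambda>x. 1)"
    using K L1 by (simp add: sp measure_def)
  have meas: "f \<in> borel_measurable M" if "continuous_on K f" for f :: "'a \<Rightarrow> real"
    using borel_measurable_continuous_on_restrict[OF that] measurable_cong_sets[OF M(1) refl] by blast
  have int: "integrable M f" if f: "continuous_on K f" for f :: "'a \<Rightarrow> real"
  proof -
    have "bounded (f ` K)"
      using compact_continuous_image[OF f compact] by (rule compact_imp_bounded)
    then obtain B where "\<And>x. x \<in> K \<Longrightarrow> norm (f x) \<le> B"
      unfolding bounded_iff by auto
    then show ?thesis
      using meas[OF f] by (intro integrable_const_bound[of _ B]) (auto simp: sp)
  qed
  have step: "L g \<le> (\<integral>x. g x \<partial>M) + L (\<lambda>x. 1)"
    if g: "continuous_on K g" "\<And>x. x \<in> K \<Longrightarrow> 0 \<le> g x" for g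
  proof -
    have "bounded (g ` K)"
      using compact_continuous_image[OF g(1) compact] by (rule compact_imp_bounded)
    then obtain B where B: "\<And>x. x \<in> K \<Longrightarrow> g x \<le> B"
      unfolding bounded_iff by (auto dest: abs_le_D1)
    obtain N :: nat where N: "B \<le> real N" using real_arch_simple by blast
    \<comment> \<open>At \<open>x\<close> the indicators of the \<open>E j\<close> add up to the ceiling of \<open>g x\<close>.\<close>
    define E where "E = (\<lambda>j::nat. {x\<in>K. real j < g x})"
    have E: "E j \<in> sets M" for j
      using meas[OF g(1)] unfolding E_def sp[symmetric] by measurable
    have count: "(\<Sum>j<N. indicator (E j) x :: real) = real (card {j. j < N \<and> real j < g x})" if "x \<in> K" for x
      using that by (simp add: E_def indicator_def sum.If_cases Int_def conj_commute)
    have lo: "g x \<le> (\<Sum>j<N. indicator (E j) x)" and hi: "(\<Sum>j<N. indicator (E j) x) \<le> g x + 1"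
      if x: "x \<in> K" for x
    proof -
      have "{j. j < N \<and> real j < g x} = {..<nat \<lceil>g x\<rceil>}"
        using B[OF x] N g(2)[OF x] by (auto simp: less_ceiling_iff zless_nat_eq_int_zless)
      then have "(\<Sum>j<N. indicator (E j) x) = real (nat \<lceil>g x\<rceil>)"
        unfolding count[OF x] by (simp only: card_lessThan)
      then show "g x \<le> (\<Sum>j<N. indicator (E j) x)" "(\<Sum>j<N. indicator (E j) x) \<le> g x + 1"
        using g(2)[OF x] by linarith+
    qed
    have "ennreal (L g) = upper (\<lambda>x. ennreal (g x))"
      using g by (simp add: upper_continuous)
    also have "\<dots> \<le> upper (\<lambda>x. \<Sum>j<N. indicator (E j) x)"
    proof (rule upper_mono)
      fix x assume x: "x \<in> K"
      have "ennreal (g x) \<le> ennreal (\<Sum>j<N. indicator (E j) x)"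
        using lo[OF x] by (rule ennreal_leI)
      also have "\<dots> = (\<Sum>j<N. ennreal (indicator (E j) x))"
        by (subst sum_ennreal) auto
      finally show "ennreal (g x) \<le> (\<Sum>j<N. indicator (E j) x)"
        by (simp add: ennreal_indicator)
    qed
    also have "\<dots> \<le> (\<Sum>j<N. upper (indicator (E j)))"
      by (rule upper_sum)
    also have "\<dots> = (\<Sum>j<N. emeasure M (E j))"
      using M(2) E by (simp add: outer_def)
    also have "\<dots> = ennreal (\<Sum>j<N. measure M (E j))"
      by (simp add: emeasure_eq_measure sum_ennreal)
    finally have "L g \<le> (\<Sum>j<N. measure M (E j))"
      by (simp add: ennreal_le_iff sum_nonneg)
    also have "\<dots> = (\<integral>x. (\<Sum>j<N. indicator (E j) x) \<partial>M)"
      using E by (subst Bochner_Integration.integral_sum) (auto simp: emeasure_eq_measure)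
    also have "\<dots> \<le> (\<integral>x. g x + 1 \<partial>M)"
      using hi E int[OF g(1)] by (intro integral_mono) (auto simp: sp emeasure_eq_measure)
    also have "\<dots> = (\<integral>x. g x \<partial>M) + L (\<lambda>x. 1)"
      using int[OF g(1)] by (simp add: mK)
    finally show ?thesis .
  qed
  have le: "L g \<le> (\<integral>x. g x \<partial>M)"
    if g: "continuous_on K g" "\<And>x. x \<in> K \<Longrightarrow> 0 \<le> g x" for g
  proof (rule ccontr)
    assume "\<not> ?thesis"
    then have "0 < L g - (\<integral>x. g x \<partial>M)" by simp
    then obtain n :: nat where n: "L (\<lambda>x. 1) < real n * (L g - (\<integral>x. g x \<partial>M))"
      using reals_Archimedean3 by blast
    have "L (\<lambda>x. real n * g x) \<le> (\<integral>x. real n * g x \<partial>M) + L (\<lambda>x. 1)"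
      using g by (intro step) (auto intro!: continuous_intros)
    then show False
      using n g by (simp add: scale algebra_simps)
  qed
  have "integrable M f \<and> (\<integral>x. f x \<partial>M) = L f" if f: "continuous_on K f" for f
  proof -
    have "bounded (f ` K)"
      using compact_continuous_image[OF f compact] by (rule compact_imp_bounded)
    then obtain B where B: "\<And>x. x \<in> K \<Longrightarrow> \<bar>f x\<bar> \<le> B"
      unfolding bounded_iff by auto
    have B': "0 \<le> f x + B" "0 \<le> (-1) * f x + B" if "x \<in> K" for x
      using B[OF that] by linarith+
    have cB: "L (\<lambda>x. B) = B * L (\<lambda>x. 1)"
      using scale[of "\<lambda>x. 1" B] by simp
    have "L (\<lambda>x. f x + B) \<le> (\<integral>x. f x + B \<partial>M)"
      by (intro le continuous_intros f B')
    then have "L f \<le> (\<integral>x. f x \<partial>M)"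
      using f int[OF f] by (simp add: add cB mK)
    moreover have "L (\<lambda>x. (-1) * f x + B) \<le> (\<integral>x. (-1) * f x + B \<partial>M)"
      by (intro le continuous_intros f B')
    then have "(\<integral>x. f x \<partial>M) \<le> L f"
      using f int[OF f] by (subst (asm) add) (auto intro!: continuous_intros simp: scale[where c="-1", simplified] cB mK)
    ultimately show ?thesis
      using int[OF f] by simp
  qed
  then show ?thesis
    using that M(1) finite_measure_axioms by blast
qed

end

text \<open>Closed sets generate the \<sigma>-algebra, and their indicators are bounded pointwise limits of
  continuous functions.\<close>

lemma measure_eqI_continuous:
  fixes K :: "'a::metric_space set"
  assumes K: "closed K"
    and M: "sets M = sets (restrict_space borel K)" "finite_measure M"
    and N: "sets N = sets (restrict_space borel K)" "finite_measure N"
    and eq: "\<And>f :: 'a \<Rightarrow> real. continuous_on K f \<Longrightarrow> (\<integral>x. f x \<partial>M) = (\<integral>x. f x \<partial>N)"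
  shows "M = N"
proof -
  interpret M: finite_measure M by fact
  interpret N: finite_measure N by fact
  have sp: "space M = K" "space N = K"
    using M(1) N(1) by (auto dest!: sets_eq_imp_space_eq simp: space_restrict_space)
  have lim: "(\<lambda>n. \<integral>x. max 0 (1 - real n * infdist x F) \<partial>Q) \<longlonglongrightarrow> measure Q (F \<inter> K)"
    if F: "closed F" "F \<noteq> {}" and Q: "sets Q = sets (restrict_space borel K)" "finite_measure Q" "space Q = K"
    for F :: "'a set" and Q :: "'a measure"
  proof -
    interpret Q: finite_measure Q by fact
    have id: "(\<lambda>x. x) \<in> measurable Q borel"
      using Q(1) measurable_cong_sets[OF Q(1) refl] measurable_restrict_space1[OF measurable_ident, of borel K]
      by (auto simp: id_def)
    have b: "(\<lambda>x. infdist x F) \<in> borel_measurable Q"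
    proof (rule measurable_compose[OF id borel_measurable_continuous_onI])
      show "continuous_on UNIV (\<lambda>x. infdist x F)" by (intro continuous_intros)
    qed
    have "F \<inter> K \<in> sets Q"
      using F K by (simp add: Q(1) sets_restrict_space_iff)
    have "(\<lambda>n. \<integral>x. max 0 (1 - real n * infdist x F) \<partial>Q) \<longlonglongrightarrow> (\<integral>x. indicator (F \<inter> K) x \<partial>Q)"
    proof (rule integral_dominated_convergence[where w = "\<lambda>x. 1"])
      show "AE x in Q. (\<lambda>n. max 0 (1 - real n * infdist x F)) \<longlonglongrightarrow> indicator (F \<inter> K) x"
      proof (rule AE_I2)
        fix x assume x: "x \<in> space Q"
        show "(\<lambda>n. max 0 (1 - real n * infdist x F)) \<longlonglongrightarrow> indicator (F \<inter> K) x"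
        proof (cases "x \<in> F")
          case True
          then show ?thesis using x Q(3) by simp
        next
          case False
          then have p: "0 < infdist x F"
            using infdist_pos_not_in_closed[OF F] by blast
          have "eventually (\<lambda>n. max 0 (1 - real n * infdist x F) = 0) sequentially"
          proof -
            obtain m where m: "1 < real m * infdist x F"
              using p reals_Archimedean3 by blast
            show ?thesis
            proof (rule eventually_sequentiallyI[of m])
              fix n assume "m \<le> n"
              then have "real m * infdist x F \<le> real n * infdist x F"
                using p by (intro mult_right_mono) auto
              then show "max 0 (1 - real n * infdist x F) = 0" using m by simp
            qed
          qed
          then show ?thesis using False by (simp add: tendsto_eventually)
        qed
      qed
      show "AE x in Q. norm (max 0 (1 - real n * infdist x F)) \<le> 1" for n
        by (auto simp: infdist_nonneg)
    qed (use b \<open>F \<inter> K \<in> sets Q\<close> in \<open>auto intro!: borel_measurable_max borel_measurable_diff borel_measurable_times\<close>)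
    moreover have "F \<inter> K \<inter> space Q = F \<inter> K" using Q(3) by auto
    ultimately show ?thesis by simp
  qed
  have closed_eq: "emeasure M F = emeasure N F" if F: "closed F" "F \<subseteq> K" for F
  proof (cases "F = {}")
    case False
    have "(\<integral>x. max 0 (1 - real n * infdist x F) \<partial>M) = (\<integral>x. max 0 (1 - real n * infdist x F) \<partial>N)" for n
      by (intro eq continuous_intros)
    with lim[OF F(1) False M sp(1)] lim[OF F(1) False N sp(2)]
    have "measure M (F \<inter> K) = measure N (F \<inter> K)"
      by (simp add: LIMSEQ_unique)
    moreover have "F \<inter> K = F" using F(2) by blast
    ultimately show ?thesis by (simp add: M.emeasure_eq_measure N.emeasure_eq_measure)
  qed auto
  show ?thesis
  proof (rule measure_eqI_generator_eq[where E = "{F. closed F \<and> F \<subseteq> K}" and \<Omega> = K and A = "\<lambda>_. K"])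
    show "sets M = sigma_sets K {F. closed F \<and> F \<subseteq> K}" "sets N = sigma_sets K {F. closed F \<and> F \<subseteq> K}"
      unfolding M(1) N(1) by (rule sets_restrict_borel_closed[OF K])+
    show "Int_stable {F. closed F \<and> F \<subseteq> K}"
      by (auto simp: Int_stable_def)
    show "range (\<lambda>_. K) \<subseteq> {F. closed F \<and> F \<subseteq> K}"
      using K by auto
  qed (use closed_eq in auto)
qed

section \<open>Star-algebras and the GNS seminorm of a state\<close>

locale star_algebra = ring R for R :: "'a star_algebra" (structure) +
  assumes smult_closed [simp, intro]: "x \<in> carrier R \<Longrightarrow> c \<odot> x \<in> carrier R"
    and smult_l_distr: "x \<in> carrier R \<Longrightarrow> (b + c) \<odot> x = b \<odot> x \<oplus> c \<odot> x"
    and smult_r_distr: "x \<in> carrier R \<Longrightarrow> y \<in> carrier R \<Longrightarrow> c \<odot> (x \<oplus> y) = c \<odot> x \<oplus> c \<odot> y"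
    and smult_smult: "x \<in> carrier R \<Longrightarrow> b \<odot> (c \<odot> x) = (b * c) \<odot> x"
    and smult_one [simp]: "x \<in> carrier R \<Longrightarrow> 1 \<odot> x = x"
    and smult_mult_left: "x \<in> carrier R \<Longrightarrow> y \<in> carrier R \<Longrightarrow> (c \<odot> x) \<otimes> y = c \<odot> (x \<otimes> y)"
    and smult_mult_right: "x \<in> carrier R \<Longrightarrow> y \<in> carrier R \<Longrightarrow> x \<otimes> (c \<odot> y) = c \<odot> (x \<otimes> y)"
    and star_closed [simp, intro]: "x \<in> carrier R \<Longrightarrow> star R x \<in> carrier R"
    and star_star [simp]: "x \<in> carrier R \<Longrightarrow> star R (star R x) = x"
    and star_add: "x \<in> carrier R \<Longrightarrow> y \<in> carrier R \<Longrightarrow> star R (x \<oplus> y) = star R x \<oplus> star R y"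
    and star_smult: "x \<in> carrier R \<Longrightarrow> star R (c \<odot> x) = cnj c \<odot> star R x"
    and star_mult: "x \<in> carrier R \<Longrightarrow> y \<in> carrier R \<Longrightarrow> star R (x \<otimes> y) = star R y \<otimes> star R x"
begin

lemma smult_zero_left: "x \<in> carrier R \<Longrightarrow> 0 \<odot> x = \<zero>"
  using smult_l_distr[of x 0 0] by simp

lemma smult_minus_one: "x \<in> carrier R \<Longrightarrow> (- 1) \<odot> x = \<ominus> x"
  using smult_l_distr[of x "-1" 1] by (simp add: smult_zero_left minus_equality)

text \<open>The completion is defined with \<open>x \<oplus> (- 1) \<odot> y\<close>; this turns it into the difference of the ring.\<close>

lemma add_smult_minus_one: "x \<in> carrier R \<Longrightarrow> y \<in> carrier R \<Longrightarrow> x \<oplus> (- 1) \<odot> y = x \<ominus> y"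
  by (simp add: smult_minus_one a_minus_def)

lemma star_one [simp]: "star R \<one> = \<one>"
  using star_mult[of "star R \<one>" \<one>] by simp

lemma star_minus: "x \<in> carrier R \<Longrightarrow> y \<in> carrier R \<Longrightarrow> star R (x \<ominus> y) = star R x \<ominus> star R y"
  by (simp add: star_add star_smult flip: add_smult_minus_one)

lemma diff_split: "x \<in> carrier R \<Longrightarrow> y \<in> carrier R \<Longrightarrow> z \<in> carrier R \<Longrightarrow> x \<ominus> z = (x \<ominus> y) \<oplus> (y \<ominus> z)"
  by algebra

lemma mult_diff:
  "x \<in> carrier R \<Longrightarrow> y \<in> carrier R \<Longrightarrow> x' \<in> carrier R \<Longrightarrow> y' \<in> carrier R \<Longrightarrow>
    x \<otimes> y \<ominus> x' \<otimes> y' = x \<otimes> (y \<ominus> y') \<oplus> (x \<ominus> x') \<otimes> y'"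
  by algebra

end

lemma le_mult_of_quadratic_nonneg:
  fixes X Y S :: real
  assumes q: "\<And>r. 0 \<le> X + 2 * r * S + r\<^sup>2 * S * Y" and nonneg: "0 \<le> S" "0 \<le> Y"
  shows "S \<le> X * Y"
proof (cases "Y = 0")
  case True
  \<comment> \<open>The expression is then affine in \<open>r\<close>, and the chosen \<open>r\<close> gives it the value \<open>- 1\<close> unless \<open>S = 0\<close>.\<close>
  show ?thesis
    using True q[of "- (X + 1) / (2 * S)"] nonneg by (cases "S = 0") (auto simp: field_simps)
next
  case False
  \<comment> \<open>The quadratic takes its minimum at \<open>r = - 1 / Y\<close>.\<close>
  have "0 \<le> X - S / Y"
    using q[of "- 1 / Y"] False by (simp add: power2_eq_square)
  then show ?thesis using False nonneg by (simp add: field_simps)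
qed

locale star_algebra_state = star_algebra +
  fixes \<tau> :: "'a \<Rightarrow> complex"
  assumes state_add: "x \<in> carrier R \<Longrightarrow> y \<in> carrier R \<Longrightarrow> \<tau> (x \<oplus> y) = \<tau> x + \<tau> y"
    and state_smult: "x \<in> carrier R \<Longrightarrow> \<tau> (c \<odot> x) = c * \<tau> x"
    and state_pos: "x \<in> carrier R \<Longrightarrow> \<tau> (star R x \<otimes> x) \<in> \<real>\<^sub>\<ge>\<^sub>0"
    and state_one: "\<tau> \<one> = 1"
begin

definition gns_norm :: "'a \<Rightarrow> real"
  where "gns_norm x = sqrt (Re (\<tau> (star R x \<otimes> x)))"

lemma Re_nonneg: "x \<in> carrier R \<Longrightarrow> 0 \<le> Re (\<tau> (star R x \<otimes> x))"
  and Im_zero: "x \<in> carrier R \<Longrightarrow> Im (\<tau> (star R x \<otimes> x)) = 0"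
  using state_pos[of x] by (auto simp: complex_nonneg_Reals_iff)

lemma gns_norm_nonneg: "x \<in> carrier R \<Longrightarrow> 0 \<le> gns_norm x"
  by (simp add: gns_norm_def Re_nonneg)

lemma gns_norm_sq: "x \<in> carrier R \<Longrightarrow> \<tau> (star R x \<otimes> x) = complex_of_real ((gns_norm x)\<^sup>2)"
  by (simp add: gns_norm_def Re_nonneg Im_zero complex_eq_iff)

lemma state_expand:
  assumes "x \<in> carrier R" "y \<in> carrier R"
  shows "\<tau> (star R (x \<oplus> c \<odot> y) \<otimes> (x \<oplus> c \<odot> y)) =
    \<tau> (star R x \<otimes> x) + c * \<tau> (star R x \<otimes> y) + cnj c * \<tau> (star R y \<otimes> x)
      + c * cnj c * \<tau> (star R y \<otimes> y)"
  using assms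
  by (simp add: star_add star_smult l_distr r_distr smult_mult_left smult_mult_right
      state_add state_smult smult_smult algebra_simps)

text \<open>Positivity makes \<open>\<tau> (star x \<otimes> x)\<close> real; polarising with the coefficients \<open>1\<close> and \<open>\<i>\<close> gives
  both halves of the claim.\<close>

lemma state_hermitian:
  assumes "x \<in> carrier R" "y \<in> carrier R"
  shows "\<tau> (star R y \<otimes> x) = cnj (\<tau> (star R x \<otimes> y))"
proof -
  have "Im (c * \<tau> (star R x \<otimes> y) + cnj c * \<tau> (star R y \<otimes> x)) = 0" for c
  proof -
    have "Im (\<tau> (star R (x \<oplus> c \<odot> y) \<otimes> (x \<oplus> c \<odot> y))) = 0"
      using assms by (intro Im_zero) auto
    moreover have "Im (c * cnj c * \<tau> (star R y \<otimes> y)) = 0"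
      using assms by (simp add: Im_zero complex_mult_cnj del: mult.commute)
    ultimately show ?thesis
      unfolding state_expand[OF assms] using assms by (simp add: Im_zero)
  qed
  from this[of 1] this[of \<i>] show ?thesis
    by (simp add: complex_eq_iff)
qed

lemma gns_norm_expand:
  assumes "x \<in> carrier R" "y \<in> carrier R"
  shows "(gns_norm (x \<oplus> c \<odot> y))\<^sup>2 =
    (gns_norm x)\<^sup>2 + 2 * Re (c * \<tau> (star R x \<otimes> y)) + (cmod c)\<^sup>2 * (gns_norm y)\<^sup>2"
proof -
  have "complex_of_real ((gns_norm (x \<oplus> c \<odot> y))\<^sup>2) = complex_of_real ((gns_norm x)\<^sup>2)
     + (c * \<tau> (star R x \<otimes> y) + cnj (c * \<tau> (star R x \<otimes> y)))
     + c * cnj c * complex_of_real ((gns_norm y)\<^sup>2)"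
    using assms state_expand[OF assms, of c] state_hermitian[OF assms]
    by (simp add: gns_norm_sq)
  also have "c * \<tau> (star R x \<otimes> y) + cnj (c * \<tau> (star R x \<otimes> y)) =
      complex_of_real (2 * Re (c * \<tau> (star R x \<otimes> y)))"
    by (rule complex_add_cnj)
  also have "c * cnj c = complex_of_real ((cmod c)\<^sup>2)"
    by (simp only: complex_norm_square)
  finally show ?thesis
    by (simp only: of_real_eq_iff flip: of_real_add of_real_mult)
qed

text \<open>With \<open>s = \<tau> (star x \<otimes> y)\<close>, the coefficient \<open>c = r * cnj s\<close> makes the expansion of
  \<open>(gns_norm (x \<oplus> c \<odot> y))\<^sup>2\<close> a real quadratic in \<open>r\<close>.\<close>

lemma cauchy_schwarz:
  assumes xy: "x \<in> carrier R" "y \<in> carrier R"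
  shows "cmod (\<tau> (star R x \<otimes> y)) \<le> gns_norm x * gns_norm y"
proof -
  define s where "s = \<tau> (star R x \<otimes> y)"
  let ?X = "(gns_norm x)\<^sup>2" and ?Y = "(gns_norm y)\<^sup>2" and ?S = "(cmod s)\<^sup>2"
  have q: "0 \<le> ?X + 2 * r * ?S + r\<^sup>2 * ?S * ?Y" for r :: real
  proof -
    have "0 \<le> (gns_norm (x \<oplus> (complex_of_real r * cnj s) \<odot> y))\<^sup>2" by simp
    also have "\<dots> = ?X + 2 * Re (complex_of_real r * (s * cnj s)) + (cmod (complex_of_real r * cnj s))\<^sup>2 * ?Y"
      unfolding gns_norm_expand[OF xy] s_def by (simp add: mult_ac)
    also have "s * cnj s = complex_of_real ?S" by (simp only: complex_norm_square)
    finally show ?thesis by (simp add: norm_mult power_mult_distrib)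
  qed
  have "?S \<le> ?X * ?Y"
    by (rule le_mult_of_quadratic_nonneg[OF q]) simp_all
  then have "?S \<le> (gns_norm x * gns_norm y)\<^sup>2" by (simp add: power_mult_distrib)
  then show ?thesis
    using xy by (simp add: s_def gns_norm_nonneg abs_le_square_iff[symmetric])
qed

lemma gns_norm_triangle:
  assumes xy: "x \<in> carrier R" "y \<in> carrier R"
  shows "gns_norm (x \<oplus> y) \<le> gns_norm x + gns_norm y"
proof (rule power2_le_imp_le)
  have "(gns_norm (x \<oplus> y))\<^sup>2 = (gns_norm x)\<^sup>2 + 2 * Re (\<tau> (star R x \<otimes> y)) + (gns_norm y)\<^sup>2"
    using gns_norm_expand[OF xy, of 1] xy by simp
  also have "Re (\<tau> (star R x \<otimes> y)) \<le> gns_norm x * gns_norm y"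
    using cauchy_schwarz[OF xy] complex_Re_le_cmod order_trans by blast
  finally show "(gns_norm (x \<oplus> y))\<^sup>2 \<le> (gns_norm x + gns_norm y)\<^sup>2"
    by (simp add: power2_sum algebra_simps)
qed (use xy in \<open>simp add: gns_norm_nonneg\<close>)

lemma gns_norm_smult:
  assumes "x \<in> carrier R" shows "gns_norm (c \<odot> x) = cmod c * gns_norm x"
proof -
  have "\<tau> (star R (c \<odot> x) \<otimes> (c \<odot> x)) = complex_of_real ((cmod c)\<^sup>2) * \<tau> (star R x \<otimes> x)"
    unfolding complex_norm_square using assms
    by (simp add: star_smult smult_mult_left smult_mult_right state_smult smult_smult)
  then show ?thesis
    by (simp add: gns_norm_def real_sqrt_mult)
qed

lemma gns_norm_one: "gns_norm \<one> = 1"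
  by (simp add: gns_norm_def state_one)

text \<open>The operator norm of left multiplication by \<open>a\<close> in the GNS representation of \<open>\<tau>\<close>, computed on
  the dense subspace that the algebra itself provides.\<close>

definition gns_op_norm :: "'a \<Rightarrow> real"
  where "gns_op_norm a = (SUP b\<in>{b \<in> carrier R. gns_norm b \<le> 1}. gns_norm (a \<otimes> b))"

lemma gns_op_norm_le:
  assumes "0 \<le> c" "\<And>b. b \<in> carrier R \<Longrightarrow> gns_norm (a \<otimes> b) \<le> c * gns_norm b"
  shows "gns_op_norm a \<le> c"
  unfolding gns_op_norm_def
proof (rule cSUP_least)
  show "{b \<in> carrier R. gns_norm b \<le> 1} \<noteq> {}"
    using gns_norm_one by fastforce
  show "gns_norm (a \<otimes> b) \<le> c" if "b \<in> {b \<in> carrier R. gns_norm b \<le> 1}" for b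
    using that assms(2)[of b] mult_left_le[of "gns_norm b" c] assms(1) by auto
qed

end

locale bounded_star_algebra_state = star_algebra_state +
  assumes bounded: "a \<in> carrier R \<Longrightarrow> \<exists>c. \<forall>b\<in>carrier R. gns_norm (a \<otimes> b) \<le> c * gns_norm b"
begin

text \<open>A vector of seminorm zero cannot be normalised; for it the claim holds because left
  multiplication is bounded, so that the product has seminorm zero as well.\<close>

lemma gns_op_norm_mult_le:
  assumes ab: "a \<in> carrier R" "b \<in> carrier R"
  shows "gns_norm (a \<otimes> b) \<le> gns_op_norm a * gns_norm b"
proof -
  obtain c where c: "\<And>b. b \<in> carrier R \<Longrightarrow> gns_norm (a \<otimes> b) \<le> c * gns_norm b"
    using bounded[OF ab(1)] by blast
  have bdd: "bdd_above ((\<lambda>b. gns_norm (a \<otimes> b)) ` {b \<in> carrier R. gns_norm b \<le> 1})"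
  proof (rule bdd_aboveI2)
    fix x assume "x \<in> {b \<in> carrier R. gns_norm b \<le> 1}"
    then have x: "x \<in> carrier R" "gns_norm x \<le> 1" by auto
    have "c * gns_norm x \<le> \<bar>c\<bar> * gns_norm x"
      using x gns_norm_nonneg by (intro mult_right_mono) auto
    also have "\<dots> \<le> \<bar>c\<bar> * 1"
      using x by (intro mult_left_mono) auto
    finally show "gns_norm (a \<otimes> x) \<le> \<bar>c\<bar>" using c[OF x(1)] by simp
  qed
  show ?thesis
  proof (cases "gns_norm b = 0")
    case True
    then show ?thesis using c[OF ab(2)] by simp
  next
    case False
    let ?t = "complex_of_real (1 / gns_norm b)"
    have pos: "0 < gns_norm b" using False gns_norm_nonneg[OF ab(2)] by simp
    then have "gns_norm (?t \<odot> b) = 1"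
      using ab by (simp add: gns_norm_smult norm_divide)
    then have "gns_norm (a \<otimes> (?t \<odot> b)) \<le> gns_op_norm a"
      unfolding gns_op_norm_def using ab by (intro cSUP_upper[OF _ bdd]) auto
    then show ?thesis
      using ab pos by (simp add: smult_mult_right gns_norm_smult norm_divide field_simps)
  qed
qed

lemma gns_op_norm_nonneg: "a \<in> carrier R \<Longrightarrow> 0 \<le> gns_op_norm a"
  using gns_op_norm_mult_le[of a \<one>] gns_norm_nonneg[of a] by (simp add: gns_norm_one)

lemma state_le_gns_op_norm:
  assumes "a \<in> carrier R" shows "cmod (\<tau> a) \<le> gns_op_norm a"
  using cauchy_schwarz[of \<one> a] gns_op_norm_mult_le[of a \<one>] assms by (simp add: gns_norm_one)

text \<open>Moving \<open>a\<close> to the other side of the form bounds \<open>\<parallel>a b\<parallel>\<^sup>2\<close> by \<open>\<parallel>b\<parallel> \<parallel>(star a \<otimes> a) b\<parallel>\<close>.\<close>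

lemma gns_op_norm_square_le:
  assumes a: "a \<in> carrier R"
  shows "(gns_op_norm a)\<^sup>2 \<le> gns_op_norm (star R a \<otimes> a)"
proof -
  let ?c = "gns_op_norm (star R a \<otimes> a)"
  have c: "0 \<le> ?c" using a by (simp add: gns_op_norm_nonneg)
  have "gns_op_norm a \<le> sqrt ?c"
  proof (rule gns_op_norm_le)
    fix b assume b: "b \<in> carrier R"
    have "(gns_norm (a \<otimes> b))\<^sup>2 = Re (\<tau> (star R b \<otimes> ((star R a \<otimes> a) \<otimes> b)))"
      using a b gns_norm_sq[of "a \<otimes> b"] by (simp add: star_mult m_assoc)
    also have "\<dots> \<le> gns_norm b * gns_norm ((star R a \<otimes> a) \<otimes> b)"
      using a b by (intro order_trans[OF complex_Re_le_cmod] cauchy_schwarz) auto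
    also have "\<dots> \<le> gns_norm b * (?c * gns_norm b)"
      using a b by (intro mult_left_mono gns_op_norm_mult_le) (auto simp: gns_norm_nonneg)
    also have "\<dots> = (sqrt ?c * gns_norm b)\<^sup>2"
      using c by (simp add: power_mult_distrib power2_eq_square[of "gns_norm b"])
    finally show "gns_norm (a \<otimes> b) \<le> sqrt ?c * gns_norm b"
      by (rule power2_le_imp_le) (use b c in \<open>simp add: gns_norm_nonneg\<close>)
  qed (use c in simp)
  then have "(gns_op_norm a)\<^sup>2 \<le> (sqrt ?c)\<^sup>2"
    using a by (intro power_mono) (auto simp: gns_op_norm_nonneg)
  then show ?thesis using c by simp
qed

lemma gns_op_norm_submult:
  assumes "a \<in> carrier R" "b \<in> carrier R"
  shows "gns_op_norm (a \<otimes> b) \<le> gns_op_norm a * gns_op_norm b"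
proof (rule gns_op_norm_le)
  fix x assume x: "x \<in> carrier R"
  have "gns_norm (a \<otimes> b \<otimes> x) \<le> gns_op_norm a * gns_norm (b \<otimes> x)"
    using assms x by (simp add: m_assoc gns_op_norm_mult_le)
  also have "\<dots> \<le> gns_op_norm a * (gns_op_norm b * gns_norm x)"
    using assms x by (intro mult_left_mono gns_op_norm_mult_le) (auto simp: gns_op_norm_nonneg)
  finally show "gns_norm (a \<otimes> b \<otimes> x) \<le> gns_op_norm a * gns_op_norm b * gns_norm x"
    by (simp add: mult.assoc)
qed (use assms in \<open>simp add: gns_op_norm_nonneg\<close>)

text \<open>One factor \<open>gns_op_norm a\<close> cancels in \<open>\<parallel>a\<parallel>\<^sup>2 \<le> \<parallel>star a \<otimes> a\<parallel> \<le> \<parallel>star a\<parallel> \<parallel>a\<parallel>\<close>.\<close>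

lemma gns_op_norm_star_le:
  assumes a: "a \<in> carrier R" shows "gns_op_norm a \<le> gns_op_norm (star R a)"
proof -
  have "gns_op_norm a * gns_op_norm a \<le> gns_op_norm (star R a) * gns_op_norm a"
    using gns_op_norm_square_le[OF a] gns_op_norm_submult[of "star R a" a] a
    by (simp add: power2_eq_square)
  then show ?thesis
    using gns_op_norm_nonneg[OF a] gns_op_norm_nonneg[OF star_closed[OF a]]
    by (cases "gns_op_norm a = 0") (auto simp: mult_le_cancel_right)
qed

theorem cstar_seminorm_gns_op_norm: "cstar_seminorm R gns_op_norm"
  unfolding cstar_seminorm_def
proof (intro conjI ballI allI)
  fix x y assume xy: "x \<in> carrier R" "y \<in> carrier R"
  show "gns_op_norm (x \<oplus> y) \<le> gns_op_norm x + gns_op_norm y"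
  proof (rule gns_op_norm_le)
    fix b assume b: "b \<in> carrier R"
    have "gns_norm ((x \<oplus> y) \<otimes> b) \<le> gns_norm (x \<otimes> b) + gns_norm (y \<otimes> b)"
      using xy b by (simp add: l_distr gns_norm_triangle)
    also have "\<dots> \<le> gns_op_norm x * gns_norm b + gns_op_norm y * gns_norm b"
      using xy b by (intro add_mono gns_op_norm_mult_le)
    finally show "gns_norm ((x \<oplus> y) \<otimes> b) \<le> (gns_op_norm x + gns_op_norm y) * gns_norm b"
      by (simp add: distrib_right)
  qed (use xy in \<open>simp add: gns_op_norm_nonneg\<close>)
next
  have le: "gns_op_norm (c \<odot> x) \<le> cmod c * gns_op_norm x" if x: "x \<in> carrier R" for c x
  proof (rule gns_op_norm_le)
    fix b assume b: "b \<in> carrier R"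
    have "gns_norm (c \<odot> x \<otimes> b) = cmod c * gns_norm (x \<otimes> b)"
      using x b by (simp add: smult_mult_left gns_norm_smult)
    also have "\<dots> \<le> cmod c * (gns_op_norm x * gns_norm b)"
      using x b by (intro mult_left_mono gns_op_norm_mult_le) auto
    finally show "gns_norm (c \<odot> x \<otimes> b) \<le> cmod c * gns_op_norm x * gns_norm b"
      by (simp add: mult.assoc)
  qed (use x in \<open>simp add: gns_op_norm_nonneg\<close>)
  fix c x assume x: "x \<in> carrier R"
  show "gns_op_norm (c \<odot> x) = cmod c * gns_op_norm x"
  proof (cases "c = 0")
    case True
    then show ?thesis
      using le[OF x, of c] gns_op_norm_nonneg[of "c \<odot> x"] x by simp
  next
    case False
    have "gns_op_norm x \<le> cmod (1 / c) * gns_op_norm (c \<odot> x)"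
      using le[of "c \<odot> x" "1 / c"] x False by (simp add: smult_smult)
    then have "cmod c * gns_op_norm x \<le> gns_op_norm (c \<odot> x)"
      using False by (simp add: norm_divide field_simps)
    then show ?thesis using le[OF x, of c] by simp
  qed
next
  fix x assume x: "x \<in> carrier R"
  have "gns_op_norm (star R x) = gns_op_norm x"
    using gns_op_norm_star_le[OF x] gns_op_norm_star_le[of "star R x"] x by simp
  then show "gns_op_norm (star R x \<otimes> x) = (gns_op_norm x)\<^sup>2"
    using gns_op_norm_square_le[OF x] gns_op_norm_submult[of "star R x" x] x
    by (simp add: power2_eq_square)
qed (auto simp: gns_op_norm_nonneg gns_op_norm_submult)

end

section \<open>Completion of a star-algebra in a C*-seminorm\<close>

locale cstar_seminormed_algebra = star_algebra +
  fixes p :: "'a \<Rightarrow> real"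
  assumes cstar_seminorm: "cstar_seminorm R p"
begin

lemma seminorm_nonneg: "x \<in> carrier R \<Longrightarrow> 0 \<le> p x"
  and seminorm_triangle: "x \<in> carrier R \<Longrightarrow> y \<in> carrier R \<Longrightarrow> p (x \<oplus> y) \<le> p x + p y"
  and seminorm_smult: "x \<in> carrier R \<Longrightarrow> p (c \<odot> x) = cmod c * p x"
  and seminorm_mult: "x \<in> carrier R \<Longrightarrow> y \<in> carrier R \<Longrightarrow> p (x \<otimes> y) \<le> p x * p y"
  and seminorm_star_mult: "x \<in> carrier R \<Longrightarrow> p (star R x \<otimes> x) = (p x)\<^sup>2"
  using cstar_seminorm by (auto simp: cstar_seminorm_def)

lemma seminorm_star_le: "x \<in> carrier R \<Longrightarrow> p x \<le> p (star R x)"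
  using seminorm_star_mult[of x] seminorm_mult[of "star R x" x] seminorm_nonneg[of x]
    seminorm_nonneg[of "star R x"]
  by (cases "p x = 0") (auto simp: power2_eq_square mult_le_cancel_right)

lemma seminorm_star: "x \<in> carrier R \<Longrightarrow> p (star R x) = p x"
  using seminorm_star_le[of x] seminorm_star_le[of "star R x"] by simp

lemma seminorm_minus: "x \<in> carrier R \<Longrightarrow> p (\<ominus> x) = p x"
  using seminorm_smult[of x "-1"] by (simp add: smult_minus_one)

lemma seminorm_zero: "p \<zero> = 0"
  using seminorm_smult[of \<zero> 0] by (simp add: smult_zero_left)

lemma seminorm_diff_commute:
  assumes "x \<in> carrier R" "y \<in> carrier R" shows "p (x \<ominus> y) = p (y \<ominus> x)"
proof -
  have "x \<ominus> y = \<ominus> (y \<ominus> x)" using assms by algebra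
  then show ?thesis using assms by (simp add: seminorm_minus)
qed

lemma seminorm_diff_triangle:
  "x \<in> carrier R \<Longrightarrow> y \<in> carrier R \<Longrightarrow> z \<in> carrier R \<Longrightarrow> p (x \<ominus> z) \<le> p (x \<ominus> y) + p (y \<ominus> z)"
  using seminorm_triangle[of "x \<ominus> y" "y \<ominus> z"] by (simp add: diff_split[of x y z])

lemma cauchy_seqs_iff:
  "X \<in> cauchy_seqs R p \<longleftrightarrow>
    (\<forall>n. X n \<in> carrier R) \<and> (\<forall>e>0. \<exists>M. \<forall>m\<ge>M. \<forall>n\<ge>M. p (X m \<ominus> X n) < e)"
  by (auto simp: cauchy_seqs_def add_smult_minus_one)

lemma cauchy_seqs_carrier: "X \<in> cauchy_seqs R p \<Longrightarrow> X n \<in> carrier R"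
  by (simp add: cauchy_seqs_iff)

lemma null_rel_iff:
  "(X, Y) \<in> null_rel R p \<longleftrightarrow>
    X \<in> cauchy_seqs R p \<and> Y \<in> cauchy_seqs R p \<and> (\<lambda>n. p (X n \<ominus> Y n)) \<longlonglongrightarrow> 0"
  by (auto simp: null_rel_def add_smult_minus_one cauchy_seqs_carrier)

lemma const_cauchy: "x \<in> carrier R \<Longrightarrow> (\<lambda>n. x) \<in> cauchy_seqs R p"
  by (simp add: cauchy_seqs_iff seminorm_zero a_minus_def r_neg)

lemma equiv_null_rel: "equiv (cauchy_seqs R p) (null_rel R p)"
proof (rule equivI)
  show "null_rel R p \<subseteq> cauchy_seqs R p \<times> cauchy_seqs R p"
    by (auto simp: null_rel_iff)
  show "refl_on (cauchy_seqs R p) (null_rel R p)"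
    by (auto simp: refl_on_def null_rel_iff cauchy_seqs_carrier seminorm_zero a_minus_def r_neg)
  show "sym (null_rel R p)"
    by (auto simp: sym_def null_rel_iff cauchy_seqs_carrier seminorm_diff_commute)
  show "trans (null_rel R p)"
  proof (rule transI)
    fix X Y Z assume *: "(X, Y) \<in> null_rel R p" "(Y, Z) \<in> null_rel R p"
    have "(\<lambda>n. p (X n \<ominus> Z n)) \<longlonglongrightarrow> 0"
    proof (rule Lim_null_comparison[OF always_eventually])
      show "(\<lambda>n. p (X n \<ominus> Y n) + p (Y n \<ominus> Z n)) \<longlonglongrightarrow> 0"
        using * by (intro tendsto_add_zero) (simp_all add: null_rel_iff)
      show "\<forall>n. norm (p (X n \<ominus> Z n)) \<le> p (X n \<ominus> Y n) + p (Y n \<ominus> Z n)"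
        using * by (auto simp: null_rel_iff seminorm_nonneg cauchy_seqs_carrier intro!: seminorm_diff_triangle)
    qed
    then show "(X, Z) \<in> null_rel R p" using * by (simp add: null_rel_iff)
  qed
qed

lemma cauchy_bounded:
  assumes X: "X \<in> cauchy_seqs R p" shows "\<exists>B\<ge>0. \<forall>n. p (X n) \<le> B"
proof -
  obtain M where M: "\<forall>m\<ge>M. \<forall>n\<ge>M. p (X m \<ominus> X n) < 1"
    using X unfolding cauchy_seqs_iff by (meson zero_less_one)
  define B where "B = (\<Sum>i\<le>M. p (X i)) + 1"
  have c: "X n \<in> carrier R" for n using X by (rule cauchy_seqs_carrier)
  have le: "p (X i) \<le> (\<Sum>i\<le>M. p (X i))" if "i \<le> M" for i
    using that c by (intro member_le_sum) (auto simp: seminorm_nonneg)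
  have "p (X n) \<le> B" for n
  proof (cases "n \<le> M")
    case True then show ?thesis using le[OF True] by (simp add: B_def)
  next
    case False
    have "p (X n) = p ((X n \<ominus> X M) \<oplus> X M)"
      using c[of n] c[of M] by (intro arg_cong[of _ _ p]) algebra
    also have "\<dots> \<le> p (X n \<ominus> X M) + p (X M)"
      using c by (intro seminorm_triangle) auto
    also have "\<dots> \<le> B"
      using M[rule_format, of n M] False le[of M] by (simp add: B_def)
    finally show ?thesis .
  qed
  moreover have "0 \<le> B"
    unfolding B_def using c by (intro add_nonneg_nonneg sum_nonneg) (auto simp: seminorm_nonneg)
  ultimately show ?thesis by blast
qed

lemma cauchy_of_lipschitz:
  assumes X: "X \<in> cauchy_seqs R p" and Y: "Y \<in> cauchy_seqs R p"
    and Z: "\<And>n. Z n \<in> carrier R" and B: "0 \<le> B"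
    "\<And>m n. p (Z m \<ominus> Z n) \<le> B * (p (X m \<ominus> X n) + p (Y m \<ominus> Y n))"
  shows "Z \<in> cauchy_seqs R p"
  unfolding cauchy_seqs_iff
proof (intro conjI allI impI Z)
  fix e :: real assume e: "0 < e"
  define d where "d = e / (B + 1) / 2"
  have d: "0 < d" using e B by (simp add: d_def)
  have "d + d = e / (B + 1)" unfolding d_def by (rule field_sum_of_halves)
  moreover have "B + 1 \<noteq> 0" using B(1) by linarith
  ultimately have "(B + 1) * (d + d) = e" by simp
  then have Bd: "B * (d + d) < e" using d by (simp add: distrib_right)
  obtain M where M: "\<forall>m\<ge>M. \<forall>n\<ge>M. p (X m \<ominus> X n) < d"
    using X d unfolding cauchy_seqs_iff by meson
  obtain N where N: "\<forall>m\<ge>N. \<forall>n\<ge>N. p (Y m \<ominus> Y n) < d"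
    using Y d unfolding cauchy_seqs_iff by meson
  have "p (Z m \<ominus> Z n) < e" if "max M N \<le> m" "max M N \<le> n" for m n
  proof -
    have "p (Z m \<ominus> Z n) \<le> B * (p (X m \<ominus> X n) + p (Y m \<ominus> Y n))" by (rule B)
    also have "\<dots> \<le> B * (d + d)"
      using M[rule_format, of m n] N[rule_format, of m n] that B(1) by (intro mult_left_mono add_mono) auto
    also have "\<dots> < e" by (rule Bd)
    finally show ?thesis .
  qed
  then show "\<exists>M. \<forall>m\<ge>M. \<forall>n\<ge>M. p (Z m \<ominus> Z n) < e" by blast
qed

lemma null_rel_of_lipschitz:
  assumes X: "(X, X') \<in> null_rel R p" and Y: "(Y, Y') \<in> null_rel R p"
    and Z: "Z \<in> cauchy_seqs R p" "Z' \<in> cauchy_seqs R p"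
    and B: "\<And>n. p (Z n \<ominus> Z' n) \<le> B * (p (X n \<ominus> X' n) + p (Y n \<ominus> Y' n))"
  shows "(Z, Z') \<in> null_rel R p"
proof -
  have "(\<lambda>n. p (Z n \<ominus> Z' n)) \<longlonglongrightarrow> 0"
  proof (rule Lim_null_comparison[OF always_eventually])
    have "(\<lambda>n. B * (p (X n \<ominus> X' n) + p (Y n \<ominus> Y' n))) \<longlonglongrightarrow> B * (0 + 0)"
      using X Y by (intro tendsto_intros) (auto simp: null_rel_iff)
    then show "(\<lambda>n. B * (p (X n \<ominus> X' n) + p (Y n \<ominus> Y' n))) \<longlonglongrightarrow> 0" by simp
    show "\<forall>n. norm (p (Z n \<ominus> Z' n)) \<le> B * (p (X n \<ominus> X' n) + p (Y n \<ominus> Y' n))"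
      using B Z by (auto simp: seminorm_nonneg cauchy_seqs_carrier)
  qed
  then show ?thesis using Z by (simp add: null_rel_iff)
qed

abbreviation cls :: "(nat \<Rightarrow> 'a) \<Rightarrow> (nat \<Rightarrow> 'a) set"
  where "cls X \<equiv> null_rel R p `` {X}"

lemma cls_closed: "X \<in> cauchy_seqs R p \<Longrightarrow> cls X \<in> carrier (completion R p)"
  by (simp add: completion_def quotientI)

lemma completion_cases:
  assumes "x \<in> carrier (completion R p)"
  obtains X where "X \<in> cauchy_seqs R p" "x = cls X"
  using assms by (auto simp: completion_def elim: quotientE)

text \<open>A Lipschitz map preserves Cauchy sequences and null sequences, so it acts on classes through
  any representative.\<close>

lemma cls_lift:
  assumes X: "X \<in> cauchy_seqs R p"
    and F: "\<And>x. x \<in> carrier R \<Longrightarrow> F x \<in> carrier R"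
    and c: "0 \<le> c" "\<And>x y. x \<in> carrier R \<Longrightarrow> y \<in> carrier R \<Longrightarrow> p (F x \<ominus> F y) \<le> c * p (x \<ominus> y)"
  shows "(\<lambda>n. F (X n)) \<in> cauchy_seqs R p"
    and "(\<Union>Y\<in>cls X. cls (\<lambda>n. F (Y n))) = cls (\<lambda>n. F (X n))"
proof -
  have le: "p (F x \<ominus> F y) \<le> c * (p (x \<ominus> y) + p (x \<ominus> y))" if "x \<in> carrier R" "y \<in> carrier R" for x y
    using c(2)[OF that] mult_nonneg_nonneg[OF c(1) seminorm_nonneg, of "x \<ominus> y"] that
    by (simp add: distrib_left)
  have C: "(\<lambda>n. F (Y n)) \<in> cauchy_seqs R p" if "Y \<in> cauchy_seqs R p" for Y
    using that by (intro cauchy_of_lipschitz[OF that that _ c(1)] le F) (auto intro: cauchy_seqs_carrier)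
  show "(\<lambda>n. F (X n)) \<in> cauchy_seqs R p" using C[OF X] .
  show "(\<Union>Y\<in>cls X. cls (\<lambda>n. F (Y n))) = cls (\<lambda>n. F (X n))"
  proof (rule UN_equiv_class[OF equiv_null_rel _ X])
    show "(\<lambda>Y. cls (\<lambda>n. F (Y n))) respects null_rel R p"
    proof (rule congruentI)
      fix Y Z assume YZ: "(Y, Z) \<in> null_rel R p"
      then have "Y \<in> cauchy_seqs R p" "Z \<in> cauchy_seqs R p" by (auto simp: null_rel_iff)
      then have "((\<lambda>n. F (Y n)), (\<lambda>n. F (Z n))) \<in> null_rel R p"
        by (intro null_rel_of_lipschitz[OF YZ YZ, of _ _ c] C le) (auto intro: cauchy_seqs_carrier)
      then show "cls (\<lambda>n. F (Y n)) = cls (\<lambda>n. F (Z n))"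
        by (rule equiv_class_eq[OF equiv_null_rel])
    qed
  qed
qed

text \<open>The Lipschitz constant may grow with the arguments, because Cauchy sequences are bounded. The
  bound is shaped so that it covers multiplication; addition satisfies it too.\<close>

lemma cls_lift2:
  assumes X: "X \<in> cauchy_seqs R p" and Y: "Y \<in> cauchy_seqs R p"
    and G: "\<And>x y. x \<in> carrier R \<Longrightarrow> y \<in> carrier R \<Longrightarrow> G x y \<in> carrier R"
    and le: "\<And>x y x' y'. x \<in> carrier R \<Longrightarrow> y \<in> carrier R \<Longrightarrow> x' \<in> carrier R \<Longrightarrow> y' \<in> carrier R \<Longrightarrow>
      p (G x y \<ominus> G x' y') \<le> (1 + p x + p y') * (p (x \<ominus> x') + p (y \<ominus> y'))"
  shows "(\<lambda>n. G (X n) (Y n)) \<in> cauchy_seqs R p"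
    and "(\<Union>X'\<in>cls X. \<Union>Y'\<in>cls Y. cls (\<lambda>n. G (X' n) (Y' n))) = cls (\<lambda>n. G (X n) (Y n))"
proof -
  have bd: "\<exists>B\<ge>0. \<forall>m n. p (G (X m) (Y m) \<ominus> G (X' n) (Y' n)) \<le>
      B * (p (X m \<ominus> X' n) + p (Y m \<ominus> Y' n))"
    if c: "X \<in> cauchy_seqs R p" "Y \<in> cauchy_seqs R p" "X' \<in> cauchy_seqs R p" "Y' \<in> cauchy_seqs R p"
    for X Y X' Y'
  proof -
    obtain A B where A: "0 \<le> A" "\<And>n. p (X n) \<le> A" and B: "0 \<le> B" "\<And>n. p (Y' n) \<le> B"
      using cauchy_bounded c by meson
    have "p (G (X m) (Y m) \<ominus> G (X' n) (Y' n)) \<le> (1 + A + B) * (p (X m \<ominus> X' n) + p (Y m \<ominus> Y' n))" for m n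
    proof -
      have "p (G (X m) (Y m) \<ominus> G (X' n) (Y' n)) \<le>
          (1 + p (X m) + p (Y' n)) * (p (X m \<ominus> X' n) + p (Y m \<ominus> Y' n))"
        using c by (intro le) (auto intro: cauchy_seqs_carrier)
      also have "\<dots> \<le> (1 + A + B) * (p (X m \<ominus> X' n) + p (Y m \<ominus> Y' n))"
        using c A B by (intro mult_right_mono add_mono add_nonneg_nonneg seminorm_nonneg minus_closed)
          (auto intro: cauchy_seqs_carrier)
      finally show ?thesis .
    qed
    then show ?thesis using A B by (intro exI[of _ "1 + A + B"]) auto
  qed
  have C: "(\<lambda>n. G (X n) (Y n)) \<in> cauchy_seqs R p"
    if c: "X \<in> cauchy_seqs R p" "Y \<in> cauchy_seqs R p" for X Y
  proof -
    obtain B where "0 \<le> B" "\<forall>m n. p (G (X m) (Y m) \<ominus> G (X n) (Y n)) \<le>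
      B * (p (X m \<ominus> X n) + p (Y m \<ominus> Y n))" using bd[OF c c] by blast
    then show ?thesis
      using c by (intro cauchy_of_lipschitz[OF c, of _ B] G) (auto intro: cauchy_seqs_carrier)
  qed
  show "(\<lambda>n. G (X n) (Y n)) \<in> cauchy_seqs R p" using C[OF X Y] .
  show "(\<Union>X'\<in>cls X. \<Union>Y'\<in>cls Y. cls (\<lambda>n. G (X' n) (Y' n))) = cls (\<lambda>n. G (X n) (Y n))"
  proof (rule UN_equiv_class2[OF equiv_null_rel equiv_null_rel _ X Y])
    show "congruent2 (null_rel R p) (null_rel R p) (\<lambda>X Y. cls (\<lambda>n. G (X n) (Y n)))"
    proof (rule congruent2I')
      fix X Y X' Y' assume r: "(X, X') \<in> null_rel R p" "(Y, Y') \<in> null_rel R p"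
      then have c: "X \<in> cauchy_seqs R p" "Y \<in> cauchy_seqs R p" "X' \<in> cauchy_seqs R p" "Y' \<in> cauchy_seqs R p"
        by (auto simp: null_rel_iff)
      obtain B where "\<forall>m n. p (G (X m) (Y m) \<ominus> G (X' n) (Y' n)) \<le>
        B * (p (X m \<ominus> X' n) + p (Y m \<ominus> Y' n))" using bd[OF c] by blast
      then have "((\<lambda>n. G (X n) (Y n)), (\<lambda>n. G (X' n) (Y' n))) \<in> null_rel R p"
        using c by (intro null_rel_of_lipschitz[OF r, of _ _ B] C) auto
      then show "cls (\<lambda>n. G (X n) (Y n)) = cls (\<lambda>n. G (X' n) (Y' n))"
        by (rule equiv_class_eq[OF equiv_null_rel])
    qed
  qed
qed

lemma mult_lipschitz:
  assumes "x \<in> carrier R" "y \<in> carrier R" "x' \<in> carrier R" "y' \<in> carrier R"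
  shows "p (x \<otimes> y \<ominus> x' \<otimes> y') \<le> (1 + p x + p y') * (p (x \<ominus> x') + p (y \<ominus> y'))"
proof -
  have "p (x \<otimes> y \<ominus> x' \<otimes> y') \<le> p (x \<otimes> (y \<ominus> y')) + p ((x \<ominus> x') \<otimes> y')"
    using assms by (simp add: mult_diff seminorm_triangle)
  also have "\<dots> \<le> p x * p (y \<ominus> y') + p (x \<ominus> x') * p y'"
    using assms by (intro add_mono seminorm_mult) auto
  also have "\<dots> \<le> (1 + p x + p y') * (p (x \<ominus> x') + p (y \<ominus> y'))"
  proof -
    have "0 \<le> p x * p (x \<ominus> x')" "0 \<le> p y' * p (y \<ominus> y')" "0 \<le> p (x \<ominus> x')" "0 \<le> p (y \<ominus> y')"
      using assms by (auto intro!: mult_nonneg_nonneg seminorm_nonneg)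
    then show ?thesis by (simp add: algebra_simps)
  qed
  finally show ?thesis .
qed

lemma add_lipschitz:
  assumes "x \<in> carrier R" "y \<in> carrier R" "x' \<in> carrier R" "y' \<in> carrier R"
  shows "p (x \<oplus> y \<ominus> (x' \<oplus> y')) \<le> (1 + p x + p y') * (p (x \<ominus> x') + p (y \<ominus> y'))"
proof -
  have "x \<oplus> y \<ominus> (x' \<oplus> y') = (x \<ominus> x') \<oplus> (y \<ominus> y')"
    using assms by algebra
  then have "p (x \<oplus> y \<ominus> (x' \<oplus> y')) \<le> 1 * (p (x \<ominus> x') + p (y \<ominus> y'))"
    using assms by (simp add: seminorm_triangle)
  also have "\<dots> \<le> (1 + p x + p y') * (p (x \<ominus> x') + p (y \<ominus> y'))"
    using assms by (intro mult_right_mono add_nonneg_nonneg) (auto simp: seminorm_nonneg)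
  finally show ?thesis .
qed

lemma smult_lipschitz:
  assumes "x \<in> carrier R" "y \<in> carrier R"
  shows "p (c \<odot> x \<ominus> c \<odot> y) \<le> cmod c * p (x \<ominus> y)"
proof -
  have "c \<odot> x \<ominus> c \<odot> y = c \<odot> (x \<ominus> y)"
    using assms by (simp add: smult_r_distr smult_smult flip: add_smult_minus_one)
  then show ?thesis using assms by (simp add: seminorm_smult)
qed

lemma star_lipschitz:
  assumes "x \<in> carrier R" "y \<in> carrier R"
  shows "p (star R x \<ominus> star R y) \<le> 1 * p (x \<ominus> y)"
  using seminorm_star[of "x \<ominus> y"] assms by (simp add: star_minus)

lemma cauchy_mult:
    "X \<in> cauchy_seqs R p \<Longrightarrow> Y \<in> cauchy_seqs R p \<Longrightarrow> (\<lambda>n. X n \<otimes> Y n) \<in> cauchy_seqs R p"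
  and cls_mult: "X \<in> cauchy_seqs R p \<Longrightarrow> Y \<in> cauchy_seqs R p \<Longrightarrow>
    cls X \<otimes>\<^bsub>completion R p\<^esub> cls Y = cls (\<lambda>n. X n \<otimes> Y n)"
  using cls_lift2[OF _ _ _ mult_lipschitz, of X Y] by (simp_all add: completion_def)

lemma cauchy_add:
    "X \<in> cauchy_seqs R p \<Longrightarrow> Y \<in> cauchy_seqs R p \<Longrightarrow> (\<lambda>n. X n \<oplus> Y n) \<in> cauchy_seqs R p"
  and cls_add: "X \<in> cauchy_seqs R p \<Longrightarrow> Y \<in> cauchy_seqs R p \<Longrightarrow>
    cls X \<oplus>\<^bsub>completion R p\<^esub> cls Y = cls (\<lambda>n. X n \<oplus> Y n)"
  using cls_lift2[OF _ _ _ add_lipschitz, of X Y] by (simp_all add: completion_def)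

lemma cauchy_smult: "X \<in> cauchy_seqs R p \<Longrightarrow> (\<lambda>n. c \<odot> X n) \<in> cauchy_seqs R p"
  and cls_smult: "X \<in> cauchy_seqs R p \<Longrightarrow> c \<odot>\<^bsub>completion R p\<^esub> cls X = cls (\<lambda>n. c \<odot> X n)"
  using cls_lift[OF _ _ _ smult_lipschitz, of X c] by (simp_all add: completion_def)

lemma cauchy_star: "X \<in> cauchy_seqs R p \<Longrightarrow> (\<lambda>n. star R (X n)) \<in> cauchy_seqs R p"
  and cls_star: "X \<in> cauchy_seqs R p \<Longrightarrow> star (completion R p) (cls X) = cls (\<lambda>n. star R (X n))"
  using cls_lift[OF _ _ _ star_lipschitz, of X] by (simp_all add: completion_def)

lemma cls_one: "\<one>\<^bsub>completion R p\<^esub> = cls (\<lambda>n. \<one>)"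
  by (simp add: completion_def)

lemma monoid_completion: "monoid (completion R p)"
proof (rule monoidI)
  note c = const_cauchy[OF one_closed]
  show "\<one>\<^bsub>completion R p\<^esub> \<in> carrier (completion R p)"
    by (simp add: cls_one cls_closed c)
  fix x y z
  assume "x \<in> carrier (completion R p)"
  then obtain X where X: "X \<in> cauchy_seqs R p" "x = cls X" by (rule completion_cases)
  show "\<one>\<^bsub>completion R p\<^esub> \<otimes>\<^bsub>completion R p\<^esub> x = x" "x \<otimes>\<^bsub>completion R p\<^esub> \<one>\<^bsub>completion R p\<^esub> = x"
    using X c by (simp_all add: cls_one cls_mult cauchy_seqs_carrier)
  assume "y \<in> carrier (completion R p)"
  then obtain Y where Y: "Y \<in> cauchy_seqs R p" "y = cls Y" by (rule completion_cases)
  show "x \<otimes>\<^bsub>completion R p\<^esub> y \<in> carrier (completion R p)"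
    using X Y by (simp add: cls_mult cls_closed cauchy_mult)
  assume "z \<in> carrier (completion R p)"
  then obtain Z where Z: "Z \<in> cauchy_seqs R p" "z = cls Z" by (rule completion_cases)
  show "x \<otimes>\<^bsub>completion R p\<^esub> y \<otimes>\<^bsub>completion R p\<^esub> z = x \<otimes>\<^bsub>completion R p\<^esub> (y \<otimes>\<^bsub>completion R p\<^esub> z)"
    using X Y Z by (simp add: cls_mult cauchy_mult m_assoc cauchy_seqs_carrier)
qed

text \<open>The limit of a bounded functional along a Cauchy sequence depends only on the class of the
  sequence (\<open>extend_functional_cls\<close>), so the choice of a representative is immaterial.\<close>

definition extend_functional :: "('a \<Rightarrow> complex) \<Rightarrow> (nat \<Rightarrow> 'a) set \<Rightarrow> complex"
  where "extend_functional \<tau> x = lim (\<lambda>n. \<tau> ((SOME X. X \<in> x) n))"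

context
  fixes \<tau> :: "'a \<Rightarrow> complex"
  assumes trace: "tracial_state R \<tau>"
    and bound: "\<And>x. x \<in> carrier R \<Longrightarrow> cmod (\<tau> x) \<le> p x"
begin

lemma functional_diff:
  assumes "x \<in> carrier R" "y \<in> carrier R" shows "cmod (\<tau> x - \<tau> y) \<le> p (x \<ominus> y)"
proof -
  have "\<tau> (x \<ominus> y) = \<tau> x - \<tau> y"
    using trace assms unfolding tracial_state_def by (simp flip: add_smult_minus_one)
  then show ?thesis using bound[of "x \<ominus> y"] assms by simp
qed

lemma extend_functional_cls:
  assumes X: "X \<in> cauchy_seqs R p"
  shows "(\<lambda>n. \<tau> (X n)) \<longlonglongrightarrow> extend_functional \<tau> (cls X)"
proof -
  define Y where "Y = (SOME Y. Y \<in> cls X)"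
  have "Y \<in> cls X"
    unfolding Y_def using equiv_class_self[OF equiv_null_rel X] by (rule someI[of "\<lambda>Y. Y \<in> cls X"])
  then have XY: "(X, Y) \<in> null_rel R p" by simp
  then have Y: "Y \<in> cauchy_seqs R p" and lim0: "(\<lambda>n. p (X n \<ominus> Y n)) \<longlonglongrightarrow> 0"
    by (auto simp: null_rel_iff)
  have "Cauchy (\<lambda>n. \<tau> (Y n))"
    unfolding Cauchy_def dist_norm
  proof (intro allI impI)
    fix e :: real assume "0 < e"
    then obtain M where "\<forall>m\<ge>M. \<forall>n\<ge>M. p (Y m \<ominus> Y n) < e"
      using Y unfolding cauchy_seqs_iff by meson
    then show "\<exists>M. \<forall>m\<ge>M. \<forall>n\<ge>M. cmod (\<tau> (Y m) - \<tau> (Y n)) < e"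
      using functional_diff cauchy_seqs_carrier[OF Y] by (meson le_less_trans)
  qed
  then have "(\<lambda>n. \<tau> (Y n)) \<longlonglongrightarrow> extend_functional \<tau> (cls X)"
    unfolding extend_functional_def Y_def[symmetric]
    by (simp add: Cauchy_convergent_iff convergent_LIMSEQ_iff)
  moreover have "(\<lambda>n. \<tau> (X n) - \<tau> (Y n)) \<longlonglongrightarrow> 0"
    using lim0 functional_diff cauchy_seqs_carrier X Y
    by (intro Lim_null_comparison[OF always_eventually lim0]) auto
  ultimately show ?thesis
    using tendsto_add by fastforce
qed

lemma extend_functional_eqI:
  "X \<in> cauchy_seqs R p \<Longrightarrow> (\<lambda>n. \<tau> (X n)) \<longlonglongrightarrow> l \<Longrightarrow> extend_functional \<tau> (cls X) = l"
  using extend_functional_cls LIMSEQ_unique by blast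

lemma extend_functional_const: "x \<in> carrier R \<Longrightarrow> extend_functional \<tau> (cls (\<lambda>n. x)) = \<tau> x"
  by (rule extend_functional_eqI) (auto intro: const_cauchy)

text \<open>Every axiom of a tracial state is an equation or a closed condition on limits.\<close>

lemma tracial_state_extend_functional: "tracial_state (completion R p) (extend_functional \<tau>)"
  unfolding tracial_state_def
proof (intro conjI ballI allI)
  fix x y
  assume "x \<in> carrier (completion R p)"
  then obtain X where X: "X \<in> cauchy_seqs R p" "x = cls X" by (rule completion_cases)
  note Xc = cauchy_seqs_carrier[OF X(1)]
  show "extend_functional \<tau> (c \<odot>\<^bsub>completion R p\<^esub> x) = c * extend_functional \<tau> x" for c
    unfolding X(2) cls_smult[OF X(1)]
    using X Xc trace by (intro extend_functional_eqI cauchy_smult)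
      (auto simp: tracial_state_def intro: tendsto_intros extend_functional_cls)
  note XX = cauchy_star[OF X(1)] X(1)
  have "(\<lambda>n. \<tau> (star R (X n) \<otimes> X n)) \<longlonglongrightarrow> extend_functional \<tau> (star (completion R p) x \<otimes>\<^bsub>completion R p\<^esub> x)"
    unfolding X(2) cls_star[OF X(1)] cls_mult[OF XX]
    by (rule extend_functional_cls[OF cauchy_mult[OF XX]])
  then show "extend_functional \<tau> (star (completion R p) x \<otimes>\<^bsub>completion R p\<^esub> x) \<in> \<real>\<^sub>\<ge>\<^sub>0"
    by (rule closed_sequentially[OF closed_nonneg_Reals_complex, rotated])
      (use trace Xc in \<open>auto simp: tracial_state_def\<close>)
  assume "y \<in> carrier (completion R p)"
  then obtain Y where Y: "Y \<in> cauchy_seqs R p" "y = cls Y" by (rule completion_cases)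
  note Yc = cauchy_seqs_carrier[OF Y(1)]
  show "extend_functional \<tau> (x \<oplus>\<^bsub>completion R p\<^esub> y) = extend_functional \<tau> x + extend_functional \<tau> y"
    unfolding X(2) Y(2) cls_add[OF X(1) Y(1)]
    using X Y Xc Yc trace by (intro extend_functional_eqI cauchy_add)
      (auto simp: tracial_state_def intro: tendsto_intros extend_functional_cls)
  have "(\<lambda>n. \<tau> (X n \<otimes> Y n)) = (\<lambda>n. \<tau> (Y n \<otimes> X n))"
    using trace Xc Yc by (auto simp: tracial_state_def)
  then show "extend_functional \<tau> (x \<otimes>\<^bsub>completion R p\<^esub> y) = extend_functional \<tau> (y \<otimes>\<^bsub>completion R p\<^esub> x)"
    unfolding X(2) Y(2) cls_mult[OF X(1) Y(1)] cls_mult[OF Y(1) X(1)]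
    using X Y by (intro extend_functional_eqI cauchy_mult) (auto intro: extend_functional_cls cauchy_mult)
next
  note c = const_cauchy[OF one_closed]
  show "extend_functional \<tau> \<one>\<^bsub>completion R p\<^esub> = 1"
    using trace by (simp add: cls_one extend_functional_const tracial_state_def)
qed

end
end

section \<open>The torus homeomorphism of a unimodular matrix\<close>

lemma compact_torus: "compact (torus :: (complex ^ 'd) set)"
proof -
  have "closed (torus :: (complex ^ 'd) set)"
    unfolding torus_def by (intro closed_Collect_all closed_Collect_eq continuous_intros)
  moreover have "norm z \<le> real CARD('d)" if "z \<in> torus" for z :: "complex ^ 'd"
    using that L2_set_le_sum[of UNIV "\<lambda>i. norm (z $ i)"] by (simp add: torus_def norm_vec_def)
  ultimately show ?thesis
    by (metis boundedI compact_eq_bounded_closed)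
qed

lemma torus_nonempty: "torus \<noteq> ({} :: (complex ^ 'd) set)"
  using range_torus_exp[where 'd = 'd] by blast

lemma det_of_int: "det (\<chi> i j. of_int (M $ i $ j) :: 'a::comm_ring_1 ^ 'n ^ 'n) = of_int (det M)"
  by (simp add: det_def)

lemma torus_exp_eq_iff: "torus_exp x = torus_exp y \<longleftrightarrow> (\<forall>i. x $ i - y $ i \<in> \<int>)"
proof -
  have "exp (2 * complex_of_real pi * \<i> * complex_of_real a) = exp (2 * complex_of_real pi * \<i> * complex_of_real b)
      \<longleftrightarrow> a - b \<in> \<int>" for a b
  proof -
    have "exp (2 * complex_of_real pi * \<i> * complex_of_real a) = exp (2 * complex_of_real pi * \<i> * complex_of_real b)
      \<longleftrightarrow> (\<exists>n::int. 2 * complex_of_real pi * \<i> * complex_of_real a =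
             2 * complex_of_real pi * \<i> * complex_of_real b + (of_int (2 * n) * pi) * \<i>)"
      by (rule exp_eq)
    also have "\<dots> \<longleftrightarrow> (\<exists>n::int. a = b + of_int n)"
    proof -
      have "2 * pi * a = 2 * pi * b + 2 * real_of_int n * pi \<longleftrightarrow> a = b + real_of_int n" for n
      proof -
        have "2 * pi * b + 2 * real_of_int n * pi = 2 * pi * (b + real_of_int n)"
          by (simp add: distrib_left)
        then show ?thesis by simp
      qed
      then show ?thesis by (simp add: complex_eq_iff)
    qed
    also have "\<dots> \<longleftrightarrow> a - b \<in> \<int>"
      by (auto simp: Ints_def) (metis add.commute diff_add_cancel)
    finally show ?thesis .
  qed
  then show ?thesis
    by (simp add: torus_exp_def vec_eq_iff)
qed

lemma continuous_torus_map: "continuous_on torus (torus_map A)"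
  unfolding torus_map_def by (intro continuous_on_vec_lambda continuous_torus_char)

text \<open>If the real matrix \<open>B\<close> of \<open>A\<close> sends \<open>w\<close> to an integer vector, then Cramer's rule expresses
  each \<open>w $ k\<close> as the quotient of an integer by \<open>det A\<close>, which is \<open>1\<close> or \<open>- 1\<close>; so \<open>w\<close> is
  integral, and this is injectivity. Surjectivity is the invertibility of \<open>B\<close> over the reals.\<close>

lemma bij_betw_torus_map:
  fixes A :: "int ^ 'd ^ 'd"
  assumes "\<bar>det A\<bar> = 1"
  shows "bij_betw (torus_map A) torus torus"
proof -
  define B :: "real ^ 'd ^ 'd" where "B = (\<chi> i j. real_of_int (A $ i $ j))"
  have B_nth: "B $ i $ j = real_of_int (A $ i $ j)" for i j by (simp add: B_def)
  have d: "det B = real_of_int (det A)"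
    unfolding B_def by (rule det_of_int)
  then have "\<bar>det B\<bar> = 1" using assms by linarith
  then have d0: "det B \<noteq> 0" by auto
  have "inj_on (torus_map A) torus"
  proof (rule inj_onI)
    fix z w :: "complex ^ 'd" assume "z \<in> torus" "w \<in> torus" and eq: "torus_map A z = torus_map A w"
    then obtain x y where z: "z = torus_exp x" and w: "w = torus_exp y"
      by (metis imageE range_torus_exp)
    have "\<forall>i. (B *v x) $ i - (B *v y) $ i \<in> \<int>"
      using eq unfolding z w torus_map_exp torus_exp_eq_iff B_def .
    then have "\<forall>i. \<exists>n::int. (B *v (x - y)) $ i = of_int n"
      by (simp add: matrix_vector_mult_diff_distrib Ints_def image_iff)
    then obtain n where n: "\<And>i. (B *v (x - y)) $ i = of_int (n i :: int)"
      by metis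
    have "(x - y) $ k \<in> \<int>" for k
    proof -
      have "(x - y) $ k * det B = det (\<chi> i j. if j = k then (B *v (x - y)) $ i else B $ i $ j)"
        by (rule cramer_lemma[symmetric])
      also have "(\<chi> i j. if j = k then (B *v (x - y)) $ i else B $ i $ j) =
          (\<chi> i j. real_of_int ((\<chi> i j. if j = k then n i else A $ i $ j) $ i $ j))"
        by (simp only: n B_nth if_distrib[of real_of_int] vec_lambda_beta)
      also have "det \<dots> \<in> \<int>"
        unfolding det_of_int by simp
      finally have "(x - y) $ k * det B \<in> \<int>" .
      moreover have "det B \<in> \<int>" by (simp add: d)
      ultimately have "(x - y) $ k * det B * det B \<in> \<int>" by (rule Ints_mult)
      moreover have "det B * det B = 1"
        using \<open>\<bar>det B\<bar> = 1\<close> by (metis abs_mult_self_eq mult_1)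
      ultimately show ?thesis by (simp add: mult.assoc)
    qed
    then show "z = w"
      by (simp add: z w torus_exp_eq_iff)
  qed
  moreover have "z \<in> torus_map A ` torus" if z: "z \<in> torus" for z :: "complex ^ 'd"
  proof -
    obtain y where y: "z = torus_exp y"
      using z by (metis imageE range_torus_exp)
    obtain x where "B *v x = y"
      using cramer[OF d0] by blast
    then have "torus_map A (torus_exp x) = z"
      by (simp add: torus_map_exp y B_def)
    then show ?thesis
      by (metis imageI rangeI range_torus_exp)
  qed
  ultimately show ?thesis
    by (auto simp: bij_betw_def torus_map_in)
qed

section \<open>The convolution algebra\<close>

lemma torus_cont_zero: "(\<lambda>z. 0) \<in> torus_cont"
  by (simp add: torus_cont_def torus_extend_def fun_eq_iff)

lemma torus_cont_outside: "f \<in> torus_cont \<Longrightarrow> z \<notin> torus \<Longrightarrow> f z = 0"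
  by (metis (mono_tags, lifting) mem_Collect_eq torus_cont_def torus_extend_def)

lemma torus_contI: "continuous_on torus f \<Longrightarrow> (\<And>z. z \<notin> torus \<Longrightarrow> f z = 0) \<Longrightarrow> f \<in> torus_cont"
  by (auto simp: torus_cont_def torus_extend_def fun_eq_iff)

lemma torus_cont_continuous: "f \<in> torus_cont \<Longrightarrow> continuous_on torus f"
  by (simp add: torus_cont_def)

lemma torus_cont_sum:
  assumes "\<And>i. i \<in> I \<Longrightarrow> f i \<in> torus_cont" shows "(\<lambda>z. \<Sum>i\<in>I. f i z) \<in> torus_cont"
proof (rule torus_contI)
  show "continuous_on torus (\<lambda>z. \<Sum>i\<in>I. f i z)"
    by (intro continuous_on_sum torus_cont_continuous assms)
  show "(\<Sum>i\<in>I. f i z) = 0" if "z \<notin> torus" for z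
    by (intro sum.neutral ballI torus_cont_outside assms that)
qed

lemma torus_cont_mult:
  assumes "f \<in> torus_cont" "g \<in> torus_cont" shows "(\<lambda>z. f z * g z) \<in> torus_cont"
  by (rule torus_contI) (use assms in \<open>simp_all add: continuous_on_mult torus_cont_continuous
      torus_cont_outside[OF assms(1)]\<close>)

lemma torus_cont_cnj:
  assumes "f \<in> torus_cont" shows "(\<lambda>z. cnj (f z)) \<in> torus_cont"
  by (rule torus_contI) (use assms in \<open>simp_all add: continuous_on_cnj torus_cont_continuous
      torus_cont_outside[OF assms(1)]\<close>)

text \<open>Reindexing in a convolution: \<open>T\<close> is a support, and \<open>U\<close> any finite set that contains its
  translate by \<open>j\<close>.\<close>

lemma sum_shift:
  fixes g :: "int \<Rightarrow> 'b::comm_monoid_add"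
  assumes "finite U" "\<And>i. i \<in> T \<Longrightarrow> i + j \<in> U" "\<And>l. l - j \<notin> T \<Longrightarrow> g l = 0"
  shows "(\<Sum>l\<in>U. g l) = (\<Sum>i\<in>T. g (i + j))"
proof -
  have "(\<Sum>l\<in>U. g l) = (\<Sum>l\<in>(\<lambda>i. i + j) ` T. g l)"
  proof (rule sum.mono_neutral_right)
    show "\<forall>l\<in>U - (\<lambda>i. i + j) ` T. g l = 0"
    proof
      fix l assume "l \<in> U - (\<lambda>i. i + j) ` T"
      then have "l - j \<notin> T" by (auto simp: image_iff) 
      then show "g l = 0" by (rule assms)
    qed
  qed (use assms in auto)
  also have "\<dots> = (\<Sum>i\<in>T. g (i + j))"
    by (subst sum.reindex) (auto simp: inj_on_def)
  finally show ?thesis .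
qed

locale unimodular =
  fixes A :: "int ^ 'd ^ 'd"
  assumes unimodular: "\<bar>det A\<bar> = 1"
begin

lemma torus_iter_closed: "z \<in> torus \<Longrightarrow> torus_iter A k z \<in> torus"
proof -
  have 1: "(torus_map A ^^ n) z \<in> torus" if "z \<in> torus" for n z
    using that by (induction n) (auto simp: torus_map_in)
  have 2: "(inv_into torus (torus_map A) ^^ n) z \<in> torus" if "z \<in> torus" for n z
    using that by (induction n)
      (auto intro!: inv_into_into simp: bij_betw_imp_surj_on[OF bij_betw_torus_map[OF unimodular]])
  show "z \<in> torus \<Longrightarrow> torus_iter A k z \<in> torus"
    using 1 2 by (simp add: torus_iter_def)
qed

lemma torus_map_inv: "z \<in> torus \<Longrightarrow> torus_map A (inv_into torus (torus_map A) z) = z"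
  using bij_betw_torus_map[OF unimodular] by (simp add: bij_betw_inv_into_right)

lemma inv_torus_map: "z \<in> torus \<Longrightarrow> inv_into torus (torus_map A) (torus_map A z) = z"
  using bij_betw_torus_map[OF unimodular] by (simp add: bij_betw_inv_into_left)

lemma torus_iter_0: "torus_iter A 0 z = z"
  by (simp add: torus_iter_def)

lemma torus_iter_1: "torus_iter A 1 z = torus_map A z"
  by (simp add: torus_iter_def)

lemma torus_iter_plus1:
  assumes z: "z \<in> torus" shows "torus_iter A (k + 1) z = torus_map A (torus_iter A k z)"
proof (cases "0 \<le> k")
  case True
  then have "nat (k + 1) = Suc (nat k)" by simp
  then show ?thesis using True by (simp add: torus_iter_def)
next
  case False
  define m where "m = nat (- (k + 1))"
  have m: "nat (- k) = Suc m" using False by (simp add: m_def)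
  have "torus_iter A (k + 1) z = (inv_into torus (torus_map A) ^^ m) z"
    using False by (cases "k + 1 = 0") (auto simp: torus_iter_def m_def)
  moreover have "torus_iter A k z = inv_into torus (torus_map A) ((inv_into torus (torus_map A) ^^ m) z)"
    using False by (simp add: torus_iter_def m)
  ultimately show ?thesis
    using torus_iter_closed[OF z, of "k + 1"] by (simp add: torus_map_inv)
qed

lemma torus_iter_minus1:
  assumes z: "z \<in> torus" shows "torus_iter A (k - 1) z = inv_into torus (torus_map A) (torus_iter A k z)"
  using torus_iter_plus1[OF z, of "k - 1"] torus_iter_closed[OF z, of "k - 1"]
  by (simp add: inv_torus_map)

lemma torus_iter_add:
  assumes z: "z \<in> torus" shows "torus_iter A j (torus_iter A k z) = torus_iter A (j + k) z"
proof (induction j rule: int_induct[where k = 0])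
  case base
  show ?case by (simp add: torus_iter_0)
next
  case (step1 i)
  then show ?case
    using torus_iter_plus1[OF torus_iter_closed[OF z], of i k] torus_iter_plus1[OF z, of "i + k"]
    by (simp add: algebra_simps)
next
  case (step2 i)
  then show ?case
    using torus_iter_minus1[OF torus_iter_closed[OF z], of i k] torus_iter_minus1[OF z, of "i + k"]
    by (simp add: algebra_simps)
qed

lemma continuous_torus_iter: "continuous_on torus (torus_iter A k)"
proof -
  let ?g = "inv_into torus (torus_map A)"
  have surj: "torus_map A ` torus = torus"
    using bij_betw_torus_map[OF unimodular] by (rule bij_betw_imp_surj_on)
  have g: "continuous_on torus ?g"
    using continuous_on_inv[OF continuous_torus_map[of A] compact_torus, of ?g] surj
    by (simp add: inv_torus_map)
  show ?thesis
  proof (induction k rule: int_induct[where k = 0])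
    case base
    show ?case by (simp add: torus_iter_0[abs_def])
  next
    case (step1 i)
    have "continuous_on torus (\<lambda>z. torus_map A (torus_iter A i z))"
      using step1 by (intro continuous_on_compose2[OF continuous_torus_map]) (auto simp: torus_iter_closed)
    then show ?case
      by (rule continuous_on_eq) (simp add: torus_iter_plus1)
  next
    case (step2 i)
    have "continuous_on torus (\<lambda>z. ?g (torus_iter A i z))"
      using step2 by (intro continuous_on_compose2[OF g]) (auto simp: torus_iter_closed)
    then show ?case
      by (rule continuous_on_eq) (simp add: torus_iter_minus1)
  qed
qed

lemma alpha_apply: "alpha A k f z = (if z \<in> torus then f (torus_iter A k z) else 0)"
  by (simp add: alpha_def torus_extend_def)

lemma torus_cont_alpha: "f \<in> torus_cont \<Longrightarrow> alpha A k f \<in> torus_cont"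
proof (rule torus_contI)
  assume "f \<in> torus_cont"
  then have "continuous_on torus (\<lambda>z. f (torus_iter A k z))"
    by (intro continuous_on_compose2[OF torus_cont_continuous continuous_torus_iter])
      (auto simp: torus_iter_closed)
  then show "continuous_on torus (alpha A k f)"
    by (rule continuous_on_eq) (simp add: alpha_apply)
qed (simp add: alpha_apply)

abbreviation "CA \<equiv> conv_algebra A"

lemma carrier_iff: "a \<in> carrier CA \<longleftrightarrow> (\<forall>k. a k \<in> torus_cont) \<and> finite {k. a k \<noteq> (\<lambda>z. 0)}"
  by (simp add: conv_algebra_def)

lemma carrier_finite: "a \<in> carrier CA \<Longrightarrow> finite {k. a k \<noteq> (\<lambda>z. 0)}"
  and carrier_cont: "a \<in> carrier CA \<Longrightarrow> a k \<in> torus_cont"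
  and carrier_outside: "a \<in> carrier CA \<Longrightarrow> z \<notin> torus \<Longrightarrow> a k z = 0"
  by (auto simp: carrier_iff torus_cont_outside)

lemma conv_mult_outside: "z \<notin> torus \<Longrightarrow> (a \<otimes>\<^bsub>CA\<^esub> b) k z = 0"
  by (simp add: conv_simps alpha_apply)

lemma conv_mult_apply:
  assumes "finite S" "\<And>j. j \<notin> S \<Longrightarrow> a j = (\<lambda>z. 0)" "z \<in> torus"
  shows "(a \<otimes>\<^bsub>CA\<^esub> b) k z = (\<Sum>j\<in>S. a j z * b (k - j) (torus_iter A j z))"
  unfolding conv_simps using assms
  by (intro sum.mono_neutral_cong_left) (auto simp: alpha_apply)

lemma conv_mult_closed:
  assumes a: "a \<in> carrier CA" and b: "b \<in> carrier CA" shows "a \<otimes>\<^bsub>CA\<^esub> b \<in> carrier CA"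
  unfolding carrier_iff
proof (intro conjI allI)
  fix k show "(a \<otimes>\<^bsub>CA\<^esub> b) k \<in> torus_cont"
    unfolding conv_simps using a b
    by (intro torus_cont_sum torus_cont_mult torus_cont_alpha) (auto simp: carrier_cont)
next
  let ?S = "{k. a k \<noteq> (\<lambda>z. 0)}" and ?T = "{k. b k \<noteq> (\<lambda>z. 0)}"
  have "{k. (a \<otimes>\<^bsub>CA\<^esub> b) k \<noteq> (\<lambda>z. 0)} \<subseteq> (\<lambda>(i, j). i + j) ` (?S \<times> ?T)"
  proof
    fix k assume "k \<in> {k. (a \<otimes>\<^bsub>CA\<^esub> b) k \<noteq> (\<lambda>z. 0)}"
    then obtain z where z: "(a \<otimes>\<^bsub>CA\<^esub> b) k z \<noteq> 0" by (auto simp: fun_eq_iff)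
    then obtain j where "j \<in> ?S" "a j z * alpha A j (b (k - j)) z \<noteq> 0"
      unfolding conv_simps by (rule sum.not_neutral_contains_not_neutral)
    then have "k - j \<in> ?T" by (auto simp: alpha_apply split: if_splits)
    with \<open>j \<in> ?S\<close> show "k \<in> (\<lambda>(i, j). i + j) ` (?S \<times> ?T)"
      by (intro image_eqI[of _ _ "(j, k - j)"]) auto
  qed
  then show "finite {k. (a \<otimes>\<^bsub>CA\<^esub> b) k \<noteq> (\<lambda>z. 0)}"
    by (rule finite_subset) (use a b in \<open>auto simp: carrier_finite\<close>)
qed

text \<open>Both sides expand to the sum over \<open>j\<close> and \<open>l\<close> of
  \<open>a\<^sub>j(z) b\<^bsub>l-j\<^esub>(\<sigma>\<^sup>j z) c\<^bsub>k-l\<^esub>(\<sigma>\<^sup>l z)\<close>, by the group law \<open>torus_iter_add\<close>.\<close>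

lemma conv_assoc:
  assumes a: "a \<in> carrier CA" and b: "b \<in> carrier CA" and c: "c \<in> carrier CA"
  shows "a \<otimes>\<^bsub>CA\<^esub> b \<otimes>\<^bsub>CA\<^esub> c = a \<otimes>\<^bsub>CA\<^esub> (b \<otimes>\<^bsub>CA\<^esub> c)"
proof (intro ext)
  fix k z
  define S T where "S = {k. a k \<noteq> (\<lambda>z. 0)}" and "T = {k. b k \<noteq> (\<lambda>z. 0)}"
  define U where "U = (\<lambda>(i, j). i + j) ` (T \<times> S) \<union> {k. (a \<otimes>\<^bsub>CA\<^esub> b) k \<noteq> (\<lambda>z. 0)}"
  have fin: "finite S" "finite T" "finite U"
    using a b conv_mult_closed[OF a b] by (auto simp: S_def T_def U_def carrier_finite)
  have S: "a j = (\<lambda>z. 0)" if "j \<notin> S" for j using that by (simp add: S_def)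
  have T: "b j = (\<lambda>z. 0)" if "j \<notin> T" for j using that by (simp add: T_def)
  have U: "(a \<otimes>\<^bsub>CA\<^esub> b) j = (\<lambda>z. 0)" if "j \<notin> U" for j using that by (simp add: U_def)
  show "(a \<otimes>\<^bsub>CA\<^esub> b \<otimes>\<^bsub>CA\<^esub> c) k z = (a \<otimes>\<^bsub>CA\<^esub> (b \<otimes>\<^bsub>CA\<^esub> c)) k z"
  proof (cases "z \<in> torus")
    case z: True
    let ?g = "\<lambda>j l. b (l - j) (torus_iter A j z) * c (k - l) (torus_iter A l z)"
    have ab: "(a \<otimes>\<^bsub>CA\<^esub> b) l z = (\<Sum>j\<in>S. a j z * b (l - j) (torus_iter A j z))" for l
      by (rule conv_mult_apply[OF fin(1) S z])
    have "(a \<otimes>\<^bsub>CA\<^esub> b \<otimes>\<^bsub>CA\<^esub> c) k z = (\<Sum>l\<in>U. (a \<otimes>\<^bsub>CA\<^esub> b) l z * c (k - l) (torus_iter A l z))"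
      by (rule conv_mult_apply[OF fin(3) U z])
    also have "\<dots> = (\<Sum>l\<in>U. \<Sum>j\<in>S. a j z * ?g j l)"
      by (simp only: ab sum_distrib_right mult.assoc)
    also have "\<dots> = (\<Sum>j\<in>S. a j z * (\<Sum>l\<in>U. ?g j l))"
      by (subst sum.swap) (simp only: sum_distrib_left)
    also have "\<dots> = (\<Sum>j\<in>S. a j z * (\<Sum>i\<in>T. ?g j (i + j)))"
    proof (rule sum.cong[OF refl])
      fix j assume "j \<in> S"
      then have "(\<Sum>l\<in>U. ?g j l) = (\<Sum>i\<in>T. ?g j (i + j))"
        by (intro sum_shift[OF fin(3)]) (auto simp: U_def T)
      then show "a j z * (\<Sum>l\<in>U. ?g j l) = a j z * (\<Sum>i\<in>T. ?g j (i + j))"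
        by (rule arg_cong)
    qed
    also have "\<dots> = (\<Sum>j\<in>S. a j z * (b \<otimes>\<^bsub>CA\<^esub> c) (k - j) (torus_iter A j z))"
      by (simp add: conv_mult_apply[OF fin(2) T torus_iter_closed[OF z]] torus_iter_add[OF z] algebra_simps)
    also have "\<dots> = (a \<otimes>\<^bsub>CA\<^esub> (b \<otimes>\<^bsub>CA\<^esub> c)) k z"
      by (rule conv_mult_apply[OF fin(1) S z, symmetric])
    finally show ?thesis .
  qed (simp add: conv_mult_outside)
qed

lemma conv_star_apply: "star CA a k z = (if z \<in> torus then cnj (a (- k) (torus_iter A k z)) else 0)"
  by (simp add: conv_simps alpha_apply)

lemma conv_star_closed:
  assumes a: "a \<in> carrier CA" shows "star CA a \<in> carrier CA"
  unfolding carrier_iff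
proof (intro conjI allI)
  fix k show "star CA a k \<in> torus_cont"
    unfolding conv_simps using a by (intro torus_cont_alpha torus_cont_cnj) (rule carrier_cont)
next
  have "{k. star CA a k \<noteq> (\<lambda>z. 0)} \<subseteq> uminus ` {k. a k \<noteq> (\<lambda>z. 0)}"
  proof
    fix k assume "k \<in> {k. star CA a k \<noteq> (\<lambda>z. 0)}"
    then have "a (- k) \<noteq> (\<lambda>z. 0)" by (auto simp: fun_eq_iff conv_star_apply split: if_splits)
    then show "k \<in> uminus ` {k. a k \<noteq> (\<lambda>z. 0)}" by (intro image_eqI[of _ _ "- k"]) auto
  qed
  then show "finite {k. star CA a k \<noteq> (\<lambda>z. 0)}"
    by (rule finite_subset) (use a in \<open>simp add: carrier_finite\<close>)
qed

text \<open>The substitution \<open>l = j + k\<close> matches the two sums, with \<open>j\<close> the degree taken from \<open>a\<close>.\<close>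

lemma conv_star_mult:
  assumes a: "a \<in> carrier CA" and b: "b \<in> carrier CA"
  shows "star CA (a \<otimes>\<^bsub>CA\<^esub> b) = star CA b \<otimes>\<^bsub>CA\<^esub> star CA a"
proof (intro ext)
  fix k z
  define S where "S = {k. a k \<noteq> (\<lambda>z. 0)}"
  define U where "U = (\<lambda>j. j + k) ` S \<union> {k. star CA b k \<noteq> (\<lambda>z. 0)}"
  have fin: "finite S" "finite U"
    using a conv_star_closed[OF b] by (auto simp: S_def U_def carrier_finite)
  have S: "a j = (\<lambda>z. 0)" if "j \<notin> S" for j using that by (simp add: S_def)
  have U: "star CA b j = (\<lambda>z. 0)" if "j \<notin> U" for j using that by (simp add: U_def)
  show "star CA (a \<otimes>\<^bsub>CA\<^esub> b) k z = (star CA b \<otimes>\<^bsub>CA\<^esub> star CA a) k z"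
  proof (cases "z \<in> torus")
    case z: True
    let ?g = "\<lambda>l. star CA b l z * star CA a (k - l) (torus_iter A l z)"
    have g: "?g l = cnj (a (l - k) (torus_iter A k z)) * cnj (b (- l) (torus_iter A l z))" for l
      using z by (simp add: conv_star_apply torus_iter_closed torus_iter_add)
    have "(star CA b \<otimes>\<^bsub>CA\<^esub> star CA a) k z = (\<Sum>l\<in>U. ?g l)"
      by (rule conv_mult_apply[OF fin(2) U z])
    also have "\<dots> = (\<Sum>j\<in>S. ?g (j + k))"
      by (rule sum_shift[OF fin(2)]) (auto simp: U_def g S)
    also have "\<dots> = (\<Sum>j\<in>S. cnj (a j (torus_iter A k z) * b (- k - j) (torus_iter A j (torus_iter A k z))))"
    proof (rule sum.cong[OF refl])
      fix j
      have e: "- (j + k) = - k - j" by simp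
      show "?g (j + k) = cnj (a j (torus_iter A k z) * b (- k - j) (torus_iter A j (torus_iter A k z)))"
        unfolding g e by (simp add: torus_iter_add[OF z])
    qed
    also have "\<dots> = star CA (a \<otimes>\<^bsub>CA\<^esub> b) k z"
      using z by (simp add: conv_star_apply conv_mult_apply[OF fin(1) S torus_iter_closed[OF z]])
    finally show ?thesis by simp
  qed (simp add: conv_mult_outside conv_star_apply)
qed

lemma conv_star_star:
  assumes a: "a \<in> carrier CA" shows "star CA (star CA a) = a"
  using a by (auto simp: fun_eq_iff conv_star_apply torus_iter_closed torus_iter_add torus_iter_0 carrier_outside[OF a])

lemma conv_distrib:
  assumes a: "a \<in> carrier CA" and b: "b \<in> carrier CA" and c: "c \<in> carrier CA"
  shows "(a \<oplus>\<^bsub>CA\<^esub> b) \<otimes>\<^bsub>CA\<^esub> c = a \<otimes>\<^bsub>CA\<^esub> c \<oplus>\<^bsub>CA\<^esub> b \<otimes>\<^bsub>CA\<^esub> c"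
    "c \<otimes>\<^bsub>CA\<^esub> (a \<oplus>\<^bsub>CA\<^esub> b) = c \<otimes>\<^bsub>CA\<^esub> a \<oplus>\<^bsub>CA\<^esub> c \<otimes>\<^bsub>CA\<^esub> b"
proof -
  have plus: "(x \<oplus>\<^bsub>CA\<^esub> y) k z = x k z + y k z" for x y k z by (simp add: conv_simps)
  show "(a \<oplus>\<^bsub>CA\<^esub> b) \<otimes>\<^bsub>CA\<^esub> c = a \<otimes>\<^bsub>CA\<^esub> c \<oplus>\<^bsub>CA\<^esub> b \<otimes>\<^bsub>CA\<^esub> c"
  proof (intro ext)
    fix k z
    let ?S = "{k. a k \<noteq> (\<lambda>z. 0)} \<union> {k. b k \<noteq> (\<lambda>z. 0)}"
    have f: "finite ?S" using a b by (simp add: carrier_finite)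
    have m: "(x \<otimes>\<^bsub>CA\<^esub> c) k z = (\<Sum>j\<in>?S. x j z * c (k - j) (torus_iter A j z))"
      if "z \<in> torus" "x = a \<or> x = b \<or> x = a \<oplus>\<^bsub>CA\<^esub> b" for x
      using that by (intro conv_mult_apply[OF f]) (auto simp: fun_eq_iff plus)
    show "((a \<oplus>\<^bsub>CA\<^esub> b) \<otimes>\<^bsub>CA\<^esub> c) k z = (a \<otimes>\<^bsub>CA\<^esub> c \<oplus>\<^bsub>CA\<^esub> b \<otimes>\<^bsub>CA\<^esub> c) k z"
      unfolding plus[of "a \<otimes>\<^bsub>CA\<^esub> c"]
      by (cases "z \<in> torus") (simp_all add: m plus conv_mult_outside sum.distrib distrib_right)
  qed
  show "c \<otimes>\<^bsub>CA\<^esub> (a \<oplus>\<^bsub>CA\<^esub> b) = c \<otimes>\<^bsub>CA\<^esub> a \<oplus>\<^bsub>CA\<^esub> c \<otimes>\<^bsub>CA\<^esub> b"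
  proof (intro ext)
    fix k z
    show "(c \<otimes>\<^bsub>CA\<^esub> (a \<oplus>\<^bsub>CA\<^esub> b)) k z = (c \<otimes>\<^bsub>CA\<^esub> a \<oplus>\<^bsub>CA\<^esub> c \<otimes>\<^bsub>CA\<^esub> b) k z"
      by (cases "z \<in> torus") (simp_all add: conv_simps alpha_apply distrib_left sum.distrib)
  qed
qed

lemma conv_one: "\<one>\<^bsub>CA\<^esub> = single (\<lambda>z. 1) 0"
  by (simp add: conv_algebra_def single_def)

lemma conv_one_mult:
  assumes a: "a \<in> carrier CA"
  shows "\<one>\<^bsub>CA\<^esub> \<otimes>\<^bsub>CA\<^esub> a = a" "a \<otimes>\<^bsub>CA\<^esub> \<one>\<^bsub>CA\<^esub> = a"
proof -
  have one: "\<one>\<^bsub>CA\<^esub> k z = (if k = 0 \<and> z \<in> torus then 1 else 0)" for k z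
    by (simp add: conv_one single_def torus_extend_def)
  show "\<one>\<^bsub>CA\<^esub> \<otimes>\<^bsub>CA\<^esub> a = a"
  proof (intro ext)
    fix k z show "(\<one>\<^bsub>CA\<^esub> \<otimes>\<^bsub>CA\<^esub> a) k z = a k z"
    proof (cases "z \<in> torus")
      case True
      then have "(\<one>\<^bsub>CA\<^esub> \<otimes>\<^bsub>CA\<^esub> a) k z = (\<Sum>j\<in>{0}. \<one>\<^bsub>CA\<^esub> j z * a (k - j) (torus_iter A j z))"
        by (intro conv_mult_apply) (auto simp: one fun_eq_iff)
      then show ?thesis using True by (simp add: one torus_iter_0)
    qed (use a in \<open>simp add: conv_mult_outside carrier_outside[OF a]\<close>)
  qed
  show "a \<otimes>\<^bsub>CA\<^esub> \<one>\<^bsub>CA\<^esub> = a"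
  proof (intro ext)
    fix k z
    define S where "S = insert k {k. a k \<noteq> (\<lambda>z. 0)}"
    have S: "finite S" "k \<in> S" "\<And>j. j \<notin> S \<Longrightarrow> a j = (\<lambda>z. 0)"
      using a by (auto simp: S_def carrier_finite)
    show "(a \<otimes>\<^bsub>CA\<^esub> \<one>\<^bsub>CA\<^esub>) k z = a k z"
    proof (cases "z \<in> torus")
      case True
      then have "(a \<otimes>\<^bsub>CA\<^esub> \<one>\<^bsub>CA\<^esub>) k z = (\<Sum>j\<in>S. a j z * \<one>\<^bsub>CA\<^esub> (k - j) (torus_iter A j z))"
        by (intro conv_mult_apply S)
      also have "\<dots> = (\<Sum>j\<in>S. if j = k then a j z else 0)"
        using True by (intro sum.cong) (auto simp: one torus_iter_closed)
      finally show ?thesis using S by simp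
    qed (use a in \<open>simp add: conv_mult_outside carrier_outside[OF a]\<close>)
  qed
qed

lemma conv_smult_closed: "a \<in> carrier CA \<Longrightarrow> c \<odot>\<^bsub>CA\<^esub> a \<in> carrier CA"
  using conv_scale_closed[of a A "\<lambda>k. c"] by (simp add: conv_simps)

lemma conv_smult_mult: "(c \<odot>\<^bsub>CA\<^esub> a) \<otimes>\<^bsub>CA\<^esub> b = c \<odot>\<^bsub>CA\<^esub> (a \<otimes>\<^bsub>CA\<^esub> b)"
proof (cases "c = 0")
  case True
  then show ?thesis by (simp add: conv_simps)
next
  case False
  then have "{j. (\<lambda>z. c * a j z) \<noteq> (\<lambda>z. 0)} = {j. a j \<noteq> (\<lambda>z. 0)}" by (auto simp: fun_eq_iff)
  then show ?thesis by (simp add: conv_simps sum_distrib_left mult.assoc)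
qed

lemma conv_zero_closed: "\<zero>\<^bsub>CA\<^esub> \<in> carrier CA"
  by (simp add: conv_algebra_def torus_cont_zero)

lemma conv_one_closed: "\<one>\<^bsub>CA\<^esub> \<in> carrier CA"
  unfolding conv_one by (rule single_closed) simp

lemma ring_conv_algebra: "ring CA"
proof (rule ringI)
  show "abelian_group CA"
  proof (rule abelian_groupI)
    show "\<exists>y\<in>carrier CA. y \<oplus>\<^bsub>CA\<^esub> x = \<zero>\<^bsub>CA\<^esub>" if "x \<in> carrier CA" for x
      using conv_smult_closed[OF that, of "-1"]
      by (intro bexI[of _ "(-1) \<odot>\<^bsub>CA\<^esub> x"]) (simp_all add: conv_algebra_def)
  qed (auto simp: conv_zero_closed intro: conv_add_closed, auto simp: conv_algebra_def algebra_simps)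
  show "monoid CA"
    by (rule monoidI) (simp_all add: conv_mult_closed conv_one_closed conv_assoc conv_one_mult)
qed (simp_all add: conv_distrib)

lemma star_algebra_conv_algebra: "star_algebra CA"
proof (intro star_algebra.intro ring_conv_algebra star_algebra_axioms.intro)
  fix x y c assume x: "x \<in> carrier CA" and y: "y \<in> carrier CA"
  show "c \<odot>\<^bsub>CA\<^esub> x \<in> carrier CA" using x by (rule conv_smult_closed)
  show "(c \<odot>\<^bsub>CA\<^esub> x) \<otimes>\<^bsub>CA\<^esub> y = c \<odot>\<^bsub>CA\<^esub> (x \<otimes>\<^bsub>CA\<^esub> y)" by (rule conv_smult_mult)
  show "x \<otimes>\<^bsub>CA\<^esub> (c \<odot>\<^bsub>CA\<^esub> y) = c \<odot>\<^bsub>CA\<^esub> (x \<otimes>\<^bsub>CA\<^esub> y)"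
  proof (intro ext)
    fix k z
    show "(x \<otimes>\<^bsub>CA\<^esub> (c \<odot>\<^bsub>CA\<^esub> y)) k z = (c \<odot>\<^bsub>CA\<^esub> (x \<otimes>\<^bsub>CA\<^esub> y)) k z"
      by (cases "z \<in> torus") (simp_all add: conv_simps alpha_apply sum_distrib_left mult_ac)
  qed
  show "star CA x \<in> carrier CA" using x by (rule conv_star_closed)
  show "star CA (star CA x) = x" using x by (rule conv_star_star)
  show "star CA (x \<otimes>\<^bsub>CA\<^esub> y) = star CA y \<otimes>\<^bsub>CA\<^esub> star CA x" using x y by (rule conv_star_mult)
  show "star CA (c \<odot>\<^bsub>CA\<^esub> x) = cnj c \<odot>\<^bsub>CA\<^esub> star CA x"
    by (intro ext) (simp add: conv_simps alpha_apply)
  show "star CA (x \<oplus>\<^bsub>CA\<^esub> y) = star CA x \<oplus>\<^bsub>CA\<^esub> star CA y"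
    by (intro ext) (simp add: conv_simps alpha_apply)
qed (simp_all add: conv_simps algebra_simps)

text \<open>Each axiom passes to suprema of seminorms; for the C*-identity because \<open>p x\<close> and
  \<open>p (star x \<otimes> x)\<close> determine each other monotonically.\<close>

lemma cstar_seminorm_universal_norm: "cstar_seminorm CA (universal_norm A)"
proof -
  interpret star_algebra CA by (rule star_algebra_conv_algebra)
  have p: "p (x \<otimes>\<^bsub>CA\<^esub> y) \<le> p x * p y" "p (star CA x \<otimes>\<^bsub>CA\<^esub> x) = (p x)\<^sup>2" "0 \<le> p x"
    if "p \<in> l1_seminorms A" "x \<in> carrier CA" "y \<in> carrier CA" for p x y
    using that by (auto simp: cstar_seminorm_def)
  show ?thesis
    unfolding cstar_seminorm_def
  proof (intro conjI ballI allI)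
    fix x assume x: "x \<in> carrier CA"
    show "0 \<le> universal_norm A x" using x by (rule universal_norm_nonneg)
    show "universal_norm A (c \<odot>\<^bsub>CA\<^esub> x) = cmod c * universal_norm A x" for c
    proof (cases "c = 0")
      case True
      then show ?thesis
        using universal_norm_scale_le[OF x, of c] universal_norm_nonneg[OF smult_closed[OF x], of c] by simp
    next
      case False
      have "universal_norm A x \<le> cmod (1 / c) * universal_norm A (c \<odot>\<^bsub>CA\<^esub> x)"
        using universal_norm_scale_le[OF smult_closed[OF x], of "1 / c" c] x False by (simp add: smult_smult)
      then have "cmod c * universal_norm A x \<le> universal_norm A (c \<odot>\<^bsub>CA\<^esub> x)"
        using False by (simp add: norm_divide field_simps)
      then show ?thesis using universal_norm_scale_le[OF x, of c] by simp
    qed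
    show "universal_norm A (star CA x \<otimes>\<^bsub>CA\<^esub> x) = (universal_norm A x)\<^sup>2"
    proof (rule antisym)
      show "universal_norm A (star CA x \<otimes>\<^bsub>CA\<^esub> x) \<le> (universal_norm A x)\<^sup>2"
      proof (rule universal_norm_least)
        fix p assume "p \<in> l1_seminorms A"
        then show "p (star CA x \<otimes>\<^bsub>CA\<^esub> x) \<le> (universal_norm A x)\<^sup>2"
          using p[of p x x] x universal_norm_upper[of p A x] by (simp add: power_mono)
      qed
      have "universal_norm A x \<le> sqrt (universal_norm A (star CA x \<otimes>\<^bsub>CA\<^esub> x))"
      proof (rule universal_norm_least)
        fix p assume q: "p \<in> l1_seminorms A"
        then have "(p x)\<^sup>2 \<le> universal_norm A (star CA x \<otimes>\<^bsub>CA\<^esub> x)"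
          using p[of p x x] x universal_norm_upper[of p A "star CA x \<otimes>\<^bsub>CA\<^esub> x"] by simp
        then show "p x \<le> sqrt (universal_norm A (star CA x \<otimes>\<^bsub>CA\<^esub> x))"
          by (rule real_le_rsqrt)
      qed
      then show "(universal_norm A x)\<^sup>2 \<le> universal_norm A (star CA x \<otimes>\<^bsub>CA\<^esub> x)"
        using x universal_norm_nonneg[OF x] universal_norm_nonneg[of "star CA x \<otimes>\<^bsub>CA\<^esub> x" A]
        by (simp add: real_le_rsqrt sqrt_ge_absD)
    qed
  next
    fix x y assume x: "x \<in> carrier CA" and y: "y \<in> carrier CA"
    show "universal_norm A (x \<oplus>\<^bsub>CA\<^esub> y) \<le> universal_norm A x + universal_norm A y"
      using x y by (rule universal_norm_add)
    show "universal_norm A (x \<otimes>\<^bsub>CA\<^esub> y) \<le> universal_norm A x * universal_norm A y"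
    proof (rule universal_norm_least)
      fix q assume q: "q \<in> l1_seminorms A"
      have "q (x \<otimes>\<^bsub>CA\<^esub> y) \<le> q x * q y" using p(1)[OF q x y] .
      also have "\<dots> \<le> universal_norm A x * universal_norm A y"
        using x y p(3)[OF q] by (intro mult_mono universal_norm_upper q universal_norm_nonneg) auto
      finally show "q (x \<otimes>\<^bsub>CA\<^esub> y) \<le> universal_norm A x * universal_norm A y" .
    qed
  qed
qed

lemma cstar_seminormed_algebra_conv_algebra: "cstar_seminormed_algebra CA (universal_norm A)"
  by (intro cstar_seminormed_algebra.intro cstar_seminormed_algebra_axioms.intro
      star_algebra_conv_algebra cstar_seminorm_universal_norm)

end

sublocale unimodular \<subseteq> cstar_seminormed_algebra CA "universal_norm A"
  by (rule cstar_seminormed_algebra_conv_algebra)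

section \<open>The generators of the crossed product\<close>

context unimodular
begin

lemma cp_embed_closed: "a \<in> carrier CA \<Longrightarrow> cp_embed A a \<in> carrier (crossed_product A)"
  unfolding cp_embed_def crossed_product_def by (intro cls_closed const_cauchy)

lemma cp_embed_mult:
  "a \<in> carrier CA \<Longrightarrow> b \<in> carrier CA \<Longrightarrow>
    cp_embed A a \<otimes>\<^bsub>crossed_product A\<^esub> cp_embed A b = cp_embed A (a \<otimes>\<^bsub>CA\<^esub> b)"
  unfolding cp_embed_def crossed_product_def by (intro cls_mult const_cauchy)

lemma cp_embed_add:
  "a \<in> carrier CA \<Longrightarrow> b \<in> carrier CA \<Longrightarrow>
    cp_embed A a \<oplus>\<^bsub>crossed_product A\<^esub> cp_embed A b = cp_embed A (a \<oplus>\<^bsub>CA\<^esub> b)"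
  unfolding cp_embed_def crossed_product_def by (intro cls_add const_cauchy)

lemma cp_embed_star:
  "a \<in> carrier CA \<Longrightarrow> star (crossed_product A) (cp_embed A a) = cp_embed A (star CA a)"
  unfolding cp_embed_def crossed_product_def by (intro cls_star const_cauchy)

lemma cp_embed_one: "\<one>\<^bsub>crossed_product A\<^esub> = cp_embed A (single (\<lambda>z. 1) 0)"
  unfolding cp_embed_def crossed_product_def conv_one[symmetric]
  by (simp add: completion_def)

lemma single_mult_unitary: "single f j \<otimes>\<^bsub>CA\<^esub> single (\<lambda>z. 1) k = single f (j + k)"
  unfolding single_mult
  by (auto simp: single_def fun_eq_iff torus_extend_def alpha_apply torus_iter_closed)

lemma single_one_closed: "single (\<lambda>z. 1) k \<in> carrier CA"
  by (rule single_closed) simp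

text \<open>Negative powers are defined through the inverse as the unique two-sided inverse, and
  uniqueness needs the associativity of the crossed product (\<open>monoid_completion\<close>).\<close>

lemma v_bar_power: "v_bar A [^]\<^bsub>crossed_product A\<^esub> (k :: int) = cp_embed A (single (\<lambda>z. 1) k)"
proof -
  interpret C: monoid "crossed_product A"
    unfolding crossed_product_def by (rule monoid_completion)
  let ?v = "\<lambda>k. cp_embed A (single (\<lambda>z. 1) k)"
  have v: "?v k \<in> carrier (crossed_product A)" for k
    by (intro cp_embed_closed single_one_closed)
  have mult: "?v j \<otimes>\<^bsub>crossed_product A\<^esub> ?v k = ?v (j + k)" for j k
    by (simp only: cp_embed_mult[OF single_one_closed single_one_closed] single_mult_unitary)
  have nat: "v_bar A [^]\<^bsub>crossed_product A\<^esub> n = ?v (int n)" for n :: nat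
  proof (induction n)
    case (Suc n)
    then show ?case by (simp add: v_bar_def mult add.commute)
  qed (simp add: cp_embed_one)
  show ?thesis
  proof (cases "k < 0")
    case True
    have "inv\<^bsub>crossed_product A\<^esub> (?v (- k)) = ?v k"
      by (rule C.inv_char) (simp_all add: v mult cp_embed_one)
    then show ?thesis using True by (simp add: int_pow_def2 nat)
  qed (simp add: int_pow_def2 nat)
qed

lemma u_bar_v_bar_power:
  "u_bar A m \<otimes>\<^bsub>crossed_product A\<^esub> v_bar A [^]\<^bsub>crossed_product A\<^esub> (k :: int) =
    cp_embed A (single (torus_char m) k)"
  unfolding v_bar_power u_bar_def
  by (simp add: cp_embed_mult single_closed continuous_torus_char single_mult_unitary)

lemma dual_action_cls:
  assumes X: "X \<in> cauchy_seqs CA (universal_norm A)"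
  shows "(\<lambda>n. gauge_conv t (X n)) \<in> cauchy_seqs CA (universal_norm A)"
    "dual_action A t (cls X) = cls (\<lambda>n. gauge_conv t (X n))"
proof -
  have le: "universal_norm A (gauge_conv t x \<ominus>\<^bsub>CA\<^esub> gauge_conv t y) \<le> 1 * universal_norm A (x \<ominus>\<^bsub>CA\<^esub> y)"
    if "x \<in> carrier CA" "y \<in> carrier CA" for x y
  proof -
    have "gauge_conv t x \<ominus>\<^bsub>CA\<^esub> gauge_conv t y = gauge_conv t (x \<ominus>\<^bsub>CA\<^esub> y)"
      using that
      by (simp add: gauge_closed flip: add_smult_minus_one) (simp add: conv_simps gauge_conv_def algebra_simps)
    then show ?thesis using that by (simp add: universal_norm_gauge_le)
  qed
  note lift = cls_lift[OF X gauge_closed _ le, simplified]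
  show "(\<lambda>n. gauge_conv t (X n)) \<in> cauchy_seqs CA (universal_norm A)"
    by (rule lift(1))
  show "dual_action A t (cls X) = cls (\<lambda>n. gauge_conv t (X n))"
    unfolding dual_action_def gauge_conv_def[symmetric] by (rule lift(2))
qed

lemma carrier_continuous: "a \<in> carrier CA \<Longrightarrow> continuous_on torus (a k)"
  by (intro torus_cont_continuous carrier_cont)

lemma continuous_on_torus_iter:
  "continuous_on torus f \<Longrightarrow> continuous_on torus (\<lambda>z. f (torus_iter A k z))"
  by (rule continuous_on_compose2[OF _ continuous_torus_iter]) (auto simp: torus_iter_closed)

end

section \<open>The trace of an invariant measure\<close>

locale invariant_measure = unimodular A for A :: "int ^ 'd ^ 'd" +
  fixes \<mu> :: "(complex ^ 'd) measure"
  assumes prob: "torus_prob \<mu>" and invariant: "torus_pushforward A \<mu> = \<mu>"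
begin

sublocale \<mu>: prob_space \<mu>
  using prob by (simp add: torus_prob_def)

lemma sets_\<mu>: "sets \<mu> = sets (restrict_space borel torus)"
  using prob by (simp add: torus_prob_def)

lemma space_\<mu>: "space \<mu> = torus"
  using sets_eq_imp_space_eq[OF sets_\<mu>] by (simp add: space_restrict_space)

lemma measurable_continuous:
  fixes f :: "complex ^ 'd \<Rightarrow> 'b::{banach, second_countable_topology}"
  shows "continuous_on torus f \<Longrightarrow> f \<in> borel_measurable \<mu>"
  using borel_measurable_continuous_on_restrict[of torus f] measurable_cong_sets[OF sets_\<mu> refl]
  by blast

lemma integrable_continuous:
  fixes f :: "complex ^ 'd \<Rightarrow> 'b::{banach, second_countable_topology}"
  assumes f: "continuous_on torus f" shows "integrable \<mu> f"
proof -
  have "bounded (f ` torus)"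
    using compact_continuous_image[OF f compact_torus] by (rule compact_imp_bounded)
  then obtain B where "\<And>x. x \<in> torus \<Longrightarrow> norm (f x) \<le> B"
    unfolding bounded_iff by auto
  then show ?thesis
    using measurable_continuous[OF f] by (intro \<mu>.integrable_const_bound[of _ B]) (auto simp: space_\<mu>)
qed

lemma integral_torus_map:
  fixes f :: "complex ^ 'd \<Rightarrow> 'b::{banach, second_countable_topology}"
  assumes f: "continuous_on torus f"
  shows "(\<integral>z. f (torus_map A z) \<partial>\<mu>) = (\<integral>z. f z \<partial>\<mu>)"
proof -
  have m: "torus_map A \<in> measurable \<mu> (restrict_space borel torus)"
    by (rule measurable_restrict_space2)
      (auto simp: space_\<mu> torus_map_in intro: measurable_continuous continuous_torus_map)
  have "(\<integral>z. f z \<partial>\<mu>) = (\<integral>z. f z \<partial>distr \<mu> (restrict_space borel torus) (torus_map A))"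
    using invariant by (simp add: torus_pushforward_def)
  also have "\<dots> = (\<integral>z. f (torus_map A z) \<partial>\<mu>)"
    using m borel_measurable_continuous_on_restrict[OF f] by (rule integral_distr)
  finally show ?thesis ..
qed

lemma integral_torus_iter:
  fixes f :: "complex ^ 'd \<Rightarrow> 'b::{banach, second_countable_topology}"
  assumes f: "continuous_on torus f"
  shows "(\<integral>z. f (torus_iter A k z) \<partial>\<mu>) = (\<integral>z. f z \<partial>\<mu>)"
proof -
  have step: "(\<integral>z. f (torus_iter A (k + 1) z) \<partial>\<mu>) = (\<integral>z. f (torus_iter A k z) \<partial>\<mu>)" for k
  proof -
    have "(\<integral>z. f (torus_iter A (k + 1) z) \<partial>\<mu>) = (\<integral>z. f (torus_iter A k (torus_map A z)) \<partial>\<mu>)"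
      by (intro Bochner_Integration.integral_cong refl)
        (simp add: space_\<mu> torus_iter_add flip: torus_iter_1)
    also have "\<dots> = (\<integral>z. f (torus_iter A k z) \<partial>\<mu>)"
      by (rule integral_torus_map[OF continuous_on_torus_iter[OF f]])
    finally show ?thesis .
  qed
  show ?thesis
  proof (induction k rule: int_induct[where k = 0])
    case base
    show ?case by (simp add: torus_iter_0)
  next
    case (step1 i)
    then show ?case using step[of i] by simp
  next
    case (step2 i)
    then show ?case using step[of "i - 1"] by simp
  qed
qed

definition conv_trace :: "(int \<Rightarrow> complex ^ 'd \<Rightarrow> complex) \<Rightarrow> complex"
  where "conv_trace a = (\<integral>z. a 0 z \<partial>\<mu>)"

lemma conv_trace_mult:
  assumes a: "a \<in> carrier CA" and b: "b \<in> carrier CA"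
    and S: "finite S" "\<And>j. j \<notin> S \<Longrightarrow> a j = (\<lambda>z. 0)"
  shows "conv_trace (a \<otimes>\<^bsub>CA\<^esub> b) = (\<Sum>j\<in>S. \<integral>z. a j z * b (- j) (torus_iter A j z) \<partial>\<mu>)"
proof -
  have "conv_trace (a \<otimes>\<^bsub>CA\<^esub> b) = (\<integral>z. (\<Sum>j\<in>S. a j z * b (- j) (torus_iter A j z)) \<partial>\<mu>)"
    unfolding conv_trace_def
    by (intro Bochner_Integration.integral_cong refl) (simp add: space_\<mu> conv_mult_apply[OF S])
  also have "\<dots> = (\<Sum>j\<in>S. \<integral>z. a j z * b (- j) (torus_iter A j z) \<partial>\<mu>)"
    by (intro Bochner_Integration.integral_sum integrable_continuous continuous_on_mult
        carrier_continuous[OF a] continuous_on_torus_iter carrier_continuous[OF b])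
  finally show ?thesis .
qed

text \<open>The substitution \<open>z \<mapsto> \<sigma>\<^sup>-\<^sup>j z\<close>, allowed by invariance, turns the \<open>j\<close>-th term
  \<open>\<integral>a\<^sub>j(z) b\<^bsub>-j\<^esub>(\<sigma>\<^sup>j z)\<close> of one product into the \<open>(-j)\<close>-th term of the other.\<close>

lemma conv_trace_commute:
  assumes a: "a \<in> carrier CA" and b: "b \<in> carrier CA"
  shows "conv_trace (a \<otimes>\<^bsub>CA\<^esub> b) = conv_trace (b \<otimes>\<^bsub>CA\<^esub> a)"
proof -
  \<comment> \<open>One index set for both products: \<open>U\<close> contains the support of \<open>a\<close>, and \<open>- U\<close> that of \<open>b\<close>.\<close>
  define U where "U = {k. a k \<noteq> (\<lambda>z. 0)} \<union> uminus ` {k. b k \<noteq> (\<lambda>z. 0)}"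
  have fin: "finite U"
    using a b by (simp add: U_def carrier_finite)
  have Ua: "a j = (\<lambda>z. 0)" if "j \<notin> U" for j using that by (simp add: U_def)
  have Ub: "b j = (\<lambda>z. 0)" if "j \<notin> uminus ` U" for j
    using that by (force simp: U_def)
  have "(\<integral>z. a j z * b (- j) (torus_iter A j z) \<partial>\<mu>) = (\<integral>z. b (- j) z * a j (torus_iter A (- j) z) \<partial>\<mu>)" for j
  proof -
    have "(\<integral>z. b (- j) z * a j (torus_iter A (- j) z) \<partial>\<mu>) =
        (\<integral>z. b (- j) (torus_iter A j z) * a j (torus_iter A (- j) (torus_iter A j z)) \<partial>\<mu>)"
      by (rule integral_torus_iter[symmetric])
        (intro continuous_on_mult carrier_continuous[OF b] continuous_on_torus_iter carrier_continuous[OF a])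
    also have "\<dots> = (\<integral>z. a j z * b (- j) (torus_iter A j z) \<partial>\<mu>)"
      by (intro Bochner_Integration.integral_cong refl) (simp add: space_\<mu> torus_iter_add torus_iter_0)
    finally show ?thesis ..
  qed
  then have "conv_trace (a \<otimes>\<^bsub>CA\<^esub> b) = (\<Sum>j\<in>U. \<integral>z. b (- j) z * a j (torus_iter A (- j) z) \<partial>\<mu>)"
    by (simp add: conv_trace_mult[OF a b fin Ua])
  also have "\<dots> = (\<Sum>j\<in>uminus ` U. \<integral>z. b j z * a (- j) (torus_iter A j z) \<partial>\<mu>)"
    by (subst sum.reindex) (auto simp: inj_on_def)
  also have "\<dots> = conv_trace (b \<otimes>\<^bsub>CA\<^esub> a)"
    by (rule conv_trace_mult[OF b a _ Ub, symmetric]) (use fin in auto)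
  finally show ?thesis .
qed

text \<open>The term of degree \<open>j\<close> is \<open>|a\<^bsub>-j\<^esub>|\<^sup>2 \<circ> \<sigma>\<^sup>j\<close>, and invariance removes \<open>\<sigma>\<^sup>j\<close> under the integral. So
  the GNS norm is that of square-summable sequences in \<open>L\<^sup>2(\<mu>)\<close>.\<close>

lemma conv_trace_star_mult:
  assumes a: "a \<in> carrier CA" and S: "finite S" "\<And>j. j \<notin> S \<Longrightarrow> a j = (\<lambda>z. 0)"
  shows "conv_trace (star CA a \<otimes>\<^bsub>CA\<^esub> a) = complex_of_real (\<Sum>j\<in>S. \<integral>z. (cmod (a j z))\<^sup>2 \<partial>\<mu>)"
proof -
  have U: "star CA a j = (\<lambda>z. 0)" if "j \<notin> uminus ` S" for j
  proof -
    have "- j \<notin> S"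
    proof
      assume "- j \<in> S"
      then have "- (- j) \<in> uminus ` S" by (rule imageI)
      with that show False by simp
    qed
    then have "a (- j) = (\<lambda>z. 0)" by (rule S(2))
    then show ?thesis by (intro ext) (simp add: conv_star_apply)
  qed
  have cont: "continuous_on torus (\<lambda>z. (cmod (a j z))\<^sup>2)" for j
    by (intro continuous_intros carrier_continuous a)
  have "(\<integral>z. star CA a j z * a (- j) (torus_iter A j z) \<partial>\<mu>) =
      complex_of_real (\<integral>z. (cmod (a (- j) z))\<^sup>2 \<partial>\<mu>)" for j
  proof -
    have "(\<integral>z. star CA a j z * a (- j) (torus_iter A j z) \<partial>\<mu>) =
        (\<integral>z. complex_of_real ((cmod (a (- j) (torus_iter A j z)))\<^sup>2) \<partial>\<mu>)"
      unfolding complex_norm_square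
      by (intro Bochner_Integration.integral_cong refl) (simp add: space_\<mu> conv_star_apply mult.commute)
    also have "\<dots> = complex_of_real (\<integral>z. (cmod (a (- j) (torus_iter A j z)))\<^sup>2 \<partial>\<mu>)"
      by (rule integral_complex_of_real)
    also have "(\<integral>z. (cmod (a (- j) (torus_iter A j z)))\<^sup>2 \<partial>\<mu>) = (\<integral>z. (cmod (a (- j) z))\<^sup>2 \<partial>\<mu>)"
      using integral_torus_iter[OF cont] .
    finally show ?thesis .
  qed
  moreover have "conv_trace (star CA a \<otimes>\<^bsub>CA\<^esub> a) =
      (\<Sum>j\<in>uminus ` S. \<integral>z. star CA a j z * a (- j) (torus_iter A j z) \<partial>\<mu>)"
    by (rule conv_trace_mult[OF conv_star_closed[OF a] a _ U]) (use S(1) in simp)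
  ultimately have "conv_trace (star CA a \<otimes>\<^bsub>CA\<^esub> a) =
      (\<Sum>j\<in>uminus ` S. complex_of_real (\<integral>z. (cmod (a (- j) z))\<^sup>2 \<partial>\<mu>))"
    by simp
  also have "\<dots> = complex_of_real (\<Sum>j\<in>S. \<integral>z. (cmod (a j z))\<^sup>2 \<partial>\<mu>)"
    by (subst sum.reindex) (auto simp: inj_on_def)
  finally show ?thesis .
qed

lemma tracial_state_conv_trace: "tracial_state CA conv_trace"
  unfolding tracial_state_def
proof (intro conjI ballI allI)
  fix x assume x: "x \<in> carrier CA"
  show "conv_trace (c \<odot>\<^bsub>CA\<^esub> x) = c * conv_trace x" for c
    by (simp add: conv_trace_def conv_simps)
  have "conv_trace (star CA x \<otimes>\<^bsub>CA\<^esub> x) =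
      complex_of_real (\<Sum>j | x j \<noteq> (\<lambda>z. 0). \<integral>z. (cmod (x j z))\<^sup>2 \<partial>\<mu>)"
    using x by (intro conv_trace_star_mult) (auto simp: carrier_finite)
  moreover have "0 \<le> (\<Sum>j | x j \<noteq> (\<lambda>z. 0). \<integral>z. (cmod (x j z))\<^sup>2 \<partial>\<mu>)"
    by (intro sum_nonneg) simp
  ultimately show "conv_trace (star CA x \<otimes>\<^bsub>CA\<^esub> x) \<in> \<real>\<^sub>\<ge>\<^sub>0"
    by (simp only: nonneg_Reals_of_real_iff)
  fix y assume y: "y \<in> carrier CA"
  show "conv_trace (x \<otimes>\<^bsub>CA\<^esub> y) = conv_trace (y \<otimes>\<^bsub>CA\<^esub> x)"
    using x y by (rule conv_trace_commute)
  show "conv_trace (x \<oplus>\<^bsub>CA\<^esub> y) = conv_trace x + conv_trace y"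
    using integrable_continuous[OF carrier_continuous[OF x]] integrable_continuous[OF carrier_continuous[OF y]]
    by (simp add: conv_trace_def conv_simps)
next
  have "conv_trace \<one>\<^bsub>CA\<^esub> = (\<integral>z. 1 \<partial>\<mu>)"
    unfolding conv_trace_def
    by (intro Bochner_Integration.integral_cong refl) (simp add: space_\<mu> conv_one single_def torus_extend_def)
  then show "conv_trace \<one>\<^bsub>CA\<^esub> = 1" by (simp add: \<mu>.prob_space)
qed

sublocale star_algebra_state CA conv_trace
proof (intro star_algebra_state.intro star_algebra_conv_algebra star_algebra_state_axioms.intro)
qed (use tracial_state_conv_trace in \<open>auto simp: tracial_state_def\<close>)

lemma gns_norm_sq_eq:
  assumes a: "a \<in> carrier CA" and S: "finite S" "\<And>j. j \<notin> S \<Longrightarrow> a j = (\<lambda>z. 0)"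
  shows "(gns_norm a)\<^sup>2 = (\<Sum>j\<in>S. \<integral>z. (cmod (a j z))\<^sup>2 \<partial>\<mu>)"
proof -
  have "conv_trace (star CA a \<otimes>\<^bsub>CA\<^esub> a) = complex_of_real (\<Sum>j\<in>S. \<integral>z. (cmod (a j z))\<^sup>2 \<partial>\<mu>)"
    by (rule conv_trace_star_mult[OF a S])
  then show ?thesis
    unfolding gns_norm_sq[OF a] by (simp only: of_real_eq_iff)
qed

lemma gns_norm_single_mult_le:
  assumes f: "continuous_on torus f" and b: "b \<in> carrier CA"
  shows "gns_norm (single f k \<otimes>\<^bsub>CA\<^esub> b) \<le> (SUP z\<in>torus. cmod (f z)) * gns_norm b"
proof (rule power2_le_imp_le)
  let ?M = "SUP z\<in>torus. cmod (f z)" and ?T = "{j. b j \<noteq> (\<lambda>z. 0)}"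
  let ?c = "single f k \<otimes>\<^bsub>CA\<^esub> b"
  have "bdd_above ((\<lambda>z. cmod (f z)) ` torus)"
    by (intro bounded_imp_bdd_above compact_imp_bounded compact_continuous_image compact_torus
        continuous_on_norm f)
  then have M: "cmod (f z) \<le> ?M" if "z \<in> torus" for z
    using that by (rule cSUP_upper2) simp
  obtain z0 :: "complex ^ 'd" where "z0 \<in> torus" using torus_nonempty by blast
  then have M0: "0 \<le> ?M" using M[of z0] norm_ge_zero order_trans by blast
  show "0 \<le> ?M * gns_norm b" using M0 b by (simp add: gns_norm_nonneg)
  have c: "?c \<in> carrier CA" using f b by (simp add: single_closed)
  have c_apply: "?c l z = f z * b (l - k) (torus_iter A k z)" if "z \<in> torus" for l z
  proof -
    have "?c l z = (\<Sum>j\<in>{k}. single f k j z * b (l - j) (torus_iter A j z))"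
      using that by (intro conv_mult_apply) (auto simp: single_def)
    then show ?thesis using that by (simp add: single_def torus_extend_def)
  qed
  have supp: "?c l = (\<lambda>z. 0)" if "l \<notin> (\<lambda>i. i + k) ` ?T" for l
  proof
    fix z
    have "b (l - k) = (\<lambda>z. 0)"
    proof (rule ccontr)
      assume "b (l - k) \<noteq> (\<lambda>z. 0)"
      then have "l \<in> (\<lambda>i. i + k) ` ?T" by (intro image_eqI[of _ _ "l - k"]) auto
      then show False using that by simp
    qed
    then show "?c l z = 0" by (cases "z \<in> torus") (simp_all add: c_apply conv_mult_outside)
  qed
  have T: "finite ?T" using b by (rule carrier_finite)
  have "(gns_norm ?c)\<^sup>2 = (\<Sum>l\<in>(\<lambda>i. i + k) ` ?T. \<integral>z. (cmod (?c l z))\<^sup>2 \<partial>\<mu>)"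
    using T supp by (intro gns_norm_sq_eq[OF c]) auto
  also have "\<dots> = (\<Sum>i\<in>?T. \<integral>z. (cmod (?c (i + k) z))\<^sup>2 \<partial>\<mu>)"
    by (subst sum.reindex) (auto simp: inj_on_def)
  also have "\<dots> \<le> (\<Sum>i\<in>?T. ?M\<^sup>2 * (\<integral>z. (cmod (b i z))\<^sup>2 \<partial>\<mu>))"
  proof (rule sum_mono)
    fix i
    have cont: "continuous_on torus (\<lambda>z. (cmod (b i z))\<^sup>2)"
      by (intro continuous_intros carrier_continuous b)
    have "(\<integral>z. (cmod (?c (i + k) z))\<^sup>2 \<partial>\<mu>) \<le> (\<integral>z. ?M\<^sup>2 * (cmod (b i (torus_iter A k z)))\<^sup>2 \<partial>\<mu>)"
    proof (rule integral_mono)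
      show "integrable \<mu> (\<lambda>z. (cmod (?c (i + k) z))\<^sup>2)"
        by (intro integrable_continuous continuous_intros carrier_continuous c)
      show "integrable \<mu> (\<lambda>z. ?M\<^sup>2 * (cmod (b i (torus_iter A k z)))\<^sup>2)"
        by (intro integrable_continuous continuous_on_mult continuous_on_const continuous_on_torus_iter[OF cont])
      show "(cmod (?c (i + k) z))\<^sup>2 \<le> ?M\<^sup>2 * (cmod (b i (torus_iter A k z)))\<^sup>2" if "z \<in> space \<mu>" for z
        using that M[of z] by (auto simp: space_\<mu> c_apply norm_mult power_mult_distrib intro!: mult_right_mono power_mono)
    qed
    also have "\<dots> = ?M\<^sup>2 * (\<integral>z. (cmod (b i z))\<^sup>2 \<partial>\<mu>)"
      using integral_torus_iter[OF cont, of k] by simp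
    finally show "(\<integral>z. (cmod (?c (i + k) z))\<^sup>2 \<partial>\<mu>) \<le> ?M\<^sup>2 * (\<integral>z. (cmod (b i z))\<^sup>2 \<partial>\<mu>)" .
  qed
  also have "\<dots> = (?M * gns_norm b)\<^sup>2"
    using gns_norm_sq_eq[OF b T] by (simp add: power_mult_distrib sum_distrib_left)
  finally show "(gns_norm ?c)\<^sup>2 \<le> (?M * gns_norm b)\<^sup>2" .
qed

text \<open>Left multiplication by the element \<open>a\<^sub>k v\<^sup>k\<close> is a unitary followed by multiplication with
  \<open>a\<^sub>k\<close> (\<open>gns_norm_single_mult_le\<close>), and \<open>a\<close> is the finite sum of these elements.\<close>

lemma gns_norm_mult_le_l1_norm:
  assumes a: "a \<in> carrier CA" and b: "b \<in> carrier CA"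
  shows "gns_norm (a \<otimes>\<^bsub>CA\<^esub> b) \<le> l1_norm a * gns_norm b"
proof -
  \<comment> \<open>The truncation of \<open>a\<close> to \<open>S\<close>, built up one degree at a time.\<close>
  define tr where "tr S = (\<lambda>k. if k \<in> S then a k else (\<lambda>z. 0))" for S :: "int set"
  let ?M = "\<lambda>k. SUP z\<in>torus. cmod (a k z)"
  have ext: "torus_extend (a k) = a k" for k
    using carrier_cont[OF a, of k] by (simp add: torus_cont_def)
  have "tr S \<in> carrier CA \<and> gns_norm (tr S \<otimes>\<^bsub>CA\<^esub> b) \<le> (\<Sum>k\<in>S. ?M k) * gns_norm b" if "finite S" for S
    using that
  proof (induction S rule: finite_induct)
    case empty
    have e: "tr {} = \<zero>\<^bsub>CA\<^esub>" by (simp add: tr_def conv_algebra_def)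
    show ?case unfolding e using b gns_norm_smult[of "\<zero>\<^bsub>CA\<^esub>" 0] by (simp add: smult_zero_left)
  next
    case (insert k S)
    have s: "single (a k) k \<in> carrier CA" by (intro single_closed carrier_continuous a)
    have eq: "tr (insert k S) = single (a k) k \<oplus>\<^bsub>CA\<^esub> tr S"
      using insert(2) by (auto simp: tr_def single_def conv_simps fun_eq_iff ext)
    have "gns_norm (tr (insert k S) \<otimes>\<^bsub>CA\<^esub> b) \<le> gns_norm (single (a k) k \<otimes>\<^bsub>CA\<^esub> b) + gns_norm (tr S \<otimes>\<^bsub>CA\<^esub> b)"
      unfolding eq using insert.IH s b by (simp add: l_distr gns_norm_triangle)
    also have "\<dots> \<le> ?M k * gns_norm b + (\<Sum>k\<in>S. ?M k) * gns_norm b"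
      using insert.IH by (intro add_mono gns_norm_single_mult_le b carrier_continuous a) auto
    finally show ?case
      using insert s by (simp add: eq distrib_right)
  qed
  from this[OF carrier_finite[OF a]]
  have "gns_norm (tr {k. a k \<noteq> (\<lambda>z. 0)} \<otimes>\<^bsub>CA\<^esub> b) \<le> l1_norm a * gns_norm b"
    by (simp add: l1_norm_def)
  moreover have "tr {k. a k \<noteq> (\<lambda>z. 0)} = a"
    by (auto simp: tr_def fun_eq_iff)
  ultimately show ?thesis by simp
qed

sublocale bounded_star_algebra_state CA conv_trace
  by unfold_locales (use gns_norm_mult_le_l1_norm in blast)

text \<open>The GNS seminorm of the trace is dominated by the 1-norm, hence is one of the seminorms whose
  supremum is the universal norm. This estimate is what extends the trace to the completion.\<close>

lemma conv_trace_le_universal_norm: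
  assumes a: "a \<in> carrier CA" shows "cmod (conv_trace a) \<le> universal_norm A a"
proof -
  have "gns_op_norm b \<le> l1_norm b" if b: "b \<in> carrier CA" for b
  proof (rule gns_op_norm_le)
    have "0 \<le> l1_norm b"
      using zero_l1_seminorm[of A] b by blast
    then show "0 \<le> l1_norm b" .
  qed (use b gns_norm_mult_le_l1_norm in blast)
  then have "gns_op_norm a \<le> universal_norm A a"
    using cstar_seminorm_gns_op_norm a by (intro universal_norm_upper) auto
  then show ?thesis using state_le_gns_op_norm[OF a] by simp
qed

definition crossed_trace :: "(nat \<Rightarrow> int \<Rightarrow> complex ^ 'd \<Rightarrow> complex) set \<Rightarrow> complex"
  where "crossed_trace = extend_functional conv_trace"

lemma crossed_trace_embed: "a \<in> carrier CA \<Longrightarrow> crossed_trace (cp_embed A a) = conv_trace a"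
  unfolding crossed_trace_def cp_embed_def
  by (rule extend_functional_const[OF tracial_state_conv_trace conv_trace_le_universal_norm])

lemma invariant_trace_crossed_trace: "invariant_trace A crossed_trace"
  unfolding invariant_trace_def crossed_product_def
proof (intro conjI allI ballI)
  note T = tracial_state_conv_trace conv_trace_le_universal_norm
  show "tracial_state (completion CA (universal_norm A)) crossed_trace"
    unfolding crossed_trace_def by (rule tracial_state_extend_functional[OF T])
  fix t x assume "x \<in> carrier (completion CA (universal_norm A))"
  then obtain X where X: "X \<in> cauchy_seqs CA (universal_norm A)" "x = cls X"
    by (rule completion_cases)
  have "conv_trace (gauge_conv t a) = conv_trace a" for a
    by (simp add: conv_trace_def gauge_conv_def)
  then have "(\<lambda>n. conv_trace (gauge_conv t (X n))) \<longlonglongrightarrow> crossed_trace x"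
    unfolding crossed_trace_def X(2) using extend_functional_cls[OF T X(1)] by simp
  then show "crossed_trace (dual_action A t x) = crossed_trace x"
    unfolding X(2) dual_action_cls(2)[OF X(1)] crossed_trace_def
    by (intro extend_functional_eqI[OF T dual_action_cls(1)[OF X(1)]])
qed

lemma crossed_trace_u_v:
  "crossed_trace (u_bar A m \<otimes>\<^bsub>crossed_product A\<^esub> v_bar A [^]\<^bsub>crossed_product A\<^esub> (k :: int)) =
    (if k = 0 then \<integral>z. torus_char m z \<partial>\<mu> else 0)"
proof -
  have "crossed_trace (u_bar A m \<otimes>\<^bsub>crossed_product A\<^esub> v_bar A [^]\<^bsub>crossed_product A\<^esub> k) =
      conv_trace (single (torus_char m) k)"
    unfolding u_bar_v_bar_power by (intro crossed_trace_embed single_closed continuous_torus_char)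
  also have "\<dots> = (\<integral>z. (if k = 0 then torus_char m z else 0) \<partial>\<mu>)"
    unfolding conv_trace_def
    by (intro Bochner_Integration.integral_cong refl) (simp add: space_\<mu> single_def torus_extend_def)
  finally show ?thesis by simp
qed

end

section \<open>The measure of an invariant trace\<close>

locale invariant_tracial_state = unimodular A for A :: "int ^ 'd ^ 'd" +
  fixes \<psi> :: "(nat \<Rightarrow> int \<Rightarrow> complex ^ 'd \<Rightarrow> complex) set \<Rightarrow> complex"
  assumes invariant: "invariant_trace A \<psi>"
begin

lemma trace_add: "x \<in> carrier (crossed_product A) \<Longrightarrow> y \<in> carrier (crossed_product A) \<Longrightarrow>
    \<psi> (x \<oplus>\<^bsub>crossed_product A\<^esub> y) = \<psi> x + \<psi> y"
  and trace_smult: "x \<in> carrier (crossed_product A) \<Longrightarrow> \<psi> (c \<odot>\<^bsub>crossed_product A\<^esub> x) = c * \<psi> x"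
  and trace_pos: "x \<in> carrier (crossed_product A) \<Longrightarrow>
    \<psi> (star (crossed_product A) x \<otimes>\<^bsub>crossed_product A\<^esub> x) \<in> \<real>\<^sub>\<ge>\<^sub>0"
  and trace_one: "\<psi> \<one>\<^bsub>crossed_product A\<^esub> = 1"
  and trace_commute: "x \<in> carrier (crossed_product A) \<Longrightarrow> y \<in> carrier (crossed_product A) \<Longrightarrow>
    \<psi> (x \<otimes>\<^bsub>crossed_product A\<^esub> y) = \<psi> (y \<otimes>\<^bsub>crossed_product A\<^esub> x)"
  and trace_dual_action: "x \<in> carrier (crossed_product A) \<Longrightarrow> \<psi> (dual_action A t x) = \<psi> x"
  using invariant by (auto simp: invariant_trace_def tracial_state_def)

lemma trace_embed_commute:
  "a \<in> carrier CA \<Longrightarrow> b \<in> carrier CA \<Longrightarrow>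
    \<psi> (cp_embed A (a \<otimes>\<^bsub>CA\<^esub> b)) = \<psi> (cp_embed A (b \<otimes>\<^bsub>CA\<^esub> a))"
  using trace_commute[of "cp_embed A a" "cp_embed A b"] by (simp add: cp_embed_closed cp_embed_mult)

definition fun_trace :: "(complex ^ 'd \<Rightarrow> complex) \<Rightarrow> complex"
  where "fun_trace f = \<psi> (cp_embed A (single f 0))"

lemma fun_trace_cong: "(\<And>z. z \<in> torus \<Longrightarrow> f z = g z) \<Longrightarrow> fun_trace f = fun_trace g"
  unfolding fun_trace_def
  by (rule arg_cong[of _ _ "\<lambda>a. \<psi> (cp_embed A a)"]) (auto simp: single_def torus_extend_def fun_eq_iff)

lemma fun_trace_add:
  assumes f: "continuous_on torus f" and g: "continuous_on torus g"
  shows "fun_trace (\<lambda>z. f z + g z) = fun_trace f + fun_trace g"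
proof -
  have "single (\<lambda>z. f z + g z) 0 = single f 0 \<oplus>\<^bsub>CA\<^esub> single g 0"
    by (auto simp: single_def torus_extend_def conv_simps fun_eq_iff)
  then show ?thesis
    using f g by (simp add: fun_trace_def single_closed trace_add cp_embed_closed flip: cp_embed_add)
qed

lemma fun_trace_scale:
  assumes f: "continuous_on torus f" shows "fun_trace (\<lambda>z. c * f z) = c * fun_trace f"
proof -
  have "single (\<lambda>z. c * f z) 0 = (\<lambda>k z. c * single f 0 k z)"
    by (auto simp: single_def torus_extend_def fun_eq_iff)
  then show ?thesis
    using f by (simp add: fun_trace_def single_closed trace_smult cp_embed_closed flip: smult_embed)
qed

lemma fun_trace_one: "fun_trace (\<lambda>z. 1) = 1"
  using trace_one by (simp add: fun_trace_def cp_embed_one)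

text \<open>A nonnegative function is the square of the selfadjoint element \<open>sqrt f\<close>.\<close>

lemma fun_trace_nonneg:
  assumes f: "continuous_on torus f" and pos: "\<And>z. z \<in> torus \<Longrightarrow> 0 \<le> f z"
  shows "fun_trace (\<lambda>z. complex_of_real (f z)) \<in> \<real>\<^sub>\<ge>\<^sub>0"
proof -
  define g where "g = (\<lambda>z. complex_of_real (sqrt (f z)))"
  have g: "continuous_on torus g" unfolding g_def by (intro continuous_intros f)
  have "star CA (single g 0) \<otimes>\<^bsub>CA\<^esub> single g 0 = single (\<lambda>z. complex_of_real (f z)) 0"
  proof -
    have "star CA (single g 0) = single g 0"
      by (auto simp: conv_star_apply single_def torus_extend_def torus_iter_0 fun_eq_iff g_def)
    moreover have "single g 0 \<otimes>\<^bsub>CA\<^esub> single g 0 = single (\<lambda>z. complex_of_real (f z)) 0"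
      unfolding single_mult using pos
      by (auto simp: single_def torus_extend_def alpha_apply torus_iter_0 fun_eq_iff g_def
          simp flip: of_real_mult)
    ultimately show ?thesis by simp
  qed
  then show ?thesis
    unfolding fun_trace_def
    using trace_pos[OF cp_embed_closed[OF single_closed[OF g]], of 0] single_closed[OF g, of 0 A]
    by (simp add: cp_embed_star cp_embed_mult)
qed

definition real_trace :: "(complex ^ 'd \<Rightarrow> real) \<Rightarrow> real"
  where "real_trace f = Re (fun_trace (\<lambda>z. complex_of_real (f z)))"

lemma positive_functional_real_trace: "positive_functional torus real_trace"
proof
  show "compact (torus :: (complex ^ 'd) set)" by (rule compact_torus)
  show *: "real_trace (\<lambda>z. f z + g z) = real_trace f + real_trace g"
    if "continuous_on torus f" "continuous_on torus g" for f g
    using that fun_trace_add[of "\<lambda>z. complex_of_real (f z)" "\<lambda>z. complex_of_real (g z)"]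
    by (simp add: real_trace_def continuous_on_of_real)
  show "real_trace (\<lambda>z. c * f z) = c * real_trace f" if "continuous_on torus f" for f c
    using that fun_trace_scale[of "\<lambda>z. complex_of_real (f z)" "complex_of_real c"]
    by (simp add: real_trace_def continuous_on_of_real)
  show "real_trace f \<le> real_trace g"
    if c: "continuous_on torus f" "continuous_on torus g" and le: "\<And>z. z \<in> torus \<Longrightarrow> f z \<le> g z" for f g
  proof -
    have "continuous_on torus (\<lambda>z. g z - f z)" using c by (intro continuous_intros)
    then have "0 \<le> real_trace (\<lambda>z. g z - f z)"
      using fun_trace_nonneg[of "\<lambda>z. g z - f z"] le
      by (simp add: real_trace_def complex_nonneg_Reals_iff)
    moreover have "real_trace (\<lambda>z. f z + (g z - f z)) = real_trace f + real_trace (\<lambda>z. g z - f z)"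
      using c by (intro * continuous_intros)
    ultimately show ?thesis by simp
  qed
qed

text \<open>Adding a constant makes \<open>f\<close> nonnegative, and the trace of a constant is that constant.\<close>

lemma fun_trace_of_real:
  assumes f: "continuous_on torus f"
  shows "fun_trace (\<lambda>z. complex_of_real (f z)) = complex_of_real (real_trace f)"
proof -
  have "bounded (f ` torus)"
    using compact_continuous_image[OF f compact_torus] by (rule compact_imp_bounded)
  then obtain B where B: "\<And>z. z \<in> torus \<Longrightarrow> \<bar>f z\<bar> \<le> B"
    unfolding bounded_iff by auto
  have "fun_trace (\<lambda>z. complex_of_real (f z + B)) \<in> \<real>\<^sub>\<ge>\<^sub>0"
  proof (rule fun_trace_nonneg)
    show "0 \<le> f z + B" if "z \<in> torus" for z using B[OF that] by linarith
  qed (intro continuous_intros f)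
  moreover have "fun_trace (\<lambda>z. complex_of_real (f z + B)) =
      fun_trace (\<lambda>z. complex_of_real (f z)) + complex_of_real B"
    using fun_trace_add[of "\<lambda>z. complex_of_real (f z)" "\<lambda>z. complex_of_real B"] f
      fun_trace_scale[of "\<lambda>z. 1" "complex_of_real B"]
    by (simp add: continuous_on_of_real fun_trace_one)
  ultimately have "Im (fun_trace (\<lambda>z. complex_of_real (f z))) = 0"
    by (simp add: complex_nonneg_Reals_iff)
  then show ?thesis by (simp add: real_trace_def complex_eq_iff)
qed

text \<open>By covariance \<open>f \<circ> \<sigma>\<close> is \<open>v f v\<^sup>*\<close>, and a trace is constant on unitary conjugates.\<close>

lemma fun_trace_torus_map:
  assumes f: "continuous_on torus f"
  shows "fun_trace (\<lambda>z. f (torus_map A z)) = fun_trace f"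
proof -
  let ?v = "single (\<lambda>z. 1) 1" and ?w = "single (\<lambda>z. 1) (- 1)"
  have c: "single f 0 \<in> carrier CA" using f by (rule single_closed)
  have "single (\<lambda>z. f (torus_map A z)) 0 = ?v \<otimes>\<^bsub>CA\<^esub> (single f 0 \<otimes>\<^bsub>CA\<^esub> ?w)"
    unfolding single_mult_unitary unfolding single_mult
    by (auto simp: single_def fun_eq_iff torus_extend_def alpha_apply torus_map_in torus_iter_1)
  then have "fun_trace (\<lambda>z. f (torus_map A z)) = \<psi> (cp_embed A (single f 0 \<otimes>\<^bsub>CA\<^esub> ?w \<otimes>\<^bsub>CA\<^esub> ?v))"
    unfolding fun_trace_def
    using trace_embed_commute[OF single_one_closed m_closed[OF c single_one_closed]] by simp
  also have "\<dots> = fun_trace f"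
    by (simp add: single_mult_unitary fun_trace_def)
  finally show ?thesis .
qed

text \<open>At time \<open>t = \<pi> / k\<close> the action multiplies \<open>f v\<^sup>k\<close> by \<open>exp (\<i> \<pi>) = - 1\<close>, so an invariant trace
  takes there a value equal to its own negative.\<close>

lemma trace_single_off_diagonal:
  assumes f: "continuous_on torus f" and k: "k \<noteq> 0"
  shows "\<psi> (cp_embed A (single f k)) = 0"
proof -
  let ?t = "pi / real_of_int k"
  have c: "single f k \<in> carrier CA" using f by (rule single_closed)
  have "\<i> * of_int k * complex_of_real ?t = \<i> * complex_of_real pi"
    using k by simp
  then have "gauge_conv ?t (single f k) = (\<lambda>j z. (- 1) * single f k j z)"
    by (auto simp: gauge_conv_def single_def fun_eq_iff)
  then have "dual_action A ?t (cp_embed A (single f k)) = (- 1) \<odot>\<^bsub>crossed_product A\<^esub> cp_embed A (single f k)"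
    by (simp only: dual_action_embed[OF c] smult_embed[OF c])
  then have "\<psi> (cp_embed A (single f k)) = - \<psi> (cp_embed A (single f k))"
    using trace_dual_action[OF cp_embed_closed[OF c], of ?t] trace_smult[OF cp_embed_closed[OF c], of "-1"]
    by simp
  then show ?thesis by simp
qed

theorem ex_representing_measure:
  "\<exists>\<mu>. torus_prob \<mu> \<and> torus_pushforward A \<mu> = \<mu> \<and>
    (\<forall>m k. \<psi> (u_bar A m \<otimes>\<^bsub>crossed_product A\<^esub> v_bar A [^]\<^bsub>crossed_product A\<^esub> (k :: int)) =
      (if k = 0 then \<integral>z. torus_char m z \<partial>\<mu> else 0))"
proof -
  interpret L: positive_functional torus real_trace
    by (rule positive_functional_real_trace)
  obtain \<mu> where sets: "sets \<mu> = sets (restrict_space borel torus)" and "finite_measure \<mu>"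
    and int: "\<And>f. continuous_on torus f \<Longrightarrow> integrable \<mu> f \<and> (\<integral>z. f z \<partial>\<mu>) = real_trace f"
    by (rule L.riesz_representation) blast
  interpret \<mu>: finite_measure \<mu> by fact
  have space: "space \<mu> = torus"
    using sets_eq_imp_space_eq[OF sets] by (simp add: space_restrict_space)
  have "measure \<mu> (space \<mu>) = 1"
    using int[of "\<lambda>z. 1"] by (simp add: real_trace_def fun_trace_one)
  then have prob: "prob_space \<mu>"
    by (intro prob_spaceI) (simp add: \<mu>.emeasure_eq_measure)
  have meas: "torus_map A \<in> measurable \<mu> (restrict_space borel torus)"
  proof (rule measurable_restrict_space2)
    show "torus_map A \<in> space \<mu> \<rightarrow> torus" by (auto simp: space torus_map_in)
    show "torus_map A \<in> borel_measurable \<mu>"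
      using borel_measurable_continuous_on_restrict[OF continuous_torus_map, of A]
        measurable_cong_sets[OF sets refl] by blast
  qed
  have "torus_pushforward A \<mu> = \<mu>"
  proof (rule measure_eqI_continuous[OF compact_imp_closed[OF compact_torus] _ _ sets \<mu>.finite_measure_axioms])
    show "sets (torus_pushforward A \<mu>) = sets (restrict_space borel torus)"
      by (simp add: torus_pushforward_def)
    show "finite_measure (torus_pushforward A \<mu>)"
      unfolding torus_pushforward_def by (rule \<mu>.finite_measure_distr[OF meas])
    fix f :: "complex ^ 'd \<Rightarrow> real" assume f: "continuous_on torus f"
    have fA: "continuous_on torus (\<lambda>z. f (torus_map A z))"
      by (rule continuous_on_compose2[OF f continuous_torus_map]) (auto simp: torus_map_in)
    have "(\<integral>z. f z \<partial>torus_pushforward A \<mu>) = (\<integral>z. f (torus_map A z) \<partial>\<mu>)"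
      unfolding torus_pushforward_def
      by (rule integral_distr[OF meas borel_measurable_continuous_on_restrict[OF f]])
    also have "\<dots> = real_trace (\<lambda>z. f (torus_map A z))" using int[OF fA] by simp
    also have "\<dots> = real_trace f"
      using fun_trace_torus_map[of "\<lambda>z. complex_of_real (f z)"] f
      by (simp add: real_trace_def continuous_on_of_real)
    also have "\<dots> = (\<integral>z. f z \<partial>\<mu>)" using int[OF f] by simp
    finally show "(\<integral>z. f z \<partial>torus_pushforward A \<mu>) = (\<integral>z. f z \<partial>\<mu>)" .
  qed
  moreover have "\<psi> (u_bar A m \<otimes>\<^bsub>crossed_product A\<^esub> v_bar A [^]\<^bsub>crossed_product A\<^esub> (k :: int)) =
      (if k = 0 then \<integral>z. torus_char m z \<partial>\<mu> else 0)" for m k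
  proof (cases "k = 0")
    case True
    let ?f = "torus_char m"
    have f: "continuous_on torus (\<lambda>z. Re (?f z))" "continuous_on torus (\<lambda>z. Im (?f z))"
      by (intro continuous_intros continuous_torus_char)+
    have "fun_trace ?f = fun_trace (\<lambda>z. complex_of_real (Re (?f z)) + \<i> * complex_of_real (Im (?f z)))"
      by (rule fun_trace_cong) (simp add: complex_eq_iff)
    also have "\<dots> = complex_of_real (real_trace (\<lambda>z. Re (?f z))) + \<i> * complex_of_real (real_trace (\<lambda>z. Im (?f z)))"
      using f by (simp add: fun_trace_add fun_trace_scale fun_trace_of_real continuous_on_of_real continuous_on_mult)
    also have "\<dots> = (\<integral>z. complex_of_real (Re (?f z)) + \<i> * complex_of_real (Im (?f z)) \<partial>\<mu>)"
      using int[OF f(1)] int[OF f(2)] by simp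
    also have "\<dots> = (\<integral>z. ?f z \<partial>\<mu>)"
      by (intro Bochner_Integration.integral_cong refl) (simp add: complex_eq_iff)
    finally show ?thesis
      unfolding u_bar_v_bar_power using True by (simp add: fun_trace_def)
  next
    case False
    then show ?thesis
      unfolding u_bar_v_bar_power
      by (simp add: trace_single_off_diagonal continuous_torus_char)
  qed
  ultimately show ?thesis
    using prob sets unfolding torus_prob_def by blast
qed

end

theorem proposition10p4:
  fixes A :: "int ^ 'd ^ 'd"
  assumes "\<bar>det A\<bar> = 1"
  shows "(\<forall>\<mu>. torus_prob \<mu> \<and> torus_pushforward A \<mu> = \<mu> \<longrightarrow>
      (\<exists>\<psi>. invariant_trace A \<psi> \<and>
        (\<forall>m k. \<psi> (u_bar A m \<otimes>\<^bsub>crossed_product A\<^esub> v_bar A [^]\<^bsub>crossed_product A\<^esub> (k :: int)) =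
          (if k = 0 then \<integral>z. torus_char m z \<partial>\<mu> else 0)))) \<and>
    (\<forall>\<psi>. invariant_trace A \<psi> \<longrightarrow>
      (\<exists>\<mu>. torus_prob \<mu> \<and> torus_pushforward A \<mu> = \<mu> \<and>
        (\<forall>m k. \<psi> (u_bar A m \<otimes>\<^bsub>crossed_product A\<^esub> v_bar A [^]\<^bsub>crossed_product A\<^esub> (k :: int)) =
          (if k = 0 then \<integral>z. torus_char m z \<partial>\<mu> else 0))))"
proof (intro conjI allI impI)
  fix \<mu> :: "(complex ^ 'd) measure"
  assume "torus_prob \<mu> \<and> torus_pushforward A \<mu> = \<mu>"
  then interpret invariant_measure A \<mu>
    using assms by unfold_locales auto
  show "\<exists>\<psi>. invariant_trace A \<psi> \<and>
        (\<forall>m k. \<psi> (u_bar A m \<otimes>\<^bsub>crossed_product A\<^esub> v_bar A [^]\<^bsub>crossed_product A\<^esub> (k :: int)) =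
          (if k = 0 then \<integral>z. torus_char m z \<partial>\<mu> else 0))"
    using invariant_trace_crossed_trace crossed_trace_u_v by blast
next
  fix \<psi> :: "(nat \<Rightarrow> int \<Rightarrow> complex ^ 'd \<Rightarrow> complex) set \<Rightarrow> complex"
  assume "invariant_trace A \<psi>"
  then interpret invariant_tracial_state A \<psi>
    using assms by unfold_locales
  show "\<exists>\<mu>. torus_prob \<mu> \<and> torus_pushforward A \<mu> = \<mu> \<and>
        (\<forall>m k. \<psi> (u_bar A m \<otimes>\<^bsub>crossed_product A\<^esub> v_bar A [^]\<^bsub>crossed_product A\<^esub> (k :: int)) =
          (if k = 0 then \<integral>z. torus_char m z \<partial>\<mu> else 0))"
    by (rule ex_representing_measure)
qed

end
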